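(* Let $T>0$ and, for $k\in\mathbb Z^2_0=\mathbb Z^2\setminus\{0\}$, let $\sigma_k(x)=e^{2\pi ik\cdot x}\,\dfrac{k^\perp}{|k|^2}$, $x\in\mathbb T^2$. Let $\rho_0\in C_b(H^{-1-}(\mathbb T^2))$, $\rho_0\ge0$, $\int\rho_0\,d\mu=1$, and let $\rho:[0,T]\times H^{-1-}(\mathbb T^2)\to[0,\|\rho_0\|_\infty]$, $\rho_t=\rho(t,\cdot)$, be measurable with $\int\rho_t\,d\mu=1$ for every $t$. Assume that for every $k\in\mathbb Z_0^2$ the derivative $\langle\sigma_k\cdot\nabla\omega,D_\omega\rho_t\rangle$ exists in the distributional sense and that the gradient estimate $$\sum_{k\in\mathbb Z^2_0}\int_0^T\!\!\int|\langle\sigma_k\cdot\nabla\omega,D_\omega\rho_t(\omega)\rangle|^2\,\mu(d\omega)dt\le\|\rho_0\|_\infty^2$$ holds. Then the series $$2\pi i\sum_{k\in\mathbb Z_0^2}\langle\omega,e^{2\pi ik\cdot x}\rangle\,\langle\sigma_k\cdot\nabla\omega,D_\omega\rho_t\rangle$$ (which defines $\langle b(\omega),D_\omega\rho_t\rangle$) converges in $L^2([0,T]\times H^{-1-}(\mathbb T^2),dt\otimes\mu)$, where convergence refers to the partial sums over $0<|k|\le N$ as $N\to\infty$.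
   Context: $\mathbb T^2=\mathbb R^2/\mathbb Z^2$; $k^\perp=(k_2,-k_1)$. $\langle\cdot,\cdot\rangle$ is the duality between $C^\infty(\mathbb T^2)'$ and $C^\infty(\mathbb T^2)$, extended complex-bilinearly to complex-valued test functions. $H^{-1-}(\mathbb T^2)=\bigcap_{\delta>0}H^{-1-\delta}(\mathbb T^2)$ with the Fréchet topology of all the norms $\|\cdot\|_{H^{-1-\delta}}$. $\mu$ is the law on $H^{-1-}(\mathbb T^2)$ of (real) white noise: the centered Gaussian random distribution with $\mathbb E[\langle\omega,\phi\rangle\langle\omega,\psi\rangle]=\int\phi\psi\,dx$ for real smooth $\phi,\psi$. $\mathcal{FC}_P$ is the set of functionals $G(\omega)=g(\langle\omega,\phi_1\rangle,\dots,\langle\omega,\phi_n\rangle)$ with $n\in\mathbb N$, $\phi_j\in C^\infty(\mathbb T^2)$ and $g$ smooth on $\mathbb R^n$ with polynomial growth together with all derivatives; $D_\omega G=\sum_j\partial_jg(\langle\omega,\phi_1\rangle,\dots,\langle\omega,\phi_n\rangle)\phi_j$. $\mathcal{FC}_{P,T}$ is the set of finite sums $F(t,\omega)=\sum_ig_i(t)f_i(\omega)$, $g_i\in C^1([0,T])$, $f_i\in\mathcal{FC}_P$. By definition $\langle\sigma_k\cdot\nabla\omega,\phi\rangle:=-\langle\omega,\sigma_k\cdot\nabla\phi\rangle$ (note $\mathrm{div}\,\sigma_k=0$). "$\langle\sigma_k\cdot\nabla\omega,D_\omega\rho_t\rangle$ exists in the distributional sense" means that there is a (complex-valued) $G_k\in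 L^2([0,T]\times H^{-1-},dt\otimes\mu)$ with $$\int_0^T\!\!\int G_kF\,d\mu\,dt=-\int_0^T\!\!\int\rho_t(\omega)\langle\sigma_k\cdot\nabla\omega,D_\omega F(t,\omega)\rangle\,d\mu\,dt\qquad\text{for all }F\in\mathcal{FC}_{P,T},$$ and then $\langle\sigma_k\cdot\nabla\omega,D_\omega\rho_t\rangle:=G_k(t,\omega)$. *)

theory Defs
  imports "HOL-Probability.Probability"
begin

text \<open>Functions on the torus are \<open>\<int>\<^sup>2\<close>-periodic functions on \<^typ>\<open>real^2\<close>; frequencies
  have type \<^typ>\<open>int^2\<close>.\<close>

definition real_freq :: "int^2 \<Rightarrow> real^2" where
  "real_freq k = (\<chi> i. real_of_int (k $ i))"

definition perp :: "int^2 \<Rightarrow> real^2" where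
  "perp k = vector [real_of_int (k $ 2), - real_of_int (k $ 1)]"

definition fourier_mode :: "int^2 \<Rightarrow> real^2 \<Rightarrow> complex" where
  "fourier_mode k x = exp (2 * of_real pi * \<i> * of_real (real_freq k \<bullet> x))"

definition sigma_field :: "int^2 \<Rightarrow> real^2 \<Rightarrow> complex^2" where
  "sigma_field k x =
     (\<chi> i. fourier_mode k x * of_real (perp k $ i / (norm (real_freq k))\<^sup>2))"


subsection \<open>Smooth functions on the torus and their dual\<close>

definition partial_torus :: "2 \<Rightarrow> (real^2 \<Rightarrow> real) \<Rightarrow> real^2 \<Rightarrow> real" where
  "partial_torus i \<phi> x = deriv (\<lambda>h. \<phi> (x + h *\<^sub>R axis i 1)) 0"

text \<open>A list of indices stands for the corresponding iterated partial derivative. A function is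
  smooth iff all its iterated partial derivatives exist and are continuous; existence has to be
  required explicitly since \<^const>\<open>deriv\<close> is total.\<close>

definition smooth_torus :: "(real^2 \<Rightarrow> real) set" where
  "smooth_torus = {\<phi>.
     (\<forall>x (m :: int^2). \<phi> (x + real_freq m) = \<phi> x) \<and>
     (\<forall>\<alpha>. continuous_on UNIV (foldr partial_torus \<alpha> \<phi>) \<and>
          (\<forall>i x. (\<lambda>h. foldr partial_torus \<alpha> \<phi> (x + h *\<^sub>R axis i 1)) differentiable at 0))}"

type_synonym functional = "(real^2 \<Rightarrow> real) \<Rightarrow> real"

text \<open>Real distributions on the torus: linear functionals bounded by one of the seminorms that
  define the topology of the test functions. They are set to \<open>0\<close> off the test functions, so that
  equality of distributions is equality in HOL.\<close>

definition distributions :: "functional set" where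
  "distributions = {\<omega>.
     (\<forall>\<phi>\<in>smooth_torus. \<forall>\<psi>\<in>smooth_torus. \<forall>a b.
        \<omega> (\<lambda>x. a * \<phi> x + b * \<psi> x) = a * \<omega> \<phi> + b * \<omega> \<psi>) \<and>
     (\<exists>C m. \<forall>\<phi>\<in>smooth_torus.
        \<bar>\<omega> \<phi>\<bar> \<le> C * (\<Sum>\<alpha> | length \<alpha> \<le> m. SUP x. \<bar>foldr partial_torus \<alpha> \<phi> x\<bar>)) \<and>
     (\<forall>\<phi>. \<phi> \<notin> smooth_torus \<longrightarrow> \<omega> \<phi> = 0)}"

text \<open>The complex-bilinear extension of the duality to complex test functions.\<close>

definition cpair :: "functional \<Rightarrow> (real^2 \<Rightarrow> complex) \<Rightarrow> complex" where
  "cpair \<omega> \<psi> = Complex (\<omega> (\<lambda>x. Re (\<psi> x))) (\<omega> (\<lambda>x. Im (\<psi> x)))"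

text \<open>The duality of \<open>\<sigma>\<^sub>k \<cdot> \<nabla>\<omega>\<close> with \<open>\<phi>\<close>.\<close>

definition transport_pair :: "int^2 \<Rightarrow> functional \<Rightarrow> (real^2 \<Rightarrow> real) \<Rightarrow> complex" where
  "transport_pair k \<omega> \<phi> =
     - cpair \<omega> (\<lambda>x. \<Sum>i\<in>UNIV. sigma_field k x $ i * of_real (partial_torus i \<phi> x))"


subsection \<open>Sobolev spaces of distributions\<close>

definition sobolev_term :: "real \<Rightarrow> functional \<Rightarrow> int^2 \<Rightarrow> real" where
  "sobolev_term s \<omega> k =
     (1 + (norm (real_freq k))\<^sup>2) powr s * (cmod (cpair \<omega> (fourier_mode (- k))))\<^sup>2"

definition sobolev :: "real \<Rightarrow> functional set" where
  "sobolev s = {\<omega> \<in> distributions. sobolev_term s \<omega> summable_on UNIV}"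

definition sobolev_norm :: "real \<Rightarrow> functional \<Rightarrow> real" where
  "sobolev_norm s \<omega> = sqrt (\<Sum>\<^sub>\<infinity>k. sobolev_term s \<omega> k)"

definition Hminus :: "functional set" where
  "Hminus = (\<Inter>\<delta>\<in>{0<..}. sobolev (- 1 - \<delta>))"

definition Hminus_topology :: "functional topology" where
  "Hminus_topology = topology_generated_by
     {{\<eta> \<in> Hminus. sobolev_norm (- 1 - \<delta>) (\<lambda>\<phi>. \<eta> \<phi> - \<omega> \<phi>) < r} |\<delta> r \<omega>.
        \<delta> > 0 \<and> r > 0 \<and> \<omega> \<in> Hminus}"

definition Hminus_borel :: "functional measure" where
  "Hminus_borel = sigma Hminus {U. openin Hminus_topology U}"

definition Hminus_sup_norm :: "(functional \<Rightarrow> real) \<Rightarrow> real" where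
  "Hminus_sup_norm f = (SUP \<omega>\<in>Hminus. \<bar>f \<omega>\<bar>)"


subsection \<open>White noise\<close>

text \<open>The first alternative is the degenerate Gaussian law of variance \<open>0\<close>.\<close>

definition centered_gaussian :: "'a measure \<Rightarrow> ('a \<Rightarrow> real) \<Rightarrow> bool" where
  "centered_gaussian M X \<longleftrightarrow> X \<in> borel_measurable M \<and>
     ((AE \<omega> in M. X \<omega> = 0) \<or>
      (\<exists>s>0. distributed M lborel X (\<lambda>x. ennreal (normal_density 0 s x))))"

definition white_noise_law :: "functional measure \<Rightarrow> bool" where
  "white_noise_law \<mu> \<longleftrightarrow> prob_space \<mu> \<and> space \<mu> = Hminus \<and> sets \<mu> = sets Hminus_borel \<and>
     (\<forall>\<Phi> c. finite \<Phi> \<and> \<Phi> \<subseteq> smooth_torus \<longrightarrow>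
        centered_gaussian \<mu> (\<lambda>\<omega>. \<Sum>\<phi>\<in>\<Phi>. c \<phi> * \<omega> \<phi>)) \<and>
     (\<forall>\<phi>\<in>smooth_torus. \<forall>\<psi>\<in>smooth_torus.
        (LINT \<omega>|\<mu>. \<omega> \<phi> * \<omega> \<psi>) = (LINT x:cbox 0 1|lborel. \<phi> x * \<psi> x))"


subsection \<open>Cylinder functionals\<close>

text \<open>Since the number \<open>n\<close> of variables varies, a function on \<open>\<real>\<^sup>n\<close> is a function on
  \<^typ>\<open>nat \<Rightarrow> real\<close> that depends on the coordinates \<open>0, \<dots>, n - 1\<close> only. For such functions
  continuity in the product topology is continuity on \<open>\<real>\<^sup>n\<close>.\<close>

definition partial_coord :: "nat \<Rightarrow> ((nat \<Rightarrow> real) \<Rightarrow> real) \<Rightarrow> (nat \<Rightarrow> real) \<Rightarrow> real" where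
  "partial_coord j g x = deriv (\<lambda>h. g (x(j := x j + h))) 0"

definition smooth_poly_growth :: "nat \<Rightarrow> ((nat \<Rightarrow> real) \<Rightarrow> real) set" where
  "smooth_poly_growth n = {g.
     (\<forall>x y. (\<forall>j<n. x j = y j) \<longrightarrow> g x = g y) \<and>
     (\<forall>\<alpha>. set \<alpha> \<subseteq> {..<n} \<longrightarrow>
        continuous_on UNIV (foldr partial_coord \<alpha> g) \<and>
        (\<forall>j<n. \<forall>x. (\<lambda>h. foldr partial_coord \<alpha> g (x(j := x j + h))) differentiable at 0) \<and>
        (\<exists>C m. \<forall>x. \<bar>foldr partial_coord \<alpha> g x\<bar> \<le> C * (1 + (\<Sum>j<n. \<bar>x j\<bar>)) ^ m))}"

definition cylinder :: "nat \<Rightarrow> ((nat \<Rightarrow> real) \<Rightarrow> real) \<Rightarrow> (nat \<Rightarrow> real^2 \<Rightarrow> real) \<Rightarrow>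
    functional \<Rightarrow> real" where
  "cylinder n g \<phi> \<omega> = g (\<lambda>j. if j < n then \<omega> (\<phi> j) else 0)"

definition cylinder_gradient :: "nat \<Rightarrow> ((nat \<Rightarrow> real) \<Rightarrow> real) \<Rightarrow> (nat \<Rightarrow> real^2 \<Rightarrow> real) \<Rightarrow>
    functional \<Rightarrow> real^2 \<Rightarrow> real" where
  "cylinder_gradient n g \<phi> \<omega> x =
     (\<Sum>j<n. partial_coord j g (\<lambda>j. if j < n then \<omega> (\<phi> j) else 0) * \<phi> j x)"

text \<open>As \<open>D\<^sub>\<omega>\<close> is given by the representation of a functional, the classes of test functionals
  are sets of pairs of a functional and its gradient. (On \<^const>\<open>Hminus\<close> the gradient does not
  depend on the representation.)\<close>

definition FC_P :: "((functional \<Rightarrow> real) \<times> (functional \<Rightarrow> real^2 \<Rightarrow> real)) set" where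
  "FC_P = {(cylinder n g \<phi>, cylinder_gradient n g \<phi>) |n g \<phi>.
     g \<in> smooth_poly_growth n \<and> (\<forall>j<n. \<phi> j \<in> smooth_torus)}"

definition C1_interval :: "real \<Rightarrow> (real \<Rightarrow> real) set" where
  "C1_interval T = {c. \<exists>c'. continuous_on {0..T} c' \<and>
     (\<forall>t\<in>{0..T}. (c has_real_derivative c' t) (at t within {0..T}))}"

definition FC_PT :: "real \<Rightarrow>
    ((real \<Rightarrow> functional \<Rightarrow> real) \<times> (real \<Rightarrow> functional \<Rightarrow> real^2 \<Rightarrow> real)) set" where
  "FC_PT T = {(\<lambda>t \<omega>. \<Sum>i<m. c i t * fst (f i) \<omega>, \<lambda>t \<omega> x. \<Sum>i<m. c i t * snd (f i) \<omega> x) |m c f.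
     \<forall>i<(m::nat). c i \<in> C1_interval T \<and> f i \<in> FC_P}"


subsection \<open>Square-integrable functions and the distributional derivative\<close>

definition L2 :: "'a measure \<Rightarrow> ('a \<Rightarrow> complex) set" where
  "L2 M = {f \<in> borel_measurable M. integrable M (\<lambda>z. (cmod (f z))\<^sup>2)}"

definition L2_convergent :: "'a measure \<Rightarrow> (nat \<Rightarrow> 'a \<Rightarrow> complex) \<Rightarrow> bool" where
  "L2_convergent M S \<longleftrightarrow> (\<forall>N. S N \<in> L2 M) \<and>
     (\<exists>f\<in>L2 M. (\<lambda>N. LINT z|M. (cmod (S N z - f z))\<^sup>2) \<longlonglongrightarrow> 0)"

definition time_space :: "real \<Rightarrow> functional measure \<Rightarrow> (real \<times> functional) measure" where
  "time_space T \<mu> = restrict_space lborel {0..T} \<Otimes>\<^sub>M \<mu>"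

text \<open>\<open>G\<close> is a version of the derivative of \<open>\<rho>\<close> along \<open>\<sigma>\<^sub>k \<cdot> \<nabla>\<omega>\<close>; it is determined up to null sets.\<close>

definition is_transport_derivative ::
    "real \<Rightarrow> functional measure \<Rightarrow> int^2 \<Rightarrow> (real \<Rightarrow> functional \<Rightarrow> real) \<Rightarrow>
     (real \<times> functional \<Rightarrow> complex) \<Rightarrow> bool" where
  "is_transport_derivative T \<mu> k \<rho> G \<longleftrightarrow> G \<in> L2 (time_space T \<mu>) \<and>
     (\<forall>(F, DF)\<in>FC_PT T.
        (LINT (t, \<omega>)|time_space T \<mu>. G (t, \<omega>) * of_real (F t \<omega>)) =
        - (LINT (t, \<omega>)|time_space T \<mu>. of_real (\<rho> t \<omega>) * transport_pair k \<omega> (DF t \<omega>)))"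

end

theory Submission imports Defs begin

text \<open>The gradient bound forces every derivative \<open>G\<^sub>k\<close>, \<open>k \<noteq> 0\<close>, to vanish almost everywhere. All partial
  sums of the series are therefore zero almost everywhere, and they converge to zero.

  The reason is a logarithmic divergence. Write \<open>e\<^sub>n\<close> for the Fourier modes, \<open>w\<^sub>n\<close> for the pairing of
  the noise with \<open>e\<^sub>n\<close>, \<open>X\<^sub>k\<close> for the derivation \<open>\<langle>\<sigma>\<^sub>k \<cdot> \<nabla>\<omega>, D\<^sub>\<omega>\<rangle>\<close> and \<open>\<tau>(k, n) = k\<^sup>\<bottom> \<cdot> n / |k|\<^sup>2\<close>, so that
  \<open>X\<^sub>k w\<^sub>n = - 2\<pi>i \<tau>(k, n) w\<^sub>n\<^sub>+\<^sub>k\<close>. Fix \<open>l \<noteq> 0\<close> and a bounded functional \<open>H = exp (i\<langle>\<omega>, \<phi>\<rangle>)\<close> with a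
  trigonometric polynomial \<open>\<phi>\<close>, and test \<open>G\<^sub>-\<^sub>k\<close> against \<open>w\<^sub>l\<^sub>+\<^sub>k H\<close>. The field \<open>X\<^sub>-\<^sub>k\<close> takes \<open>w\<^sub>l\<^sub>+\<^sub>k\<close> back to
  \<open>2\<pi>i \<tau>(k, l) w\<^sub>l\<close>. It also acts on \<open>H\<close> and produces the products \<open>w\<^sub>l\<^sub>+\<^sub>k w\<^sub>m\<^sub>-\<^sub>k\<close> with the frequencies \<open>m\<close> of
  \<open>\<phi>\<close>; their means, which occur for \<open>m = - l\<close>, turn \<open>w\<^sub>l H\<close> into \<open>w\<^sub>l H - D\<^sub>l H\<close>, where \<open>D\<^sub>l\<close> is the derivative
  in the direction \<open>e\<^sub>l\<close>. After multiplication by \<open>\<tau>(k, l)\<close> and summation over a finite set of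
  frequencies \<open>k\<close>, the main term is \<open>s\<close> times the integral of \<open>\<rho> (w\<^sub>l H - D\<^sub>l H)\<close>, where
  \<open>s = \<Sum>\<^sub>k \<tau>(k, l)\<^sup>2\<close>. All other terms are of order \<open>\<surd>s\<close>: the tested derivatives by the gradient bound,
  and the centred products because they are nearly orthogonal (Isserlis) while \<open>\<rho>\<close> is bounded. But
  \<open>s\<close> can be made arbitrarily large, since \<open>\<Sum>\<^sub>k 1 / |k|\<^sup>2\<close> diverges in dimension two. Hence the
  integral of \<open>\<rho> (w\<^sub>l H - D\<^sub>l H)\<close> is zero (\<open>tested_mode\<close>): the weak derivative of the density vanishes in the
  direction of every mode other than the constant one.

  Integrating by parts once more, the integral of \<open>G\<^sub>k H\<close> becomes that of \<open>\<rho>\<close> against a second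
  derivative of \<open>H\<close> whose coefficients are antisymmetric, hence it vanishes
  (\<open>derivative_test_exp_zero\<close>). Exponentials in time and in finitely many modes determine an
  integrable function up to null sets (\<open>complex_density_zero_of_joint_char\<close>), because the modes generate
  the Borel sets of the Sobolev space (\<open>sets_time_space_subset\<close>).\<close>

section \<open>Trigonometric polynomials\<close>

lemma real_freq_add: "real_freq (k + l) = real_freq k + real_freq l"
  and real_freq_uminus: "real_freq (- k) = - real_freq k"
  by (simp_all add: real_freq_def vec_eq_iff)

lemma fourier_mode_add: "fourier_mode (k + l) x = fourier_mode k x * fourier_mode l x"
  by (simp add: fourier_mode_def real_freq_add inner_add_left exp_add[symmetric] algebra_simps)

lemma fourier_mode_cnj: "cnj (fourier_mode k x) = fourier_mode (- k) x"
  by (simp add: fourier_mode_def real_freq_uminus exp_cnj)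

lemma fourier_mode_periodic: "fourier_mode k (x + real_freq m) = fourier_mode k x"
proof -
  have *: "real_freq k \<bullet> real_freq m = real_of_int (\<Sum>i\<in>UNIV. k $ i * m $ i)"
    by (simp add: inner_vec_def real_freq_def)
  have "exp (2 * of_real pi * \<i> * of_real (real_freq k \<bullet> real_freq m)) = 1"
    unfolding * exp_eq_1 by (auto intro!: exI[of _ "\<Sum>i\<in>UNIV. k $ i * m $ i"])
  then show ?thesis
    by (simp add: fourier_mode_def inner_add_right algebra_simps exp_add)
qed

lemma fourier_mode_continuous [continuous_intros]: "continuous_on A (fourier_mode k)"
  unfolding fourier_mode_def[abs_def] by (intro continuous_intros)

lemma fourier_mode_has_derivative_axis:
  "((\<lambda>h. fourier_mode k (x + h *\<^sub>R axis i 1)) has_vector_derivative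
     (2 * of_real pi * \<i> * of_int (k $ i) * fourier_mode k x)) (at 0)"
proof -
  have eq: "(\<lambda>h. fourier_mode k (x + h *\<^sub>R axis i 1)) =
     (\<lambda>z. fourier_mode k x * exp (2 * of_real pi * \<i> * of_int (k $ i) * z)) \<circ> of_real"
    by (auto simp: fun_eq_iff fourier_mode_def inner_add_right inner_axis real_freq_def exp_add
        algebra_simps)
  have "((\<lambda>z. fourier_mode k x * exp (2 * of_real pi * \<i> * of_int (k $ i) * z)) has_field_derivative
     (2 * of_real pi * \<i> * of_int (k $ i) * fourier_mode k x)) (at (of_real 0))"
    by (auto intro!: derivative_eq_intros)
  then show ?thesis
    unfolding eq comp_def by (rule has_vector_derivative_real_field)
qed

text \<open>The sum runs over the support, so that a polynomial is given by its coefficient function alone.\<close>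

definition trig :: "(int^2 \<Rightarrow> complex) \<Rightarrow> real^2 \<Rightarrow> complex" where
  "trig a x = (\<Sum>m | a m \<noteq> 0. a m * fourier_mode m x)"

abbreviation fin_supp :: "(int^2 \<Rightarrow> complex) \<Rightarrow> bool" where
  "fin_supp a \<equiv> finite {m. a m \<noteq> 0}"

lemma trig_eq: "finite B \<Longrightarrow> (\<And>m. m \<notin> B \<Longrightarrow> a m = 0) \<Longrightarrow> trig a x = (\<Sum>m\<in>B. a m * fourier_mode m x)"
  unfolding trig_def by (rule sum.mono_neutral_left) auto

lemma fin_supp_add: "fin_supp a \<Longrightarrow> fin_supp b \<Longrightarrow> fin_supp (\<lambda>m. c * a m + d * b m)"
  by (rule finite_subset[of _ "{m. a m \<noteq> 0} \<union> {m. b m \<noteq> 0}"]) auto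

lemma fin_supp_mult: "fin_supp a \<Longrightarrow> fin_supp (\<lambda>m. c m * a m)"
  by (rule finite_subset[of _ "{m. a m \<noteq> 0}"]) auto

lemma fin_supp_uminus:
  assumes "fin_supp a" shows "fin_supp (\<lambda>m. a (- m))"
proof -
  have "{m. a (- m) \<noteq> 0} = uminus ` {m. a m \<noteq> 0}"
    by (auto simp: image_iff) (metis minus_minus)
  then show ?thesis using assms by simp
qed

lemma trig_lin:
  assumes "fin_supp a" "fin_supp b"
  shows "trig (\<lambda>m. c * a m + d * b m) x = c * trig a x + d * trig b x"
proof -
  let ?B = "{m. a m \<noteq> 0} \<union> {m. b m \<noteq> 0}"
  have "finite ?B" using assms by simp
  then show ?thesis
    by (subst (1 2 3) trig_eq[of ?B]) (auto simp: sum.distrib sum_distrib_left algebra_simps)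
qed

lemma trig_cnj:
  assumes "fin_supp a"
  shows "cnj (trig a x) = trig (\<lambda>m. cnj (a (- m))) x"
proof -
  have "cnj (trig a x) = (\<Sum>m | a m \<noteq> 0. cnj (a m) * fourier_mode (- m) x)"
    by (simp add: trig_def fourier_mode_cnj)
  also have "\<dots> = (\<Sum>m | a (- m) \<noteq> 0. cnj (a (- m)) * fourier_mode m x)"
    by (rule sum.reindex_bij_witness[of _ uminus uminus]) auto
  finally show ?thesis by (simp add: trig_def)
qed

lemma trig_single: "trig (\<lambda>m. if m = k then c else 0) x = c * fourier_mode k x"
  by (subst trig_eq[of "{k}"]) auto

lemma fin_supp_single: "fin_supp (\<lambda>m. if m = k then c else 0)"
  by (rule finite_subset[of _ "{k}"]) auto

lemma trig_has_derivative_axis: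
  assumes "fin_supp a"
  shows "((\<lambda>h. trig a (x + h *\<^sub>R axis i 1)) has_vector_derivative
     trig (\<lambda>m. 2 * of_real pi * \<i> * of_int (m $ i) * a m) x) (at 0)"
proof -
  have "((\<lambda>h. \<Sum>m | a m \<noteq> 0. a m * fourier_mode m (x + h *\<^sub>R axis i 1)) has_vector_derivative
     (\<Sum>m | a m \<noteq> 0. a m * (2 * of_real pi * \<i> * of_int (m $ i) * fourier_mode m x))) (at 0)"
    by (intro has_vector_derivative_sum has_vector_derivative_mult_right
        fourier_mode_has_derivative_axis)
  moreover have "(\<Sum>m | a m \<noteq> 0. a m * (2 * of_real pi * \<i> * of_int (m $ i) * fourier_mode m x)) =
     trig (\<lambda>m. 2 * of_real pi * \<i> * of_int (m $ i) * a m) x"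
    using assms by (subst trig_eq[of "{m. a m \<noteq> 0}"]) (auto intro!: sum.cong)
  ultimately show ?thesis by (simp add: trig_def[of a])
qed

lemma trig_continuous: "continuous_on A (trig a)"
  unfolding trig_def[abs_def] by (intro continuous_intros)

lemma trig_periodic: "trig a (x + real_freq m) = trig a x"
  by (simp add: trig_def fourier_mode_periodic)

text \<open>Real functions with a finite Fourier series. Unlike the single modes they are closed under real
  linear combinations and partial derivatives, and they are smooth test functions.\<close>

definition real_trig :: "(real^2 \<Rightarrow> real) set" where
  "real_trig = {\<phi>. \<exists>a. fin_supp a \<and> (\<forall>x. of_real (\<phi> x) = trig a x)}"

lemma real_trigI: "fin_supp a \<Longrightarrow> (\<And>x. of_real (\<phi> x) = trig a x) \<Longrightarrow> \<phi> \<in> real_trig"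
  unfolding real_trig_def by blast

lemma real_trigE:
  assumes "\<phi> \<in> real_trig"
  obtains a where "fin_supp a" "\<And>x. of_real (\<phi> x) = trig a x"
  using assms unfolding real_trig_def by blast

lemma partial_torus_real_trig:
  assumes a: "fin_supp a" and \<phi>: "\<And>x. of_real (\<phi> x) = trig a x"
  shows "((\<lambda>h. \<phi> (x + h *\<^sub>R axis i 1)) has_real_derivative partial_torus i \<phi> x) (at 0)" (is ?A)
    and "of_real (partial_torus i \<phi> x) = trig (\<lambda>m. 2 * of_real pi * \<i> * of_int (m $ i) * a m) x" (is ?B)
proof -
  let ?D = "trig (\<lambda>m. 2 * of_real pi * \<i> * of_int (m $ i) * a m) x"
  have D: "((\<lambda>h. complex_of_real (\<phi> (x + h *\<^sub>R axis i 1))) has_vector_derivative ?D) (at 0)"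
    using trig_has_derivative_axis[OF a, of x i] by (simp add: \<phi>)
  have 1: "((\<lambda>h. \<phi> (x + h *\<^sub>R axis i 1)) has_real_derivative Re ?D) (at 0)"
    using bounded_linear.has_vector_derivative[OF bounded_linear_Re D]
    by (simp add: has_real_derivative_iff_has_vector_derivative)
  have "((\<lambda>h::real. 0) has_real_derivative Im ?D) (at 0)"
    using bounded_linear.has_vector_derivative[OF bounded_linear_Im D]
    by (simp add: has_real_derivative_iff_has_vector_derivative)
  then have im: "Im ?D = 0" using DERIV_const DERIV_unique by blast
  have eq: "partial_torus i \<phi> x = Re ?D"
    unfolding partial_torus_def using 1 by (rule DERIV_imp_deriv)
  show ?A using 1 eq by simp
  show ?B using im eq by (simp add: complex_eq_iff)
qed

lemma foldr_partial_real_trig: "\<phi> \<in> real_trig \<Longrightarrow> foldr partial_torus \<alpha> \<phi> \<in> real_trig"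
proof (induction \<alpha>)
  case (Cons i \<alpha>)
  then obtain a where a: "fin_supp a" "\<And>x. of_real (foldr partial_torus \<alpha> \<phi> x) = trig a x"
    unfolding real_trig_def by blast
  from real_trigI[OF fin_supp_mult[OF a(1)] partial_torus_real_trig(2)[OF a]] show ?case
    by simp
qed simp

lemma real_trig_smooth: "real_trig \<subseteq> smooth_torus"
proof
  fix \<phi> assume \<phi>: "\<phi> \<in> real_trig"
  have cont: "continuous_on UNIV \<psi>" if \<psi>: "\<psi> \<in> real_trig" for \<psi>
  proof -
    obtain a where "\<And>x. of_real (\<psi> x) = trig a x" using real_trigE[OF \<psi>] by metis
    then have "\<psi> = (\<lambda>x. Re (trig a x))" by (metis Re_complex_of_real)
    then show ?thesis by (simp add: continuous_on_Re trig_continuous)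
  qed
  have diff: "(\<lambda>h. \<psi> (x + h *\<^sub>R axis i 1)) differentiable at 0" if \<psi>: "\<psi> \<in> real_trig" for \<psi> i x
  proof -
    obtain a where "fin_supp a" "\<And>x. of_real (\<psi> x) = trig a x" using real_trigE[OF \<psi>] by metis
    from partial_torus_real_trig(1)[OF this] show ?thesis
      by (auto simp: real_differentiable_def)
  qed
  have per: "\<phi> (x + real_freq m) = \<phi> x" for x m
  proof -
    obtain a where "\<And>x. of_real (\<phi> x) = trig a x" using real_trigE[OF \<phi>] by metis
    then have "complex_of_real (\<phi> (x + real_freq m)) = of_real (\<phi> x)" by (simp add: trig_periodic)
    then show ?thesis by simp
  qed
  show "\<phi> \<in> smooth_torus"
    unfolding smooth_torus_def using per cont diff foldr_partial_real_trig[OF \<phi>] by blast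
qed

lemma real_trig_lin:
  assumes "\<phi> \<in> real_trig" "\<psi> \<in> real_trig"
  shows "(\<lambda>x. a * \<phi> x + b * \<psi> x) \<in> real_trig"
proof -
  obtain p where p: "fin_supp p" "\<And>x. of_real (\<phi> x) = trig p x"
    using assms unfolding real_trig_def by blast
  obtain q where q: "fin_supp q" "\<And>x. of_real (\<psi> x) = trig q x"
    using assms unfolding real_trig_def by blast
  show ?thesis
    by (rule real_trigI[OF fin_supp_add[OF p(1) q(1)]]) (simp add: trig_lin[OF p(1) q(1)] p q)
qed

lemma real_trig_zero: "(\<lambda>x. 0) \<in> real_trig"
  by (rule real_trigI[of "\<lambda>m. 0"]) (auto simp: trig_def)

lemma Re_trig: assumes "fin_supp a" shows "(\<lambda>x. Re (trig a x)) \<in> real_trig"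
proof -
  let ?b = "\<lambda>m. (1/2) * a m + (1/2) * cnj (a (- m))"
  have f: "fin_supp (\<lambda>m. cnj (a (- m)))" using fin_supp_uminus[OF assms] by simp
  have "of_real (Re z) = (1/2) * z + (1/2) * cnj z" for z
    by (simp add: complex_eq_iff)
  then have "of_real (Re (trig a x)) = trig ?b x" for x
    by (subst trig_lin[OF assms f]) (simp add: trig_cnj[OF assms])
  then show ?thesis by (rule real_trigI[OF fin_supp_add[OF assms f]])
qed

lemma Im_trig: assumes "fin_supp a" shows "(\<lambda>x. Im (trig a x)) \<in> real_trig"
proof -
  have "(\<lambda>x. Im (trig a x)) = (\<lambda>x. Re (trig (\<lambda>m. - \<i> * a m + 0 * a m) x))"
    by (subst trig_lin[OF assms assms]) simp
  then show ?thesis using Re_trig[OF fin_supp_add[OF assms assms, of "- \<i>" 0]] by simp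
qed

lemma Re_mode: "(\<lambda>x. Re (fourier_mode k x)) \<in> real_trig"
  and Im_mode: "(\<lambda>x. Im (fourier_mode k x)) \<in> real_trig"
  using Re_trig[OF fin_supp_single, of k 1] Im_trig[OF fin_supp_single, of k 1]
  by (auto simp: trig_single)

section \<open>The duality with trigonometric polynomials\<close>

lemma distribution_lin:
  assumes "\<omega> \<in> distributions" "\<phi> \<in> real_trig" "\<psi> \<in> real_trig"
  shows "\<omega> (\<lambda>x. a * \<phi> x + b * \<psi> x) = a * \<omega> \<phi> + b * \<omega> \<psi>"
  using assms real_trig_smooth unfolding distributions_def by blast

lemma distribution_zero: "\<omega> \<in> distributions \<Longrightarrow> \<omega> (\<lambda>x. 0) = 0"
  using distribution_lin[OF _ real_trig_zero real_trig_zero, of \<omega> 0 0] by simp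

lemma cpair_trig:
  assumes \<omega>: "\<omega> \<in> distributions" and a: "fin_supp a"
  shows "cpair \<omega> (trig a) = (\<Sum>m | a m \<noteq> 0. a m * cpair \<omega> (fourier_mode m))"
proof -
  have "finite B \<Longrightarrow> (\<lambda>x. Re (\<Sum>m\<in>B. a m * fourier_mode m x)) \<in> real_trig \<and>
     (\<lambda>x. Im (\<Sum>m\<in>B. a m * fourier_mode m x)) \<in> real_trig \<and>
     cpair \<omega> (\<lambda>x. \<Sum>m\<in>B. a m * fourier_mode m x) = (\<Sum>m\<in>B. a m * cpair \<omega> (fourier_mode m))" for B
  proof (induction B rule: finite_induct)
    case empty
    show ?case using distribution_zero[OF \<omega>] real_trig_zero by (simp add: cpair_def zero_complex.ctr)
  next
    case (insert n B)
    let ?S = "\<lambda>x. \<Sum>m\<in>B. a m * fourier_mode m x"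
    have S: "(\<lambda>x. Re (?S x)) \<in> real_trig" "(\<lambda>x. Im (?S x)) \<in> real_trig"
      using insert.IH by blast+
    define u where "u = (\<lambda>x. Re (a n) * Re (fourier_mode n x) + (- Im (a n)) * Im (fourier_mode n x))"
    define v where "v = (\<lambda>x. Re (a n) * Im (fourier_mode n x) + Im (a n) * Re (fourier_mode n x))"
    have uv: "u \<in> real_trig" "v \<in> real_trig"
      unfolding u_def v_def by (intro real_trig_lin Re_mode Im_mode)+
    have wu: "\<omega> u = Re (a n) * \<omega> (\<lambda>x. Re (fourier_mode n x)) - Im (a n) * \<omega> (\<lambda>x. Im (fourier_mode n x))"
      unfolding u_def by (subst distribution_lin[OF \<omega> Re_mode Im_mode]) simp
    have wv: "\<omega> v = Re (a n) * \<omega> (\<lambda>x. Im (fourier_mode n x)) + Im (a n) * \<omega> (\<lambda>x. Re (fourier_mode n x))"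
      unfolding v_def by (subst distribution_lin[OF \<omega> Im_mode Re_mode]) simp
    have R: "(\<lambda>x. Re (\<Sum>m\<in>insert n B. a m * fourier_mode m x)) = (\<lambda>x. 1 * u x + 1 * Re (?S x))"
      and I: "(\<lambda>x. Im (\<Sum>m\<in>insert n B. a m * fourier_mode m x)) = (\<lambda>x. 1 * v x + 1 * Im (?S x))"
      using insert by (auto simp: u_def v_def)
    have IH: "Complex (\<omega> (\<lambda>x. Re (?S x))) (\<omega> (\<lambda>x. Im (?S x))) = (\<Sum>m\<in>B. a m * cpair \<omega> (fourier_mode m))"
      using insert.IH unfolding cpair_def by blast
    have "cpair \<omega> (\<lambda>x. \<Sum>m\<in>insert n B. a m * fourier_mode m x) =
       Complex (\<omega> u) (\<omega> v) + Complex (\<omega> (\<lambda>x. Re (?S x))) (\<omega> (\<lambda>x. Im (?S x)))"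
      unfolding cpair_def R I using distribution_lin[OF \<omega> uv(1) S(1), of 1 1]
        distribution_lin[OF \<omega> uv(2) S(2), of 1 1] by (simp add: complex_eq_iff)
    also have "\<dots> = (\<Sum>m\<in>insert n B. a m * cpair \<omega> (fourier_mode m))"
      unfolding IH using insert(1,2) by (simp add: cpair_def complex_eq_iff wu wv)
    finally show ?case unfolding R I using uv S real_trig_lin by blast
  qed
  from this[OF a] show ?thesis by (simp add: trig_def[abs_def])
qed

lemma cpair_trig':
  assumes "\<omega> \<in> distributions" "finite B" "\<And>m. m \<notin> B \<Longrightarrow> a m = 0"
  shows "cpair \<omega> (trig a) = (\<Sum>m\<in>B. a m * cpair \<omega> (fourier_mode m))"
proof -
  have *: "{m. a m \<noteq> 0} \<subseteq> B" using assms by auto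
  then have "fin_supp a" using assms(2) finite_subset by blast
  from cpair_trig[OF assms(1) this] show ?thesis
    using sum.mono_neutral_left[OF assms(2) *, of "\<lambda>m. a m * cpair \<omega> (fourier_mode m)"] by auto
qed

lemma real_trig_pair:
  assumes \<omega>: "\<omega> \<in> distributions" and a: "fin_supp a" and \<phi>: "\<And>x. of_real (\<phi> x) = trig a x"
  shows "of_real (\<omega> \<phi>) = (\<Sum>m | a m \<noteq> 0. a m * cpair \<omega> (fourier_mode m))"
proof -
  have "of_real (\<omega> \<phi>) = cpair \<omega> (\<lambda>x. of_real (\<phi> x))"
    using distribution_zero[OF \<omega>] by (simp add: cpair_def complex_eq_iff)
  then show ?thesis using cpair_trig[OF \<omega> a] by (simp add: \<phi>)
qed

lemma cpair_mode_cnj: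
  assumes \<omega>: "\<omega> \<in> distributions"
  shows "cnj (cpair \<omega> (fourier_mode k)) = cpair \<omega> (fourier_mode (- k))"
proof -
  have "\<omega> (\<lambda>x. - Im (fourier_mode k x)) = - \<omega> (\<lambda>x. Im (fourier_mode k x))"
    using distribution_lin[OF \<omega> Im_mode Im_mode, of "-1" k 0 k] by simp
  then show ?thesis
    by (simp add: cpair_def fourier_mode_cnj[symmetric] complex_eq_iff)
qed

text \<open>The Fourier multiplier of \<open>\<sigma>\<^sub>k \<cdot> \<nabla>\<close>, without the factor \<open>2\<pi>i\<close>.\<close>

definition transport_coeff :: "int^2 \<Rightarrow> int^2 \<Rightarrow> real" where
  "transport_coeff k m = (perp k \<bullet> real_freq m) / (norm (real_freq k))\<^sup>2"

lemma transport_pair_trig: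
  assumes \<omega>: "\<omega> \<in> distributions" and a: "fin_supp a" and \<phi>: "\<And>x. of_real (\<phi> x) = trig a x"
  shows "transport_pair k \<omega> \<phi> =
    - (2 * of_real pi * \<i>) * (\<Sum>m | a m \<noteq> 0. of_real (transport_coeff k m) * a m * cpair \<omega> (fourier_mode (m + k)))"
proof -
  let ?c = "2 * of_real pi * \<i> :: complex"
  define b where "b = (\<lambda>n. ?c * of_real (transport_coeff k (n - k)) * a (n - k))"
  let ?A = "{m. a m \<noteq> 0}"
  have b0: "n \<notin> (\<lambda>m. m + k) ` ?A \<Longrightarrow> b n = 0" for n
    by (cases "a (n - k) = 0") (auto simp: b_def image_iff)
  have "(\<Sum>i\<in>UNIV. sigma_field k x $ i * of_real (partial_torus i \<phi> x)) = trig b x" for x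
  proof -
    have p: "of_real (partial_torus i \<phi> x) = (\<Sum>m\<in>?A. ?c * of_int (m $ i) * a m * fourier_mode m x)" for i
      unfolding partial_torus_real_trig(2)[OF a \<phi>] using a by (intro trig_eq) auto
    have t: "of_real (transport_coeff k m) =
        (\<Sum>i\<in>UNIV. complex_of_real (perp k $ i / (norm (real_freq k))\<^sup>2) * of_int (m $ i))" for m
      by (simp add: transport_coeff_def inner_vec_def real_freq_def sum_divide_distrib)
    have "(\<Sum>i\<in>UNIV. sigma_field k x $ i * of_real (partial_torus i \<phi> x)) =
       (\<Sum>m\<in>?A. \<Sum>i\<in>UNIV. sigma_field k x $ i * (?c * of_int (m $ i) * a m * fourier_mode m x))"
      unfolding p sum_distrib_left by (rule sum.swap)
    also have "\<dots> = (\<Sum>m\<in>?A. ?c * of_real (transport_coeff k m) * a m * fourier_mode (m + k) x)"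
      by (intro sum.cong refl)
        (simp add: t sigma_field_def sum_distrib_left sum_distrib_right fourier_mode_add algebra_simps)
    also have "\<dots> = (\<Sum>n\<in>(\<lambda>m. m + k) ` ?A. b n * fourier_mode n x)"
      by (subst sum.reindex) (auto simp: b_def inj_on_def)
    also have "\<dots> = trig b x" using a b0 by (intro trig_eq[symmetric]) auto
    finally show ?thesis .
  qed
  then have "transport_pair k \<omega> \<phi> = - cpair \<omega> (trig b)"
    unfolding transport_pair_def by presburger
  also have "cpair \<omega> (trig b) = (\<Sum>n\<in>(\<lambda>m. m + k) ` ?A. b n * cpair \<omega> (fourier_mode n))"
    using a b0 by (intro cpair_trig' \<omega>) auto
  also have "\<dots> = ?c * (\<Sum>m\<in>?A. of_real (transport_coeff k m) * a m * cpair \<omega> (fourier_mode (m + k)))"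
    by (subst sum.reindex) (auto simp: b_def inj_on_def sum_distrib_left algebra_simps)
  finally show ?thesis by simp
qed

lemma transport_pair_lin:
  assumes \<omega>: "\<omega> \<in> distributions" and "\<phi> \<in> real_trig" "\<psi> \<in> real_trig"
  shows "transport_pair k \<omega> (\<lambda>x. c * \<phi> x + d * \<psi> x) =
    of_real c * transport_pair k \<omega> \<phi> + of_real d * transport_pair k \<omega> \<psi>"
proof -
  obtain p where p: "fin_supp p" "\<And>x. of_real (\<phi> x) = trig p x"
    using assms unfolding real_trig_def by blast
  obtain q where q: "fin_supp q" "\<And>x. of_real (\<psi> x) = trig q x"
    using assms unfolding real_trig_def by blast
  let ?r = "\<lambda>m. of_real c * p m + of_real d * q m"
  have r: "fin_supp ?r" by (rule fin_supp_add[OF p(1) q(1)])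
  have r': "of_real (c * \<phi> x + d * \<psi> x) = trig ?r x" for x
    by (simp add: trig_lin[OF p(1) q(1)] p q)
  let ?B = "{m. p m \<noteq> 0} \<union> {m. q m \<noteq> 0}"
  have B: "finite ?B" using p q by simp
  have ext: "(\<Sum>m | a m \<noteq> 0. of_real (transport_coeff k m) * a m * cpair \<omega> (fourier_mode (m + k))) =
     (\<Sum>m\<in>?B. of_real (transport_coeff k m) * a m * cpair \<omega> (fourier_mode (m + k)))"
    if "{m. a m \<noteq> 0} \<subseteq> ?B" for a
    using that B by (intro sum.mono_neutral_left) auto
  show ?thesis
    unfolding transport_pair_trig[OF \<omega> p] transport_pair_trig[OF \<omega> q] transport_pair_trig[OF \<omega> r r']
    by (subst (1 2 3) ext)
      (auto simp: sum_distrib_left sum.distrib sum_negf algebra_simps)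
qed

text \<open>Recombines the real and imaginary parts of a mode: the field \<open>\<sigma>\<^sub>k \<cdot>
  \<nabla>\<close> shifts frequencies by \<open>k\<close>. Cylinder functionals accept only real
  test functions, which is why the parts appear separately.\<close>

lemma transport_pair_mode:
  assumes \<omega>: "\<omega> \<in> distributions"
  shows "transport_pair k \<omega> (\<lambda>x. Re (fourier_mode n x)) + \<i> * transport_pair k \<omega> (\<lambda>x. Im (fourier_mode n x)) =
    - (2 * of_real pi * \<i>) * of_real (transport_coeff k n) * cpair \<omega> (fourier_mode (n + k))"
proof -
  define d where "d j m = (if m = j then 1 else 0 :: complex)" for j m :: "int^2"
  have d: "fin_supp (d j)" for j unfolding d_def by (rule fin_supp_single)
  have td: "trig (d j) x = fourier_mode j x" for j x
    unfolding d_def by (simp add: trig_single)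
  let ?r = "\<lambda>m. (1/2) * d n m + (1/2) * d (- n) m" and ?i = "\<lambda>m. (- \<i>/2) * d n m + (\<i>/2) * d (- n) m"
  have r: "fin_supp ?r" and i: "fin_supp ?i" by (rule fin_supp_add[OF d d])+
  have r': "of_real (Re (fourier_mode n x)) = trig ?r x" for x
    by (subst trig_lin[OF d d]) (simp add: td fourier_mode_cnj[symmetric] complex_eq_iff)
  have i': "of_real (Im (fourier_mode n x)) = trig ?i x" for x
    by (subst trig_lin[OF d d]) (simp add: td fourier_mode_cnj[symmetric] complex_eq_iff)
  let ?f = "\<lambda>m. of_real (transport_coeff k m) * cpair \<omega> (fourier_mode (m + k))"
  have ext: "(\<Sum>m | a m \<noteq> 0. of_real (transport_coeff k m) * a m * cpair \<omega> (fourier_mode (m + k))) =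
     (\<Sum>m\<in>{n, - n}. a m * ?f m)" if "{m. a m \<noteq> 0} \<subseteq> {n, - n}" for a
    by (subst sum.mono_neutral_left[OF _ that]) (auto simp: algebra_simps intro!: sum.cong)
  have sub: "{m. ?r m \<noteq> 0} \<subseteq> {n, - n}" "{m. ?i m \<noteq> 0} \<subseteq> {n, - n}" by (auto simp: d_def)
  have "(\<Sum>m\<in>{n, - n}. ?r m * ?f m) + \<i> * (\<Sum>m\<in>{n, - n}. ?i m * ?f m) =
     (\<Sum>m\<in>{n, - n}. d n m * ?f m)"
    unfolding sum_distrib_left sum.distrib[symmetric] by (intro sum.cong) (auto simp: algebra_simps)
  also have "\<dots> = (\<Sum>m\<in>{n, - n}. if m = n then ?f m else 0)"
    by (intro sum.cong) (auto simp: d_def)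
  also have "\<dots> = ?f n"
    by (subst sum.delta) auto
  finally have *: "(\<Sum>m\<in>{n, - n}. ?r m * ?f m) + \<i> * (\<Sum>m\<in>{n, - n}. ?i m * ?f m) = ?f n" .
  have lin: "c * x + \<i> * (c * y) = c * z" if "x + \<i> * y = z" for c x y z :: complex
    using that by (auto simp: algebra_simps)
  show ?thesis
    unfolding transport_pair_trig[OF \<omega> r r'] transport_pair_trig[OF \<omega> i i'] ext[OF sub(1)] ext[OF sub(2)]
      lin[OF *] by (simp add: algebra_simps)
qed

section \<open>The Borel sets of the negative Sobolev space are generated by the Fourier modes\<close>

definition sobolev_weight :: "real \<Rightarrow> int^2 \<Rightarrow> real" where
  "sobolev_weight s k = (1 + (norm (real_freq k))\<^sup>2) powr s"

text \<open>The sign of the frequency follows the convention of \<^const>\<open>sobolev_term\<close>.\<close>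

definition mode_seq :: "functional \<Rightarrow> int^2 \<Rightarrow> complex" where
  "mode_seq \<omega> k = cpair \<omega> (fourier_mode (- k))"

text \<open>Sobolev norms restricted to finitely many frequencies. They are plain finite
  \<open>\<ell>\<^sup>2\<close> norms, so the triangle inequality and measurability are
  immediate, and the full norm is their supremum.\<close>

definition partial_norm :: "real \<Rightarrow> (int^2) set \<Rightarrow> (int^2 \<Rightarrow> complex) \<Rightarrow> real" where
  "partial_norm s F a = L2_set (\<lambda>k. sqrt (sobolev_weight s k) * cmod (a k)) F"

lemma sobolev_weight_pos: "sobolev_weight s k > 0"
  unfolding sobolev_weight_def by (smt (verit) powr_gt_zero zero_le_power2)

lemma sobolev_weight_mono: "s \<le> t \<Longrightarrow> sobolev_weight s k \<le> sobolev_weight t k"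
  unfolding sobolev_weight_def by (intro powr_mono) auto

lemma sobolev_weight_le_1: "s \<le> 0 \<Longrightarrow> sobolev_weight s k \<le> 1"
  using powr_mono[of s 0 "1 + (norm (real_freq k))\<^sup>2"] by (simp add: sobolev_weight_def add_nonneg_eq_0_iff)

lemma sobolev_term_eq: "sobolev_term s \<omega> k = sobolev_weight s k * (cmod (mode_seq \<omega> k))\<^sup>2"
  by (simp add: sobolev_term_def sobolev_weight_def mode_seq_def)

lemma sobolev_term_nonneg: "0 \<le> sobolev_term s \<omega> k"
  by (simp add: sobolev_term_def)

lemma partial_norm_sq: "(partial_norm s F a)\<^sup>2 = (\<Sum>k\<in>F. sobolev_weight s k * (cmod (a k))\<^sup>2)"
  unfolding partial_norm_def L2_set_def using sobolev_weight_pos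
  by (subst real_sqrt_pow2) (auto simp: power_mult_distrib less_imp_le intro!: sum_nonneg sum.cong)

lemma partial_norm_nonneg: "0 \<le> partial_norm s F a"
  by (simp add: partial_norm_def)

lemma partial_norm_triangle:
  "partial_norm s F (\<lambda>k. a k - c k) \<le> partial_norm s F (\<lambda>k. a k - b k) + partial_norm s F (\<lambda>k. b k - c k)"
proof -
  have "partial_norm s F (\<lambda>k. a k - c k) \<le>
    L2_set (\<lambda>k. sqrt (sobolev_weight s k) * cmod (a k - b k) + sqrt (sobolev_weight s k) * cmod (b k - c k)) F"
    unfolding partial_norm_def distrib_left[symmetric]
    by (intro L2_set_mono mult_left_mono mult_nonneg_nonneg norm_diff_triangle_le[of _ "b k" for k])
      (auto simp: less_imp_le[OF sobolev_weight_pos])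
  also have "\<dots> \<le> partial_norm s F (\<lambda>k. a k - b k) + partial_norm s F (\<lambda>k. b k - c k)"
    unfolding partial_norm_def by (rule L2_set_triangle_ineq)
  finally show ?thesis .
qed

lemma partial_norm_mono: "s \<le> t \<Longrightarrow> partial_norm s F a \<le> partial_norm t F a"
  unfolding partial_norm_def
  by (intro L2_set_mono mult_right_mono) (auto simp: sobolev_weight_mono less_imp_le[OF sobolev_weight_pos])

lemma partial_norm_commute: "partial_norm s F (\<lambda>k. a k - b k) = partial_norm s F (\<lambda>k. b k - a k)"
  by (simp add: partial_norm_def norm_minus_commute)

lemma partial_norm_le_sobolev_norm:
  assumes "sobolev_term s \<omega> summable_on UNIV" "finite F"
  shows "partial_norm s F (mode_seq \<omega>) \<le> sobolev_norm s \<omega>"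
proof -
  have "(partial_norm s F (mode_seq \<omega>))\<^sup>2 \<le> (\<Sum>\<^sub>\<infinity>k. sobolev_term s \<omega> k)"
    unfolding partial_norm_sq sobolev_term_eq[symmetric]
    using assms by (intro finite_sum_le_infsum) (auto simp: sobolev_term_nonneg)
  then show ?thesis unfolding sobolev_norm_def
    by (rule real_le_rsqrt)
qed

lemma sobolev_norm_le:
  assumes b: "\<And>F. finite F \<Longrightarrow> partial_norm s F (mode_seq \<omega>) \<le> b"
  shows "sobolev_term s \<omega> summable_on UNIV" and "sobolev_norm s \<omega> \<le> b"
proof -
  have b0: "0 \<le> b" using b[of "{}"] partial_norm_nonneg[of s "{}" "mode_seq \<omega>"] by simp
  have le: "sum (sobolev_term s \<omega>) F \<le> b\<^sup>2" if "finite F" for F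
    using power_mono[OF b[OF that] partial_norm_nonneg, of 2]
    by (simp add: partial_norm_sq sobolev_term_eq)
  show s: "sobolev_term s \<omega> summable_on UNIV"
    by (rule nonneg_bdd_above_summable_on) (auto simp: sobolev_term_nonneg intro!: bdd_aboveI2[of _ _ "b\<^sup>2"] le)
  have "(\<Sum>\<^sub>\<infinity>k. sobolev_term s \<omega> k) \<le> b\<^sup>2"
    by (rule infsum_le_finite_sums[OF s le])
  then show "sobolev_norm s \<omega> \<le> b"
    unfolding sobolev_norm_def using b0 by (simp add: real_le_lsqrt)
qed

lemma mode_seq_diff: "mode_seq (\<lambda>\<phi>. \<eta> \<phi> - \<omega> \<phi>) = (\<lambda>k. mode_seq \<eta> k - mode_seq \<omega> k)"
  by (auto simp: mode_seq_def cpair_def complex_eq_iff)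

lemma Hminus_summable: "\<omega> \<in> Hminus \<Longrightarrow> \<delta> > 0 \<Longrightarrow> sobolev_term (- 1 - \<delta>) \<omega> summable_on UNIV"
  unfolding Hminus_def sobolev_def by auto

lemma Hminus_diff_summable:
  assumes "\<eta> \<in> Hminus" "\<omega> \<in> Hminus" "\<delta> > 0"
  shows "sobolev_term (- 1 - \<delta>) (\<lambda>\<phi>. \<eta> \<phi> - \<omega> \<phi>) summable_on UNIV"
proof (rule sobolev_norm_le(1))
  fix F :: "(int^2) set" assume F: "finite F"
  have "partial_norm (- 1 - \<delta>) F (mode_seq (\<lambda>\<phi>. \<eta> \<phi> - \<omega> \<phi>)) \<le>
    partial_norm (- 1 - \<delta>) F (mode_seq \<eta>) + partial_norm (- 1 - \<delta>) F (mode_seq \<omega>)"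
    unfolding mode_seq_diff
    using partial_norm_commute[of "- 1 - \<delta>" F "\<lambda>k. 0" "mode_seq \<omega>"]
      partial_norm_triangle[of "- 1 - \<delta>" F "mode_seq \<eta>" "mode_seq \<omega>" "\<lambda>k. 0"]
    by simp
  also have "\<dots> \<le> sobolev_norm (- 1 - \<delta>) \<eta> + sobolev_norm (- 1 - \<delta>) \<omega>"
    using assms F by (intro add_mono partial_norm_le_sobolev_norm Hminus_summable)
  finally show "partial_norm (- 1 - \<delta>) F (mode_seq (\<lambda>\<phi>. \<eta> \<phi> - \<omega> \<phi>)) \<le>
    sobolev_norm (- 1 - \<delta>) \<eta> + sobolev_norm (- 1 - \<delta>) \<omega>" .
qed

text \<open>Finitely supported sequences of Gaussian rationals, coded by association lists so that
  they are indexed by a countable type.\<close>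

definition rational_seq :: "((int^2) \<times> rat \<times> rat) list \<Rightarrow> int^2 \<Rightarrow> complex" where
  "rational_seq xs k = (case map_of xs k of Some (u, v) \<Rightarrow> Complex (of_rat u) (of_rat v) | None \<Rightarrow> 0)"

text \<open>Separability of the weighted \<open>\<ell>\<^sup>2\<close> space: cut off a small tail of the
  coefficients and replace the finitely many remaining ones by Gaussian rationals.\<close>

lemma rational_seq_dense:
  assumes sm: "sobolev_term s \<eta> summable_on UNIV" and s: "s \<le> 0" and r: "r > 0"
  obtains xs where "\<And>F. finite F \<Longrightarrow> partial_norm s F (\<lambda>k. mode_seq \<eta> k - rational_seq xs k) \<le> r"
proof -
  have "\<forall>\<^sub>F F in finite_subsets_at_top UNIV. dist (sum (sobolev_term s \<eta>) F) (\<Sum>\<^sub>\<infinity>k. sobolev_term s \<eta> k) < r\<^sup>2 / 2"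
    using r by (intro tendstoD[OF infsum_tendsto[OF sm]]) auto
  then obtain F0 where F0: "finite F0"
      "dist (sum (sobolev_term s \<eta>) F0) (\<Sum>\<^sub>\<infinity>k. sobolev_term s \<eta> k) < r\<^sup>2 / 2"
    unfolding eventually_finite_subsets_at_top by blast
  have tail: "sum (sobolev_term s \<eta>) F \<le> r\<^sup>2 / 2" if F: "finite F" "F \<inter> F0 = {}" for F
  proof -
    have "sum (sobolev_term s \<eta>) F + sum (sobolev_term s \<eta>) F0 = sum (sobolev_term s \<eta>) (F \<union> F0)"
      using F F0 by (simp add: sum.union_disjoint)
    also have "\<dots> \<le> (\<Sum>\<^sub>\<infinity>k. sobolev_term s \<eta> k)"
      using F F0 by (intro finite_sum_le_infsum[OF sm]) (auto simp: sobolev_term_nonneg)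
    finally show ?thesis using F0(2) by (simp add: dist_real_def abs_if split: if_splits)
  qed
  \<comment> \<open>The weights are at most one, so an error \<open>\<epsilon>\<close> in each of the kept coefficients costs at most
    \<open>r\<^sup>2/2\<close>; the tail costs the other half.\<close>
  define \<epsilon> where "\<epsilon> = r / sqrt (2 * (real (card F0) + 1))"
  have \<epsilon>: "\<epsilon> > 0" using r by (simp add: \<epsilon>_def)
  have \<epsilon>2: "real (card F0) * \<epsilon>\<^sup>2 \<le> r\<^sup>2 / 2"
  proof -
    have "real (card F0) * \<epsilon>\<^sup>2 = (real (card F0) / (real (card F0) + 1)) * (r\<^sup>2 / 2)"
      unfolding \<epsilon>_def by (simp add: power_divide real_sqrt_pow2)
    also have "\<dots> \<le> 1 * (r\<^sup>2 / 2)" by (intro mult_right_mono) auto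
    finally show ?thesis by simp
  qed
  have rat: "\<exists>q. \<bar>x - of_rat q\<bar> \<le> \<epsilon> / 2" for x :: real
  proof -
    obtain q where "x - \<epsilon> / 2 < of_rat q" "of_rat q < x" using of_rat_dense[of "x - \<epsilon> / 2" x] \<epsilon> by auto
    then show ?thesis by (intro exI[of _ q]) auto
  qed
  obtain rt where rt: "\<And>x. \<bar>x - of_rat (rt x)\<bar> \<le> \<epsilon> / 2" using rat by metis
  obtain ks where ks: "set ks = F0" using F0(1) finite_list by blast
  define xs where "xs = map (\<lambda>k. (k, rt (Re (mode_seq \<eta> k)), rt (Im (mode_seq \<eta> k)))) ks"
  have q: "rational_seq xs k = (if k \<in> F0 then
     Complex (of_rat (rt (Re (mode_seq \<eta> k)))) (of_rat (rt (Im (mode_seq \<eta> k)))) else 0)" for k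
    unfolding rational_seq_def xs_def map_of_map_restrict using ks by (simp add: restrict_map_def)
  have "partial_norm s F (\<lambda>k. mode_seq \<eta> k - rational_seq xs k) \<le> r" if F: "finite F" for F
  proof -
    let ?t = "\<lambda>k. sobolev_weight s k * (cmod (mode_seq \<eta> k - rational_seq xs k))\<^sup>2"
    have "?t k \<le> \<epsilon>\<^sup>2" if "k \<in> F0" for k
    proof -
      have "cmod (mode_seq \<eta> k - rational_seq xs k) \<le>
        \<bar>Re (mode_seq \<eta> k - rational_seq xs k)\<bar> + \<bar>Im (mode_seq \<eta> k - rational_seq xs k)\<bar>"
        by (rule cmod_le)
      also have "\<dots> \<le> \<epsilon> / 2 + \<epsilon> / 2" using that rt[of "Re (mode_seq \<eta> k)"] rt[of "Im (mode_seq \<eta> k)"]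
        by (intro add_mono) (simp_all add: q)
      finally have "(cmod (mode_seq \<eta> k - rational_seq xs k))\<^sup>2 \<le> \<epsilon>\<^sup>2" by (intro power_mono) auto
      then show ?thesis
        using mult_mono[OF sobolev_weight_le_1[OF s, of k], of _ "\<epsilon>\<^sup>2"] by simp
    qed
    then have "sum ?t (F \<inter> F0) \<le> (\<Sum>k\<in>F \<inter> F0. \<epsilon>\<^sup>2)" by (intro sum_mono) auto
    also have "\<dots> \<le> real (card F0) * \<epsilon>\<^sup>2" using F0(1) by (auto intro!: mult_right_mono card_mono)
    finally have 1: "sum ?t (F \<inter> F0) \<le> r\<^sup>2 / 2" using \<epsilon>2 by linarith
    have "sum ?t (F - F0) = sum (sobolev_term s \<eta>) (F - F0)"
      by (intro sum.cong) (auto simp: q sobolev_term_eq)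
    also have "\<dots> \<le> r\<^sup>2 / 2" using F by (intro tail) auto
    finally have "sum ?t (F \<inter> F0) + sum ?t (F - F0) \<le> r\<^sup>2" using 1 by linarith
    also have "sum ?t (F \<inter> F0) + sum ?t (F - F0) = sum ?t F"
      by (rule sum.Int_Diff[OF F, symmetric])
    finally have "(partial_norm s F (\<lambda>k. mode_seq \<eta> k - rational_seq xs k))\<^sup>2 \<le> r\<^sup>2"
      by (simp add: partial_norm_sq)
    then show ?thesis by (rule power2_le_imp_le) (use r in simp)
  qed
  then show thesis by (rule that)
qed

text \<open>Closed balls with countably many possible centres, radii and exponents. The centre is a sequence
  of coefficients and need not come from a distribution. The bound is stated on all finite lists
  of frequencies, a countable family, so that measurability needs no limit.\<close>

definition rational_ball :: "nat \<times> ((int^2) \<times> rat \<times> rat) list \<times> rat \<Rightarrow> functional set" where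
  "rational_ball p = (case p of (n, xs, r) \<Rightarrow> {\<zeta> \<in> Hminus. \<forall>ks.
     partial_norm (- 1 - 1 / real (Suc n)) (set ks) (\<lambda>k. mode_seq \<zeta> k - rational_seq xs k) \<le> of_rat r})"

text \<open>The Sobolev norms increase with the exponent, so exponents \<open>- 1 - 1/n\<close> suffice; a
  rational centre closer to \<open>\<eta>\<close> than half of the remaining distance gives a
  ball inside the given one.\<close>

lemma rational_ball_in_ball:
  assumes \<omega>: "\<omega> \<in> Hminus" and \<eta>: "\<eta> \<in> Hminus" and \<delta>: "\<delta> > 0"
    and r: "sobolev_norm (- 1 - \<delta>) (\<lambda>\<phi>. \<eta> \<phi> - \<omega> \<phi>) < r"
  shows "\<exists>p. \<eta> \<in> rational_ball p \<and>
     rational_ball p \<subseteq> {\<zeta> \<in> Hminus. sobolev_norm (- 1 - \<delta>) (\<lambda>\<phi>. \<zeta> \<phi> - \<omega> \<phi>) < r}"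
proof -
  let ?N = "sobolev_norm (- 1 - \<delta>) (\<lambda>\<phi>. \<eta> \<phi> - \<omega> \<phi>)"
  obtain n where n: "1 / real (Suc n) < \<delta>" using \<delta> nat_approx_posE by blast
  define s where "s = - 1 - 1 / real (Suc n)"
  have s: "s \<le> 0" "- 1 - \<delta> \<le> s" using n unfolding s_def by (auto intro: order_trans[OF _ divide_nonneg_nonneg])
  obtain \<rho> where \<rho>: "0 < real_of_rat \<rho>" "of_rat \<rho> < (r - ?N) / 2"
    using of_rat_dense[of 0 "(r - ?N) / 2"] r by auto
  have "sobolev_term s \<eta> summable_on UNIV"
    unfolding s_def by (rule Hminus_summable[OF \<eta>]) simp
  then obtain xs where xs: "\<And>F. finite F \<Longrightarrow> partial_norm s F (\<lambda>k. mode_seq \<eta> k - rational_seq xs k) \<le> of_rat \<rho>"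
    using rational_seq_dense s(1) \<rho>(1) by blast
  have ball: "rational_ball (n, xs, \<rho>) = {\<zeta> \<in> Hminus. \<forall>ks.
     partial_norm s (set ks) (\<lambda>k. mode_seq \<zeta> k - rational_seq xs k) \<le> of_rat \<rho>}"
    by (simp add: rational_ball_def s_def)
  have "\<eta> \<in> rational_ball (n, xs, \<rho>)" unfolding ball using \<eta> xs by simp
  moreover have "sobolev_norm (- 1 - \<delta>) (\<lambda>\<phi>. \<zeta> \<phi> - \<omega> \<phi>) < r" if \<zeta>: "\<zeta> \<in> rational_ball (n, xs, \<rho>)" for \<zeta>
  proof -
    have "sobolev_norm (- 1 - \<delta>) (\<lambda>\<phi>. \<zeta> \<phi> - \<omega> \<phi>) \<le> 2 * of_rat \<rho> + ?N"
    proof (rule sobolev_norm_le(2))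
      fix F :: "(int^2) set" assume F: "finite F"
      obtain ks where ks: "set ks = F" using F finite_list by blast
      have "partial_norm (- 1 - \<delta>) F (\<lambda>k. mode_seq \<zeta> k - mode_seq \<eta> k) \<le> partial_norm s F (\<lambda>k. mode_seq \<zeta> k - mode_seq \<eta> k)"
        by (rule partial_norm_mono[OF s(2)])
      also have "\<dots> \<le> partial_norm s F (\<lambda>k. mode_seq \<zeta> k - rational_seq xs k) +
          partial_norm s F (\<lambda>k. rational_seq xs k - mode_seq \<eta> k)"
        by (rule partial_norm_triangle)
      also have "\<dots> \<le> of_rat \<rho> + of_rat \<rho>"
        using \<zeta> ks xs[OF F] unfolding ball by (intro add_mono) (auto simp: partial_norm_commute[of s F "mode_seq \<eta>"])
      finally have 1: "partial_norm (- 1 - \<delta>) F (\<lambda>k. mode_seq \<zeta> k - mode_seq \<eta> k) \<le> 2 * of_rat \<rho>" by simp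
      have 2: "partial_norm (- 1 - \<delta>) F (\<lambda>k. mode_seq \<eta> k - mode_seq \<omega> k) \<le> ?N"
        using partial_norm_le_sobolev_norm[OF Hminus_diff_summable[OF \<eta> \<omega> \<delta>] F] by (simp add: mode_seq_diff)
      show "partial_norm (- 1 - \<delta>) F (mode_seq (\<lambda>\<phi>. \<zeta> \<phi> - \<omega> \<phi>)) \<le> 2 * of_rat \<rho> + ?N"
        unfolding mode_seq_diff using partial_norm_triangle[of "- 1 - \<delta>" F "mode_seq \<zeta>" "mode_seq \<omega>" "mode_seq \<eta>"] 1 2
        by linarith
    qed
    then show ?thesis using \<rho>(2) by (simp add: field_simps)
  qed
  moreover have "rational_ball (n, xs, \<rho>) \<subseteq> Hminus" unfolding ball by auto
  ultimately show ?thesis by (intro exI[of _ "(n, xs, \<rho>)"]) auto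
qed

definition mode_parts :: "(real^2 \<Rightarrow> real) set" where
  "mode_parts = range (\<lambda>k x. Re (fourier_mode k x)) \<union> range (\<lambda>k x. Im (fourier_mode k x))"

lemma mode_parts_real_trig: "mode_parts \<subseteq> real_trig"
  using Re_mode Im_mode by (auto simp: mode_parts_def)

definition mode_sets :: "functional set set" where
  "mode_sets = {(\<lambda>\<omega>. \<omega> \<phi>) -` B \<inter> Hminus |\<phi> B. \<phi> \<in> mode_parts \<and> B \<in> sets borel}"

lemma rational_ball_measurable: "rational_ball p \<in> sigma_sets Hminus mode_sets"
proof -
  define N where "N = sigma Hminus mode_sets"
  have sub: "mode_sets \<subseteq> Pow Hminus" by (auto simp: mode_sets_def)
  have sp: "space N = Hminus" unfolding N_def using sub by (rule space_measure_of)
  have sets: "sets N = sigma_sets Hminus mode_sets" unfolding N_def using sub by (rule sets_measure_of)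
  have part: "(\<lambda>\<omega>. \<omega> \<phi>) \<in> borel_measurable N" if "\<phi> \<in> mode_parts" for \<phi>
    using that by (intro measurableI) (auto simp: sets sp mode_sets_def)
  have [measurable]: "(\<lambda>\<omega>. mode_seq \<omega> k) \<in> borel_measurable N" for k
  proof -
    have "(\<lambda>\<omega>. mode_seq \<omega> k) = (\<lambda>\<omega>. of_real (\<omega> (\<lambda>x. Re (fourier_mode (- k) x))) + \<i> * of_real (\<omega> (\<lambda>x. Im (fourier_mode (- k) x))))"
      by (auto simp: mode_seq_def cpair_def complex_eq_iff)
    moreover have [measurable]: "(\<lambda>\<omega>. \<omega> (\<lambda>x. Re (fourier_mode (- k) x))) \<in> borel_measurable N"
       "(\<lambda>\<omega>. \<omega> (\<lambda>x. Im (fourier_mode (- k) x))) \<in> borel_measurable N"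
      by (intro part; auto simp: mode_parts_def)+
    ultimately show ?thesis by simp
  qed
  obtain n xs r where p: "p = (n, xs, r)" by (cases p)
  have "rational_ball p = {\<zeta> \<in> space N. \<forall>ks.
     partial_norm (- 1 - 1 / real (Suc n)) (set ks) (\<lambda>k. mode_seq \<zeta> k - rational_seq xs k) \<le> of_rat r}"
    by (simp add: p rational_ball_def sp)
  also have "\<dots> \<in> sets N"
    unfolding partial_norm_def L2_set_def by measurable
  finally show ?thesis by (simp add: sets)
qed

text \<open>Finite intersections of rational balls form a countable base, so every open set is a countable
  union of measurable sets. The base property is inherited along the generation of the topology.\<close>

lemma Hminus_open_measurable:
  assumes "openin Hminus_topology U"
  shows "U \<in> sigma_sets Hminus mode_sets"
proof -
  define I where "I ps = {\<zeta> \<in> Hminus. \<forall>p\<in>set ps. \<zeta> \<in> rational_ball p}" for ps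
  interpret sigma_algebra Hminus "sigma_sets Hminus mode_sets"
    by (rule sigma_algebra_sigma_sets) (auto simp: mode_sets_def)
  have I: "I ps \<in> sigma_sets Hminus mode_sets" for ps
  proof (induction ps)
    case (Cons p ps)
    have "I (p # ps) = rational_ball p \<inter> I ps" by (auto simp: I_def)
    then show ?case using Int[OF rational_ball_measurable[of p] Cons.IH] by simp
  qed (simp add: I_def)
  have "generate_topology_on {{\<eta> \<in> Hminus. sobolev_norm (- 1 - \<delta>) (\<lambda>\<phi>. \<eta> \<phi> - \<omega> \<phi>) < r} |\<delta> r \<omega>.
        \<delta> > 0 \<and> r > 0 \<and> \<omega> \<in> Hminus} U"
    using assms unfolding Hminus_topology_def by (rule openin_topology_generated_by)
  then have base: "\<forall>\<eta>\<in>U. \<exists>ps. \<eta> \<in> I ps \<and> I ps \<subseteq> U"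
  proof (induction rule: generate_topology_on.induct)
    case (Int a b)
    show ?case
    proof
      fix \<eta> assume "\<eta> \<in> a \<inter> b"
      then obtain ps qs where "\<eta> \<in> I ps" "I ps \<subseteq> a" "\<eta> \<in> I qs" "I qs \<subseteq> b" using Int by blast
      moreover have "I (ps @ qs) = I ps \<inter> I qs" by (auto simp: I_def)
      ultimately show "\<exists>ps. \<eta> \<in> I ps \<and> I ps \<subseteq> a \<inter> b" by (intro exI[of _ "ps @ qs"]) auto
    qed
  next
    case (Basis B)
    then obtain \<delta> r \<omega> where B: "B = {\<eta> \<in> Hminus. sobolev_norm (- 1 - \<delta>) (\<lambda>\<phi>. \<eta> \<phi> - \<omega> \<phi>) < r}" "\<delta> > 0" "\<omega> \<in> Hminus"
      by blast
    show ?case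
    proof
      fix \<eta> assume \<eta>: "\<eta> \<in> B"
      then obtain p where p: "\<eta> \<in> rational_ball p" "rational_ball p \<subseteq> B"
        using rational_ball_in_ball[OF B(3) _ B(2), of \<eta> r] unfolding B(1) by blast
      have "I [p] \<subseteq> rational_ball p" "\<eta> \<in> I [p]" using p \<eta> by (auto simp: I_def B(1))
      then show "\<exists>ps. \<eta> \<in> I ps \<and> I ps \<subseteq> B" using p by blast
    qed
  qed blast+
  have "U = (\<Union>ps\<in>{ps. I ps \<subseteq> U}. I ps)" using base by blast
  moreover have "(\<Union>ps\<in>{ps. I ps \<subseteq> U}. I ps) \<in> sigma_sets Hminus mode_sets"
    using I by (intro countable_UN') auto
  ultimately show ?thesis by simp
qed

lemma sets_Hminus_borel_subset: "sets Hminus_borel \<subseteq> sigma_sets Hminus mode_sets"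
proof -
  have sub: "{U. openin Hminus_topology U} \<subseteq> sigma_sets Hminus mode_sets"
    using Hminus_open_measurable by auto
  moreover have "sigma_sets Hminus mode_sets \<subseteq> Pow Hminus"
    by (rule sigma_sets_into_sp[THEN PowI, THEN subsetI]) (auto simp: mode_sets_def)
  ultimately have "sets Hminus_borel = sigma_sets Hminus {U. openin Hminus_topology U}"
    unfolding Hminus_borel_def by (intro sets_measure_of) auto
  then show ?thesis using sigma_sets_mono[OF sub] by simp
qed

text \<open>Time and the real and imaginary parts of the modes generate the product
  \<open>\<sigma>\<close>-algebra; this is the generating family to which uniqueness of
  characteristic functions is applied.\<close>

lemma sets_time_space_subset:
  assumes \<mu>: "space \<mu> = Hminus" "sets \<mu> = sets Hminus_borel"
  shows "sets (time_space T \<mu>) \<subseteq> sigma_sets (space (time_space T \<mu>))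
     {X -` B \<inter> space (time_space T \<mu>) |X B. X \<in> insert fst ((\<lambda>\<phi> z. snd z \<phi>) ` mode_parts) \<and> B \<in> sets borel}"
    (is "_ \<subseteq> sigma_sets ?S ?G")
proof -
  have S: "?S = {0..T} \<times> Hminus" by (simp add: time_space_def space_pair_measure \<mu> space_restrict_space)
  define N where "N = sigma ?S ?G"
  have sub: "?G \<subseteq> Pow ?S" by auto
  have sp: "space N = ?S" unfolding N_def using sub by (rule space_measure_of)
  have sets: "sets N = sigma_sets ?S ?G" unfolding N_def using sub by (rule sets_measure_of)
  have gen: "X -` B \<inter> ?S \<in> sets N" if "X \<in> insert fst ((\<lambda>\<phi> z. snd z \<phi>) ` mode_parts)" "B \<in> sets borel" for X B
    unfolding sets by (rule sigma_sets.Basic) (use that in blast)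
  have "snd \<in> measurable N (sigma Hminus mode_sets)"
  proof (rule measurable_measure_of)
    show "mode_sets \<subseteq> Pow Hminus" by (auto simp: mode_sets_def)
    show "snd \<in> space N \<rightarrow> Hminus" by (auto simp: sp S)
    fix A assume "A \<in> mode_sets"
    then obtain \<phi> B where A: "A = (\<lambda>\<omega>. \<omega> \<phi>) -` B \<inter> Hminus" "\<phi> \<in> mode_parts" "B \<in> sets borel"
      by (auto simp: mode_sets_def)
    have "snd -` A \<inter> space N = (\<lambda>z. snd z \<phi>) -` B \<inter> ?S" by (auto simp: A(1) sp S)
    also have "\<dots> \<in> sets N" using A(2,3) by (intro gen) auto
    finally show "snd -` A \<inter> space N \<in> sets N" .
  qed
  moreover have "sets (sigma Hminus mode_sets) = sigma_sets Hminus mode_sets"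
    by (rule sets_measure_of) (auto simp: mode_sets_def)
  ultimately have snd: "snd -` b \<inter> ?S \<in> sets N" if "b \<in> sets \<mu>" for b
    using measurable_sets[of snd N "sigma Hminus mode_sets" b] that sets_Hminus_borel_subset \<mu> sp by auto
  have "a \<times> b \<in> sets N" if ab: "a \<in> sets (restrict_space lborel {0..T})" "b \<in> sets \<mu>" for a b
  proof -
    obtain a' where a': "a' \<in> sets borel" "a = {0..T} \<inter> a'"
      using ab(1) unfolding sets_restrict_space by auto
    have "b \<subseteq> Hminus" using sets.sets_into_space[OF ab(2)] \<mu> by simp
    then have "a \<times> b = (fst -` a' \<inter> ?S) \<inter> (snd -` b \<inter> ?S)" by (auto simp: a' S)
    also have "\<dots> \<in> sets N" using gen[of fst a'] a'(1) snd[OF ab(2)] by auto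
    finally show ?thesis .
  qed
  then show ?thesis unfolding time_space_def sets[symmetric] S[symmetric]
    using sets_pair_in_sets[of "restrict_space lborel {0..T}" \<mu> N] by (simp add: sets time_space_def)
qed

section \<open>Complex densities are determined by characteristic functions\<close>

text \<open>The positive and negative parts of \<open>g\<close> have equal mass by the case \<open>s =
  0\<close>. Normalised, they push forward under \<open>X\<close> to two probability laws with
  the same characteristic function, which Levy's theorem identifies.\<close>

lemma real_density_zero_of_char:
  fixes g X :: "'a \<Rightarrow> real"
  assumes g: "integrable M g" and X[measurable]: "X \<in> borel_measurable M"
    and char: "\<And>s. (CLINT x|M. of_real (g x) * iexp (s * X x)) = 0"
    and B[measurable]: "B \<in> sets borel"
  shows "(LINT x|M. g x * indicator B (X x)) = 0"
proof -
  note [measurable] = borel_measurable_integrable[OF g]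
  define u v where "u x = max 0 (g x)" and "v x = max 0 (- g x)" for x
  have u: "integrable M u" "\<And>x. 0 \<le> u x" and v: "integrable M v" "\<And>x. 0 \<le> v x"
    using g by (auto simp: u_def[abs_def] v_def[abs_def])
  have guv: "g x = u x - v x" for x by (auto simp: u_def v_def)
  note [measurable] = borel_measurable_integrable[OF u(1)] borel_measurable_integrable[OF v(1)]
  have int_e: "integrable M (\<lambda>x. of_real (f x) * iexp (s * X x))" if "integrable M f" for f s
  proof -
    note [measurable] = borel_measurable_integrable[OF that]
    show ?thesis
      by (rule Bochner_Integration.integrable_bound[OF that]) (auto simp: norm_mult)
  qed
  have eq: "(CLINT x|M. of_real (u x) * iexp (s * X x)) = (CLINT x|M. of_real (v x) * iexp (s * X x))" for s
  proof -
    have "(CLINT x|M. of_real (g x) * iexp (s * X x)) =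
      (CLINT x|M. of_real (u x) * iexp (s * X x) - of_real (v x) * iexp (s * X x))"
      by (intro Bochner_Integration.integral_cong) (auto simp: guv algebra_simps)
    also have "\<dots> = (CLINT x|M. of_real (u x) * iexp (s * X x)) - (CLINT x|M. of_real (v x) * iexp (s * X x))"
      by (intro Bochner_Integration.integral_diff int_e u v)
    finally show ?thesis using char[of s] by simp
  qed
  have p: "(LINT x|M. u x) = (LINT x|M. v x)"
    using eq[of 0] by simp
  have int_B: "integrable M (\<lambda>x. f x * indicator B (X x))" if "integrable M f" for f :: "'a \<Rightarrow> real"
  proof -
    note [measurable] = borel_measurable_integrable[OF that]
    show ?thesis
      by (rule Bochner_Integration.integrable_bound[OF that]) (auto simp: indicator_def)
  qed
  have "(LINT x|M. u x * indicator B (X x)) = (LINT x|M. v x * indicator B (X x))"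
  proof (cases "(LINT x|M. u x) = 0")
    case True
    have z: "(LINT x|M. f x * indicator B (X x)) = 0"
      if f: "integrable M f" "\<And>x. 0 \<le> f x" "(LINT x|M. f x) = 0" for f :: "'a \<Rightarrow> real"
    proof -
      have "AE x in M. f x = 0" using integral_nonneg_eq_0_iff_AE[OF f(1)] f by simp
      then have "AE x in M. f x * indicator B (X x) = 0" by eventually_elim simp
      then show ?thesis by (rule integral_eq_zero_AE)
    qed
    show ?thesis using z[OF u] z[OF v] True p by simp
  next
    case False
    define q where "q = (LINT x|M. u x)"
    have q: "q > 0" using False u(2) unfolding q_def by (metis Bochner_Integration.integral_nonneg less_eq_real_def)
    define N where "N f = density M (\<lambda>x. ennreal (f x / q))" for f
    have N: "prob_space (N f)" "X \<in> borel_measurable (N f)"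
      "(CLINT x|N f. iexp (s * X x)) = (CLINT x|M. of_real (f x) * iexp (s * X x)) / q"
      "(LINT x|N f. indicator B (X x)) = (LINT x|M. f x * indicator B (X x)) / q"
      if f: "integrable M f" "\<And>x. 0 \<le> f x" "(LINT x|M. f x) = q" for f s
    proof -
      note [measurable] = borel_measurable_integrable[OF f(1)]
      have "emeasure (N f) (space (N f)) = (\<integral>\<^sup>+x. ennreal (f x / q) \<partial>M)"
        unfolding N_def by (subst emeasure_density) (auto intro!: nn_integral_cong)
      also have "\<dots> = ennreal (LINT x|M. f x / q)"
        using f q by (intro nn_integral_eq_integral) auto
      also have "\<dots> = 1" using f q by simp
      finally show "prob_space (N f)" by (rule prob_spaceI)
      show "X \<in> borel_measurable (N f)" unfolding N_def by simp
      show "(CLINT x|N f. iexp (s * X x)) = (CLINT x|M. of_real (f x) * iexp (s * X x)) / q"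
        unfolding N_def using f q
        by (subst integral_density) (auto simp: scaleR_conv_of_real)
      show "(LINT x|N f. indicator B (X x)) = (LINT x|M. f x * indicator B (X x)) / q"
        unfolding N_def using f q by (subst integral_density) auto
    qed
    have d: "real_distribution (distr (N f) borel X)" "char (distr (N f) borel X) s =
        (CLINT x|M. of_real (f x) * iexp (s * X x)) / q"
       "measure (distr (N f) borel X) B = (LINT x|M. f x * indicator B (X x)) / q"
      if f: "integrable M f" "\<And>x. 0 \<le> f x" "(LINT x|M. f x) = q" for f s
    proof -
      interpret prob_space "N f" using N(1)[OF f] .
      note [measurable] = N(2)[OF f]
      show "real_distribution (distr (N f) borel X)" by simp
      show "char (distr (N f) borel X) s = (CLINT x|M. of_real (f x) * iexp (s * X x)) / q"
        unfolding char_def N(3)[OF f, symmetric] by (rule integral_distr) auto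
      have "measure (distr (N f) borel X) B = (LINT x|distr (N f) borel X. indicator B x)"
        by simp
      also have "\<dots> = (LINT x|M. f x * indicator B (X x)) / q"
        by (subst integral_distr) (auto simp: N(4)[OF f])
      finally show "measure (distr (N f) borel X) B = (LINT x|M. f x * indicator B (X x)) / q" .
    qed
    have uq: "(LINT x|M. u x) = q" "(LINT x|M. v x) = q" using p q_def by auto
    have "distr (N u) borel X = distr (N v) borel X"
      using d(2)[OF u uq(1)] d(2)[OF v uq(2)] eq
      by (intro Levy_uniqueness d(1) u v uq ext) simp
    then show ?thesis using d(3)[OF u uq(1)] d(3)[OF v uq(2)] q by simp
  qed
  then show ?thesis
    using Bochner_Integration.integral_diff[OF int_B[OF u(1)] int_B[OF v(1)]]
    by (simp add: guv algebra_simps)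
qed

lemma integral_add_scaled:
  fixes f g :: "'a \<Rightarrow> complex"
  assumes "integrable M f" "integrable M g"
  shows "(CLINT x|M. f x + c * g x) = (CLINT x|M. f x) + c * (CLINT x|M. g x)"
  using assms by simp

text \<open>Conjugation together with \<open>s \<mapsto> - s\<close> shows that the conjugate of
  \<open>G\<close> has the same property, hence so does its real part. The imaginary part of
  \<open>G\<close> is the real part of \<open>- i G\<close>.\<close>

lemma complex_density_zero_of_char:
  fixes G :: "'a \<Rightarrow> complex" and X :: "'a \<Rightarrow> real"
  assumes G: "integrable M G" and X[measurable]: "X \<in> borel_measurable M"
    and char: "\<And>s. (CLINT x|M. G x * iexp (s * X x)) = 0"
    and B[measurable]: "B \<in> sets borel"
  shows "(CLINT x|M. G x * indicator B (X x)) = 0"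
proof -
  have Re0: "(LINT x|M. Re (F x) * indicator B (X x)) = 0"
    if F: "integrable M F" and char: "\<And>s. (CLINT x|M. F x * iexp (s * X x)) = 0" for F
  proof (rule real_density_zero_of_char[OF integrable_Re[OF F] X _ B])
    fix s
    note [measurable] = borel_measurable_integrable[OF F]
    have int: "integrable M (\<lambda>x. F x * iexp (s * X x))" for s
      by (rule Bochner_Integration.integrable_bound[OF F]) (auto simp: norm_mult)
    have "(CLINT x|M. of_real (Re (F x)) * iexp (s * X x)) =
       (CLINT x|M. (1/2) * (F x * iexp (s * X x)) + (1/2) * cnj (F x * iexp ((- s) * X x)))"
    proof (intro Bochner_Integration.integral_cong refl)
      fix x
      have "complex_of_real (Re (F x)) = (F x + cnj (F x)) / 2" by (simp add: complex_eq_iff)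
      then show "of_real (Re (F x)) * iexp (s * X x) =
        (1/2) * (F x * iexp (s * X x)) + (1/2) * cnj (F x * iexp ((- s) * X x))"
        by (simp only:) (simp add: exp_cnj field_simps)
    qed
    also have "\<dots> = (CLINT x|M. (1/2) * (F x * iexp (s * X x))) + (1/2) * (CLINT x|M. cnj (F x * iexp ((- s) * X x)))"
      by (rule integral_add_scaled) (use int in \<open>simp_all only: integrable_mult_right integrable_cnj\<close>)
    also have "\<dots> = 0"
      unfolding Bochner_Integration.integral_cnj integral_mult_right_zero char by simp
    finally show "(CLINT x|M. of_real (Re (F x)) * iexp (s * X x)) = 0" .
  qed
  have "(CLINT x|M. - \<i> * G x * iexp (s * X x)) = 0" for s
    using char[of s] by (simp only: mult.assoc integral_mult_right_zero mult_zero_right)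
  from Re0[OF _ this] have Im0: "(LINT x|M. Im (G x) * indicator B (X x)) = 0" using G by simp
  note [measurable] = borel_measurable_integrable[OF G]
  have iB: "integrable M (\<lambda>x. G x * indicator B (X x))"
    by (rule Bochner_Integration.integrable_bound[OF G]) (auto simp: indicator_def)
  have "Re (G x * indicator B (X x)) = Re (G x) * indicator B (X x)"
    "Im (G x * indicator B (X x)) = Im (G x) * indicator B (X x)" for x
    by (auto simp: indicator_def)
  then show ?thesis using integral_Re[OF iB] integral_Im[OF iB] Re0[OF G char] Im0
    by (simp add: complex_eq_iff)
qed

text \<open>A multivariate uniqueness theorem reduced to one variable at a time: the one-dimensional
  statement replaces the factor \<open>exp (i s X)\<close> by the indicator of an event of
  \<open>X\<close>, while the remaining exponential is kept as part of the density. Induction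
  over a list of variables gives all cylinder events, and the
  \<open>\<pi>\<close>-\<open>\<lambda>\<close> theorem gives all events.\<close>

lemma complex_density_zero_of_joint_char:
  fixes G :: "'a \<Rightarrow> complex" and W V :: "('a \<Rightarrow> real) set"
  assumes fin: "sigma_finite_measure M" and G: "integrable M G" and W: "W \<subseteq> borel_measurable M"
    and VW: "V \<subseteq> W" and zero: "(\<lambda>_. 0) \<in> W"
    and lin: "\<And>X Y s. X \<in> W \<Longrightarrow> Y \<in> V \<Longrightarrow> (\<lambda>x. X x + s * Y x) \<in> W"
    and gen: "sets M \<subseteq> sigma_sets (space M) {X -` B \<inter> space M |X B. X \<in> V \<and> B \<in> sets borel}"
    and char: "\<And>X. X \<in> W \<Longrightarrow> (CLINT x|M. G x * iexp (X x)) = 0"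
  shows "AE x in M. G x = 0"
proof -
  note [measurable] = borel_measurable_integrable[OF G]
  define I where "I ps = {x \<in> space M. \<forall>(X, B)\<in>set ps. X x \<in> B}" for ps :: "(('a \<Rightarrow> real) \<times> real set) list"
  define ok where "ok ps \<longleftrightarrow> set ps \<subseteq> V \<times> sets borel" for ps :: "(('a \<Rightarrow> real) \<times> real set) list"
  have meas: "I ps \<in> sets M" if "ok ps" for ps
    using that
  proof (induction ps)
    case (Cons p ps)
    obtain X B where p: "p = (X, B)" by force
    have [measurable]: "X \<in> borel_measurable M" "B \<in> sets borel"
      using Cons.prems VW W by (auto simp: ok_def p)
    have "I (p # ps) = (X -` B \<inter> space M) \<inter> I ps" by (auto simp: I_def p)
    moreover have "X -` B \<inter> space M \<in> sets M" by measurable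
    moreover have "I ps \<in> sets M" using Cons by (simp add: ok_def)
    ultimately show ?case by auto
  qed (simp add: I_def)
  have int: "integrable M (\<lambda>x. G x * indicator A x * iexp (X x))" if "A \<in> sets M" "X \<in> W" for A X
  proof -
    have [measurable]: "A \<in> sets M" "X \<in> borel_measurable M" using that W by auto
    show ?thesis
      by (rule Bochner_Integration.integrable_bound[OF G]) (auto simp: norm_mult indicator_def)
  qed
  have key: "ok ps \<Longrightarrow> Y \<in> W \<Longrightarrow> (CLINT x|M. G x * indicator (I ps) x * iexp (Y x)) = 0" for ps Y
  proof (induction ps arbitrary: Y)
    case Nil
    have "(CLINT x|M. G x * indicator (I []) x * iexp (Y x)) = (CLINT x|M. G x * iexp (Y x))"
      by (intro Bochner_Integration.integral_cong) (auto simp: I_def)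
    then show ?case using char[OF Nil(2)] by simp
  next
    case (Cons p ps)
    obtain X B where p: "p = (X, B)" by force
    have XB: "X \<in> V" "B \<in> sets borel" and ok: "ok ps"
      using Cons.prems by (auto simp: ok_def p)
    have X: "X \<in> borel_measurable M" using XB VW W by auto
    have "(CLINT x|M. (G x * indicator (I ps) x * iexp (Y x)) * indicator B (X x)) = 0"
    proof (rule complex_density_zero_of_char[OF int[OF meas[OF ok] Cons.prems(2)] X _ XB(2)])
      fix s
      have "(CLINT x|M. (G x * indicator (I ps) x * iexp (Y x)) * iexp (s * X x)) =
        (CLINT x|M. G x * indicator (I ps) x * iexp (Y x + s * X x))"
        by (intro Bochner_Integration.integral_cong) (auto simp: exp_add distrib_left)
      also have "\<dots> = 0" by (rule Cons.IH[OF ok lin[OF Cons.prems(2) XB(1)]])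
      finally show "(CLINT x|M. (G x * indicator (I ps) x * iexp (Y x)) * iexp (s * X x)) = 0" .
    qed
    moreover have "(CLINT x|M. (G x * indicator (I ps) x * iexp (Y x)) * indicator B (X x)) =
      (CLINT x|M. G x * indicator (I (p # ps)) x * iexp (Y x))"
      by (intro Bochner_Integration.integral_cong) (auto simp: I_def p indicator_def)
    ultimately show ?case by simp
  qed
  define \<E> where "\<E> = {I ps |ps. ok ps}"
  have \<E>0: "(LINT x:A|M. G x) = 0" if A: "A \<in> \<E>" for A
  proof -
    obtain ps where ps: "ok ps" "A = I ps" using A unfolding \<E>_def by blast
    have "(LINT x:A|M. G x) = (CLINT x|M. G x * indicator (I ps) x * iexp 0)"
      unfolding set_lebesgue_integral_def ps
      by (intro Bochner_Integration.integral_cong) (auto simp: indicator_def)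
    then show ?thesis using key[OF ps(1) zero] by simp
  qed
  have stable: "Int_stable \<E>"
  proof (rule Int_stableI)
    fix A B assume "A \<in> \<E>" "B \<in> \<E>"
    then obtain ps qs where "ok ps" "A = I ps" "ok qs" "B = I qs" unfolding \<E>_def by blast
    then have "A \<inter> B = I (ps @ qs)" "ok (ps @ qs)" by (auto simp: I_def ok_def)
    then show "A \<inter> B \<in> \<E>" unfolding \<E>_def by blast
  qed
  have \<E>_sub: "\<E> \<subseteq> sets M" using meas unfolding \<E>_def by blast
  have "{X -` B \<inter> space M |X B. X \<in> V \<and> B \<in> sets borel} \<subseteq> \<E>"
  proof safe
    fix X :: "'a \<Rightarrow> real" and B :: "real set" assume "X \<in> V" "B \<in> sets borel"
    then have "X -` B \<inter> space M = I [(X, B)]" "ok [(X, B)]" by (auto simp: I_def ok_def)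
    then show "X -` B \<inter> space M \<in> \<E>" unfolding \<E>_def by blast
  qed
  then have sub: "sets M \<subseteq> sigma_sets (space M) \<E>" by (rule order_trans[OF gen sigma_sets_mono'])
  have sM: "sigma_sets (space M) \<E> \<subseteq> sets M"
    using \<E>_sub by (rule sets.sigma_sets_subset)
  have setint: "set_integrable M A G" if "A \<in> sets M" for A
    unfolding set_integrable_def using that G by (rule integrable_mult_indicator)
  have \<E>_Pow: "\<E> \<subseteq> Pow (space M)" using \<E>_sub sets.sets_into_space by blast
  have zero_tot: "(CLINT x|M. G x) = 0" using char[OF zero] by simp
  have all: "(LINT x:A|M. G x) = 0" if "A \<in> sets M" for A
    using stable \<E>_Pow sub[THEN subsetD, OF that]
  proof (induction rule: sigma_sets_induct_disjoint)
    fix A assume "A \<in> \<E>" then show "(LINT x:A|M. G x) = 0" by (rule \<E>0)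
  next
    show "(LINT x:{}|M. G x) = 0" by (simp add: set_lebesgue_integral_def)
  next
    fix A assume A: "A \<in> sigma_sets (space M) \<E>" "(LINT x:A|M. G x) = 0"
    have AM: "A \<in> sets M" using A sM by auto
    have "(LINT x:(space M - A) \<union> A|M. G x) = (LINT x:space M - A|M. G x) + (LINT x:A|M. G x)"
      using AM by (intro set_integral_Un setint) auto
    moreover have "(space M - A) \<union> A = space M" using sets.sets_into_space[OF AM] by auto
    moreover have "(LINT x:space M|M. G x) = 0" using zero_tot set_integral_space[OF G] by simp
    ultimately show "(LINT x:space M - A|M. G x) = 0" using A by simp
  next
    fix A :: "nat \<Rightarrow> 'a set"
    assume A: "disjoint_family A" "range A \<subseteq> sigma_sets (space M) \<E>" "\<And>i. (LINT x:A i|M. G x) = 0"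
    have AM: "A i \<in> sets M" for i using A(2) sM by auto
    have "(LINT x:(\<Union>i. A i)|M. G x) = (\<Sum>i. (LINT x:A i|M. G x))"
      using A AM by (intro lebesgue_integral_countable_add setint) (auto simp: disjoint_family_on_def)
    then show "(LINT x:(\<Union>i. A i)|M. G x) = 0" using A by simp
  qed
  show ?thesis
    by (rule sigma_finite_measure.density_zero[OF fin G all])
qed

section \<open>Moments of white noise\<close>

lemma (in prob_space) centered_gaussian_moments:
  assumes "centered_gaussian M X"
  shows "integrable M (\<lambda>x. X x ^ n)" and "expectation (\<lambda>x. X x ^ 4) = 3 * (expectation (\<lambda>x. (X x)\<^sup>2))\<^sup>2"
proof -
  have [measurable]: "X \<in> borel_measurable M" using assms by (simp add: centered_gaussian_def)
  have "integrable M (\<lambda>x. X x ^ n) \<and> expectation (\<lambda>x. X x ^ 4) = 3 * (expectation (\<lambda>x. (X x)\<^sup>2))\<^sup>2"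
  proof (cases "AE x in M. X x = 0")
    case True
    have "integrable M (\<lambda>x. X x ^ n) \<longleftrightarrow> integrable M (\<lambda>x. 0 ^ n :: real)"
      using True by (intro integrable_cong_AE) auto
    moreover have "expectation (\<lambda>x. X x ^ k) = expectation (\<lambda>x. 0 ^ k)" for k
      using True by (intro integral_cong_AE) auto
    ultimately show ?thesis by simp
  next
    case False
    then obtain s where s: "s > 0" and d: "distributed M lborel X (\<lambda>x. ennreal (normal_density 0 s x))"
      using assms unfolding centered_gaussian_def by auto
    have "integrable M (\<lambda>x. X x ^ n)"
      using distributed_integrable[OF d, of "\<lambda>x. x ^ n"] integrable_normal_moment[OF s, of 0 n] by simp
    moreover have e: "expectation (\<lambda>x. X x ^ (2 * k)) = fact (2 * k) / ((2 / s\<^sup>2)^k * fact k)" for k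
      using distributed_integral[OF d, of "\<lambda>x. x ^ (2 * k)"] integral_normal_moment_even[OF s, of 0 k] by simp
    have "expectation (\<lambda>x. X x ^ 4) = 3 * (expectation (\<lambda>x. (X x)\<^sup>2))\<^sup>2"
      using e[of 1] e[of 2] s by (simp add: fact_numeral power2_eq_square power_divide field_simps)
    ultimately show ?thesis by blast
  qed
  then show "integrable M (\<lambda>x. X x ^ n)" "expectation (\<lambda>x. X x ^ 4) = 3 * (expectation (\<lambda>x. (X x)\<^sup>2))\<^sup>2"
    by blast+
qed

lemma abs_prod4_le:
  fixes a b c d :: real
  shows "\<bar>a * b * c * d\<bar> \<le> a^4 + b^4 + c^4 + d^4"
proof -
  have *: "\<bar>x * y\<bar> \<le> (x\<^sup>2 + y\<^sup>2) / 2" for x y :: real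
    using sum_squares_bound[of "\<bar>x\<bar>" "\<bar>y\<bar>"] by (simp add: abs_mult)
  have "\<bar>(a * b) * (c * d)\<bar> \<le> ((a * b)\<^sup>2 + (c * d)\<^sup>2) / 2" by (rule *)
  moreover have "\<bar>a\<^sup>2 * b\<^sup>2\<bar> \<le> ((a\<^sup>2)\<^sup>2 + (b\<^sup>2)\<^sup>2) / 2" "\<bar>c\<^sup>2 * d\<^sup>2\<bar> \<le> ((c\<^sup>2)\<^sup>2 + (d\<^sup>2)\<^sup>2) / 2"
    by (rule *)+
  moreover have "0 \<le> a^4" "0 \<le> b^4" "0 \<le> c^4" "0 \<le> d^4" by (simp_all add: zero_le_even_power)
  ultimately show ?thesis
    by (simp add: power_mult_distrib mult.assoc flip: power_mult)
qed

text \<open>Wick's formula for four variables follows by polarisation from \<open>E L\<^sup>4 = 3 (E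
  L\<^sup>2)\<^sup>2\<close> for centred Gaussian \<open>L\<close>.\<close>

lemma (in prob_space) isserlis4:
  assumes g: "\<And>a b c d. centered_gaussian M (\<lambda>x. a * A x + b * B x + c * C x + d * D x)"
  shows "integrable M (\<lambda>x. A x * B x * C x * D x)"
    and "integrable M (\<lambda>x. A x * B x)"
    and "expectation (\<lambda>x. A x * B x * C x * D x) =
      expectation (\<lambda>x. A x * B x) * expectation (\<lambda>x. C x * D x) +
      expectation (\<lambda>x. A x * C x) * expectation (\<lambda>x. B x * D x) +
      expectation (\<lambda>x. A x * D x) * expectation (\<lambda>x. B x * C x)"
proof -
  have gA: "centered_gaussian M A" and gB: "centered_gaussian M B"
    and gC: "centered_gaussian M C" and gD: "centered_gaussian M D"
    using g[of 1 0 0 0] g[of 0 1 0 0] g[of 0 0 1 0] g[of 0 0 0 1] by simp_all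
  have [measurable]: "A \<in> borel_measurable M" "B \<in> borel_measurable M" "C \<in> borel_measurable M" "D \<in> borel_measurable M"
    using gA gB gC gD by (simp_all add: centered_gaussian_def)
  note mom = centered_gaussian_moments(1)
  show int4: "integrable M (\<lambda>x. A x * B x * C x * D x)"
    by (rule Bochner_Integration.integrable_bound[of _ "\<lambda>x. A x ^ 4 + B x ^ 4 + C x ^ 4 + D x ^ 4"])
      (use abs_prod4_le in \<open>auto intro!: Bochner_Integration.integrable_add mom gA gB gC gD
        simp: order.trans[OF abs_prod4_le abs_ge_self]\<close>)
  have int2: "integrable M (\<lambda>x. P x * Q x)" if "centered_gaussian M P" "centered_gaussian M Q" for P Q
  proof (rule Bochner_Integration.integrable_bound[of _ "\<lambda>x. (P x)\<^sup>2 + (Q x)\<^sup>2"])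
    have [measurable]: "P \<in> borel_measurable M" "Q \<in> borel_measurable M"
      using that by (simp_all add: centered_gaussian_def)
    show "integrable M (\<lambda>x. (P x)\<^sup>2 + (Q x)\<^sup>2)"
      by (intro Bochner_Integration.integrable_add mom that)
    show "(\<lambda>x. P x * Q x) \<in> borel_measurable M" by measurable
    have "\<bar>p * q\<bar> \<le> \<bar>p\<^sup>2 + q\<^sup>2\<bar>" for p q :: real
    proof -
      have "2 * \<bar>p\<bar> * \<bar>q\<bar> \<le> p\<^sup>2 + q\<^sup>2" using sum_squares_bound[of "\<bar>p\<bar>" "\<bar>q\<bar>"] by simp
      moreover have "0 \<le> \<bar>p\<bar> * \<bar>q\<bar>" by simp
      ultimately show ?thesis unfolding abs_mult by linarith
    qed
    then show "AE x in M. norm (P x * Q x) \<le> norm ((P x)\<^sup>2 + (Q x)\<^sup>2)" by simp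
  qed
  show "integrable M (\<lambda>x. A x * B x)" by (rule int2[OF gA gB])
  define L where "L b c d x = A x + b * B x + c * C x + d * D x" for b c d x
  have gL: "centered_gaussian M (L b c d)" for b c d
    using g[of 1 b c d] by (simp add: L_def[abs_def])
  define V where "V b c d = expectation (\<lambda>x. (L b c d x)\<^sup>2)" for b c d
  define e where "e P Q = expectation (\<lambda>x. P x * Q x)" for P Q :: "'a \<Rightarrow> real"
  have V: "V b c d = e A A + b\<^sup>2 * e B B + c\<^sup>2 * e C C + d\<^sup>2 * e D D + 2 * b * e A B + 2 * c * e A C + 2 * d * e A D
     + 2 * b * c * e B C + 2 * b * d * e B D + 2 * c * d * e C D" for b c d
  proof -
    have "V b c d = expectation (\<lambda>x. A x * A x + b\<^sup>2 * (B x * B x) + c\<^sup>2 * (C x * C x) + d\<^sup>2 * (D x * D x)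
      + 2 * b * (A x * B x) + 2 * c * (A x * C x) + 2 * d * (A x * D x)
      + 2 * b * c * (B x * C x) + 2 * b * d * (B x * D x) + 2 * c * d * (C x * D x))"
      unfolding V_def L_def
      by (intro Bochner_Integration.integral_cong refl) (simp add: power2_eq_square algebra_simps)
    then show ?thesis unfolding e_def
      by (simp add: int2 gA gB gC gD)
  qed
  define s where "s = e A A + e B B + e C C + e D D"
  have V8: "V 1 1 1 = s + 2 * (e A B + e A C + e A D + e B C + e B D + e C D)"
    "V 1 1 (-1) = s + 2 * (e A B + e A C - e A D + e B C - e B D - e C D)"
    "V 1 (-1) 1 = s + 2 * (e A B - e A C + e A D - e B C + e B D - e C D)"
    "V 1 (-1) (-1) = s + 2 * (e A B - e A C - e A D - e B C - e B D + e C D)"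
    "V (-1) 1 1 = s + 2 * (- e A B + e A C + e A D - e B C - e B D + e C D)"
    "V (-1) 1 (-1) = s + 2 * (- e A B + e A C - e A D - e B C + e B D - e C D)"
    "V (-1) (-1) 1 = s + 2 * (- e A B - e A C + e A D + e B C - e B D - e C D)"
    "V (-1) (-1) (-1) = s + 2 * (- e A B - e A C - e A D + e B C + e B D + e C D)"
    unfolding V s_def by simp_all
  have int_L: "integrable M (\<lambda>x. L b c d x ^ 4)" for b c d by (rule mom[OF gL])
  have EL: "expectation (\<lambda>x. L b c d x ^ 4) = 3 * (V b c d)\<^sup>2" for b c d
    unfolding V_def by (rule centered_gaussian_moments(2)[OF gL])
  \<comment> \<open>Summing \<open>bcd (A + bB + cC + dD)\<^sup>4\<close> over the eight choices of signs leaves the \<open>4! = 24\<close> mixed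
    monomials \<open>ABCD\<close> of each term, and \<open>8 \<cdot> 24 = 192\<close>.\<close>
  have pol: "192 * (A x * B x * C x * D x) =
      L 1 1 1 x ^ 4 - L 1 1 (-1) x ^ 4 - L 1 (-1) 1 x ^ 4 + L 1 (-1) (-1) x ^ 4
      - L (-1) 1 1 x ^ 4 + L (-1) 1 (-1) x ^ 4 + L (-1) (-1) 1 x ^ 4 - L (-1) (-1) (-1) x ^ 4" for x
    unfolding L_def by algebra
  have "192 * expectation (\<lambda>x. A x * B x * C x * D x) = expectation (\<lambda>x. 192 * (A x * B x * C x * D x))"
    using int4 by simp
  also have "\<dots> = 3 * (V 1 1 1)\<^sup>2 - 3 * (V 1 1 (-1))\<^sup>2 - 3 * (V 1 (-1) 1)\<^sup>2 + 3 * (V 1 (-1) (-1))\<^sup>2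
      - 3 * (V (-1) 1 1)\<^sup>2 + 3 * (V (-1) 1 (-1))\<^sup>2 + 3 * (V (-1) (-1) 1)\<^sup>2 - 3 * (V (-1) (-1) (-1))\<^sup>2"
    unfolding pol by (simp add: int_L EL)
  also have "\<dots> = 192 * (e A B * e C D + e A C * e B D + e A D * e B C)"
    unfolding V8 by algebra
  finally show "expectation (\<lambda>x. A x * B x * C x * D x) =
      expectation (\<lambda>x. A x * B x) * expectation (\<lambda>x. C x * D x) +
      expectation (\<lambda>x. A x * C x) * expectation (\<lambda>x. B x * D x) +
      expectation (\<lambda>x. A x * D x) * expectation (\<lambda>x. B x * C x)"
    by (simp add: e_def)
qed

text \<open>Lebesgue measure on the unit square is a product measure, so the integral factorises over the
  coordinates, and a coordinate with a non-zero frequency contributes a zero factor.\<close>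

lemma integral_fourier_mode:
  "(CLINT x:cbox 0 1|lborel. fourier_mode k x) = (if k = 0 then 1 else 0)"
proof -
  let ?f = "\<lambda>(b::real^2) (t::real). indicator {0..1} t *\<^sub>R exp (2 * of_real pi * \<i> * of_real (real_freq k \<bullet> b) * of_real t)"
  interpret product_sigma_finite "\<lambda>_::real^2. lborel :: real measure" ..
  have int: "integrable lborel (?f b)" for b
    by (rule borel_integrable_compact) (auto intro!: continuous_intros)
  have one: "(1::real^2) \<bullet> b = 1" if "b \<in> Basis" for b
    using that by (auto simp: Basis_vec_def inner_axis)
  have "(CLINT x:cbox 0 1|lborel. fourier_mode k x) =
     (LINT f|Pi\<^sub>M Basis (\<lambda>_. lborel). indicator (cbox 0 1) (\<Sum>b\<in>Basis. f b *\<^sub>R b) *\<^sub>R fourier_mode k (\<Sum>b\<in>Basis. f b *\<^sub>R b))"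
    unfolding set_lebesgue_integral_def
    by (subst lborel_eq, subst integral_distr) (auto intro!: borel_measurable_scaleR
        borel_measurable_continuous_onI[OF fourier_mode_continuous])
  also have "\<dots> = (LINT f|Pi\<^sub>M Basis (\<lambda>_. lborel). (\<Prod>b\<in>Basis. ?f b (f b)))"
  proof (intro Bochner_Integration.integral_cong refl)
    fix f :: "real^2 \<Rightarrow> real"
    have s: "(\<Sum>b\<in>Basis. f b *\<^sub>R b) \<bullet> b' = f b'" if "b' \<in> Basis" for b'
      using that by (simp add: inner_sum_left inner_Basis if_distrib sum.delta cong: if_cong)
    have i: "(\<Sum>b\<in>Basis. f b *\<^sub>R b) \<in> cbox 0 1 \<longleftrightarrow> (\<forall>b\<in>Basis. f b \<in> {0..1})"
      by (simp add: mem_box s one)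
    have "fourier_mode k (\<Sum>b\<in>Basis. f b *\<^sub>R b) =
       (\<Prod>b\<in>Basis. exp (2 * of_real pi * \<i> * of_real (real_freq k \<bullet> b) * of_real (f b)))"
      by (simp add: fourier_mode_def inner_sum_right sum_distrib_left exp_sum mult_ac)
    moreover have "indicator (cbox 0 1) (\<Sum>b\<in>Basis. f b *\<^sub>R b) = (\<Prod>b\<in>Basis. indicator {0..1} (f b) :: real)"
      unfolding indicator_def of_bool_def i by (cases "\<forall>b\<in>Basis. f b \<in> {0..1}") (auto simp: prod_zero_iff)
    ultimately show "indicator (cbox 0 1) (\<Sum>b\<in>Basis. f b *\<^sub>R b) *\<^sub>R fourier_mode k (\<Sum>b\<in>Basis. f b *\<^sub>R b) =
      (\<Prod>b\<in>Basis. ?f b (f b))"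
      by (simp add: scaleR_conv_of_real prod.distrib)
  qed
  also have "\<dots> = (\<Prod>b\<in>Basis. LINT t|lborel. ?f b t)"
    by (intro product_integral_prod int) auto
  also have "\<dots> = (if k = 0 then 1 else 0)"
  proof (cases "k = 0")
    case True
    then have "real_freq k = 0" by (simp add: real_freq_def vec_eq_iff)
    then have "(LINT t|lborel. ?f b t) = 1" for b
      by (simp flip: set_lebesgue_integral_def add: set_integral_const)
    then show ?thesis using True by simp
  next
    case False
    then obtain i where i: "k $ i \<noteq> 0" by (auto simp: vec_eq_iff)
    define b :: "real^2" where "b = axis i 1"
    have b: "b \<in> Basis" by (auto simp: b_def Basis_vec_def)
    let ?c = "2 * of_real pi * \<i> * of_int (k $ i) :: complex"
    have c: "?c \<noteq> 0" using i by simp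
    have kb: "real_freq k \<bullet> b = k $ i" by (simp add: b_def inner_axis real_freq_def)
    have e: "exp ?c = 1"
      by (simp add: exp_eq_1)
    have "(LINT t|lborel. indicator {0..1} t *\<^sub>R exp (?c * of_real t)) = exp (?c * of_real 1) / ?c - exp (?c * of_real 0) / ?c"
    proof (rule integral_FTC_atLeastAtMost)
      fix x :: real
      have "((\<lambda>z. exp (?c * z) / ?c) has_field_derivative exp (?c * of_real x)) (at (of_real x))"
        using c by (auto intro!: derivative_eq_intros)
      from has_vector_derivative_real_field[OF this]
      show "((\<lambda>x. exp (?c * of_real x) / ?c) has_vector_derivative exp (?c * of_real x)) (at x within {0..1})"
        by (rule has_vector_derivative_at_within)
    qed (auto intro!: continuous_intros)
    then have "(LINT t|lborel. ?f b t) = 0" using e by (simp add: kb)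
    from this b have "\<exists>b\<in>Basis. (LINT t|lborel. ?f b t) = 0" by (rule bexI)
    with finite_Basis have "(\<Prod>b\<in>Basis. LINT t|lborel. ?f b t) = 0" by (rule prod_zero)
    then show ?thesis using False by simp
  qed
  finally show ?thesis .
qed

locale white_noise =
  fixes \<mu> :: "functional measure"
  assumes law: "white_noise_law \<mu>"

sublocale white_noise \<subseteq> prob_space \<mu>
  using law by (simp add: white_noise_law_def)

abbreviation mode :: "int^2 \<Rightarrow> functional \<Rightarrow> complex" where
  "mode k \<omega> \<equiv> cpair \<omega> (fourier_mode k)"

lemma Hminus_distributions: "\<omega> \<in> Hminus \<Longrightarrow> \<omega> \<in> distributions"
  unfolding Hminus_def sobolev_def by (auto dest!: bspec[of _ _ 1])

context white_noise
begin

lemma space_eq: "space \<mu> = Hminus" and sets_eq: "sets \<mu> = sets Hminus_borel"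
  using law by (auto simp: white_noise_law_def)

text \<open>The defining property of white noise is indexed by finite sets of test functions; a family with
  repetitions is covered by collecting equal test functions.\<close>

lemma gaussian_comb:
  fixes J :: "'i set"
  assumes "finite J" "\<And>j. j \<in> J \<Longrightarrow> \<phi> j \<in> real_trig"
  shows "centered_gaussian \<mu> (\<lambda>\<omega>. \<Sum>j\<in>J. c j * \<omega> (\<phi> j))"
proof -
  have eq: "(\<Sum>j\<in>J. c j * \<omega> (\<phi> j)) = (\<Sum>\<psi>\<in>\<phi> ` J. (\<Sum>j | j \<in> J \<and> \<phi> j = \<psi>. c j) * \<omega> \<psi>)" for \<omega> :: functional
    by (subst sum.image_gen[OF assms(1), of _ \<phi>]) (auto simp: sum_distrib_right intro!: sum.cong)
  have sub: "finite (\<phi> ` J) \<and> \<phi> ` J \<subseteq> smooth_torus" using assms real_trig_smooth by auto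
  have "centered_gaussian \<mu> (\<lambda>\<omega>. \<Sum>\<phi>\<in>\<Phi>. d \<phi> * \<omega> \<phi>)" if "finite \<Phi> \<and> \<Phi> \<subseteq> smooth_torus" for \<Phi> d
    using law that by (simp add: white_noise_law_def)
  from this[OF sub] show ?thesis unfolding eq .
qed

lemma gaussian4:
  assumes "\<phi>1 \<in> real_trig" "\<phi>2 \<in> real_trig" "\<phi>3 \<in> real_trig" "\<phi>4 \<in> real_trig"
  shows "centered_gaussian \<mu> (\<lambda>\<omega>. a * \<omega> \<phi>1 + b * \<omega> \<phi>2 + c * \<omega> \<phi>3 + d * \<omega> \<phi>4)"
proof -
  have "centered_gaussian \<mu> (\<lambda>\<omega>. \<Sum>j<4. [a,b,c,d] ! j * \<omega> ([\<phi>1,\<phi>2,\<phi>3,\<phi>4] ! j))"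
    using assms by (intro gaussian_comb) (auto simp: less_Suc_eq numeral_eq_Suc)
  then show ?thesis by (simp add: numeral_eq_Suc)
qed

lemma pair_measurable [measurable]: "\<phi> \<in> real_trig \<Longrightarrow> (\<lambda>\<omega>. \<omega> \<phi>) \<in> borel_measurable \<mu>"
  using gaussian4[of \<phi> \<phi> \<phi> \<phi> 1 0 0 0] by (simp add: centered_gaussian_def)

lemma covariance:
  assumes "\<phi> \<in> real_trig" "\<psi> \<in> real_trig"
  shows "integrable \<mu> (\<lambda>\<omega>. \<omega> \<phi> * \<omega> \<psi>)"
    and "(LINT \<omega>|\<mu>. \<omega> \<phi> * \<omega> \<psi>) = (LINT x:cbox 0 1|lborel. \<phi> x * \<psi> x)"
proof -
  show "integrable \<mu> (\<lambda>\<omega>. \<omega> \<phi> * \<omega> \<psi>)"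
    by (rule isserlis4(2)[OF gaussian4[OF assms assms]])
  have "\<phi> \<in> smooth_torus" "\<psi> \<in> smooth_torus" using assms real_trig_smooth by auto
  then show "(LINT \<omega>|\<mu>. \<omega> \<phi> * \<omega> \<psi>) = (LINT x:cbox 0 1|lborel. \<phi> x * \<psi> x)"
    using law by (simp add: white_noise_law_def)
qed

lemma mode_measurable [measurable]: "mode k \<in> borel_measurable \<mu>"
proof -
  have "mode k = (\<lambda>\<omega>. of_real (\<omega> (\<lambda>x. Re (fourier_mode k x))) + \<i> * of_real (\<omega> (\<lambda>x. Im (fourier_mode k x))))"
    by (auto simp: cpair_def complex_eq_iff)
  moreover have [measurable]: "(\<lambda>\<omega>. \<omega> (\<lambda>x. Re (fourier_mode k x))) \<in> borel_measurable \<mu>"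
     "(\<lambda>\<omega>. \<omega> (\<lambda>x. Im (fourier_mode k x))) \<in> borel_measurable \<mu>"
    by (intro pair_measurable Re_mode Im_mode)+
  ultimately show ?thesis by simp
qed

definition cov :: "(functional \<Rightarrow> complex) \<Rightarrow> (functional \<Rightarrow> complex) \<Rightarrow> complex" where
  "cov X Y = (CLINT \<omega>|\<mu>. X \<omega> * Y \<omega>)"

text \<open>Integrability is part of the property, so that it passes to complex combinations in one slot;
  rotating the slots then extends the formula from real to complex variables.\<close>

definition isserlis :: "(functional \<Rightarrow> complex) \<Rightarrow> (functional \<Rightarrow> complex) \<Rightarrow> (functional \<Rightarrow> complex) \<Rightarrow>
    (functional \<Rightarrow> complex) \<Rightarrow> bool" where
  "isserlis A B C D \<longleftrightarrow>
     integrable \<mu> (\<lambda>\<omega>. A \<omega> * B \<omega>) \<and> integrable \<mu> (\<lambda>\<omega>. A \<omega> * C \<omega>) \<and> integrable \<mu> (\<lambda>\<omega>. A \<omega> * D \<omega>) \<and>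
     integrable \<mu> (\<lambda>\<omega>. B \<omega> * C \<omega>) \<and> integrable \<mu> (\<lambda>\<omega>. B \<omega> * D \<omega>) \<and> integrable \<mu> (\<lambda>\<omega>. C \<omega> * D \<omega>) \<and>
     integrable \<mu> (\<lambda>\<omega>. A \<omega> * B \<omega> * C \<omega> * D \<omega>) \<and>
     (CLINT \<omega>|\<mu>. A \<omega> * B \<omega> * C \<omega> * D \<omega>) = cov A B * cov C D + cov A C * cov B D + cov A D * cov B C"

lemma isserlis_rotate: "isserlis A B C D \<Longrightarrow> isserlis B C D A"
  unfolding isserlis_def cov_def by (simp add: mult_ac)

lemma isserlis_complex_combination:
  assumes "isserlis A B C D" "isserlis A' B C D"
  shows "isserlis (\<lambda>\<omega>. A \<omega> + \<i> * A' \<omega>) B C D"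
proof -
  have c: "cov (\<lambda>\<omega>. A \<omega> + \<i> * A' \<omega>) X = cov A X + \<i> * cov A' X"
    if "integrable \<mu> (\<lambda>\<omega>. A \<omega> * X \<omega>)" "integrable \<mu> (\<lambda>\<omega>. A' \<omega> * X \<omega>)" for X
    using that by (simp add: cov_def distrib_right mult.assoc)
  have i: "integrable \<mu> (\<lambda>\<omega>. (A \<omega> + \<i> * A' \<omega>) * X \<omega>)"
    if "integrable \<mu> (\<lambda>\<omega>. A \<omega> * X \<omega>)" "integrable \<mu> (\<lambda>\<omega>. A' \<omega> * X \<omega>)" for X
    using that by (simp add: distrib_right mult.assoc)
  have p: "(A \<omega> + \<i> * A' \<omega>) * B \<omega> * C \<omega> * D \<omega> =
      A \<omega> * B \<omega> * C \<omega> * D \<omega> + \<i> * (A' \<omega> * B \<omega> * C \<omega> * D \<omega>)" for \<omega>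
    by (simp add: algebra_simps)
  show ?thesis
    using assms unfolding isserlis_def p
    by (simp add: c i) (simp add: algebra_simps)
qed

lemma isserlis_real:
  assumes "\<phi>1 \<in> real_trig" "\<phi>2 \<in> real_trig" "\<phi>3 \<in> real_trig" "\<phi>4 \<in> real_trig"
  shows "isserlis (\<lambda>\<omega>. of_real (\<omega> \<phi>1)) (\<lambda>\<omega>. of_real (\<omega> \<phi>2)) (\<lambda>\<omega>. of_real (\<omega> \<phi>3)) (\<lambda>\<omega>. of_real (\<omega> \<phi>4))"
  using isserlis4(1,3)[of "\<lambda>\<omega>. \<omega> \<phi>1" "\<lambda>\<omega>. \<omega> \<phi>2" "\<lambda>\<omega>. \<omega> \<phi>3" "\<lambda>\<omega>. \<omega> \<phi>4", OF gaussian4[OF assms]]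
    covariance(1) assms
  unfolding isserlis_def cov_def by (simp flip: of_real_mult of_real_add)

lemma isserlis_mode: "isserlis (mode a) (mode b) (mode c) (mode d)"
proof -
  define R where "R k \<omega> = complex_of_real (\<omega> (\<lambda>x. Re (fourier_mode k x)))" for k and \<omega> :: functional
  define I where "I k \<omega> = complex_of_real (\<omega> (\<lambda>x. Im (fourier_mode k x)))" for k and \<omega> :: functional
  have w: "mode k = (\<lambda>\<omega>. R k \<omega> + \<i> * I k \<omega>)" for k
    by (auto simp: R_def I_def cpair_def complex_eq_iff)
  define S where "S = {R k |k. True} \<union> {I k |k. True}"
  have rep: "\<exists>\<phi>\<in>real_trig. X = (\<lambda>\<omega>. of_real (\<omega> \<phi>))" if "X \<in> S" for X
    using that Re_mode Im_mode unfolding S_def R_def[abs_def] I_def[abs_def] by blast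
  have S: "isserlis A B C D" if ABCD: "A \<in> S" "B \<in> S" "C \<in> S" "D \<in> S" for A B C D
    using rep[OF ABCD(1)] rep[OF ABCD(2)] rep[OF ABCD(3)] rep[OF ABCD(4)]
    by (elim bexE) (simp add: isserlis_real)
  have RI: "R k \<in> S" "I k \<in> S" for k by (auto simp: S_def)
  have 1: "isserlis (mode k) B C D" if "B \<in> S" "C \<in> S" "D \<in> S" for k B C D
    unfolding w by (intro isserlis_complex_combination S RI that)
  have 2: "isserlis (mode k) B C (mode l)" if "B \<in> S" "C \<in> S" for k l B C
    unfolding w[of k] by (intro isserlis_complex_combination isserlis_rotate[OF 1] RI that)
  have 3: "isserlis (mode k) B (mode m) (mode l)" if "B \<in> S" for k l m B
    unfolding w[of k] by (intro isserlis_complex_combination isserlis_rotate[OF 2] RI that)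
  show ?thesis
    unfolding w[of a] by (intro isserlis_complex_combination isserlis_rotate[OF 3] RI)
qed

lemma mode_mult_integrable: "integrable \<mu> (\<lambda>\<omega>. mode a \<omega> * mode b \<omega>)"
  and mode_mult4_integrable: "integrable \<mu> (\<lambda>\<omega>. mode a \<omega> * mode b \<omega> * mode c \<omega> * mode d \<omega>)"
  using isserlis_mode[of a b c d] by (auto simp: isserlis_def)

text \<open>White noise turns the duality into the \<open>L\<^sup>2\<close> product. No conjugate is
  involved, so \<open>w\<^sub>a\<close> correlates with \<open>w\<^sub>-\<^sub>a\<close>.\<close>

lemma cov_mode: "cov (mode a) (mode b) = (if a + b = 0 then 1 else 0)"
proof -
  define R where "R k x = Re (fourier_mode k x)" for k x
  define I where "I k x = Im (fourier_mode k x)" for k x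
  have RI: "R k \<in> real_trig" "I k \<in> real_trig" for k
    unfolding R_def[abs_def] I_def[abs_def] by (rule Re_mode Im_mode)+
  define S where "S \<phi> \<psi> = (LINT x:cbox 0 1|lborel. \<phi> x * \<psi> x :: real)" for \<phi> \<psi> :: "real^2 \<Rightarrow> real"
  have int: "set_integrable lborel (cbox 0 1) (\<lambda>x. \<phi> x * \<psi> x)" if "\<phi> \<in> {R a, I a}" "\<psi> \<in> {R b, I b}" for \<phi> \<psi>
    unfolding set_integrable_def R_def I_def
    by (rule borel_integrable_compact, simp, insert that)
      (auto simp: R_def[abs_def] I_def[abs_def] intro!: continuous_intros)
  have "cov (mode a) (mode b) = (CLINT \<omega>|\<mu>. Complex (\<omega> (R a) * \<omega> (R b) - \<omega> (I a) * \<omega> (I b))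
       (\<omega> (R a) * \<omega> (I b) + \<omega> (I a) * \<omega> (R b)))"
    unfolding cov_def by (intro Bochner_Integration.integral_cong refl)
      (simp add: cpair_def R_def[abs_def] I_def[abs_def] complex_eq_iff)
  also have "\<dots> = (CLINT \<omega>|\<mu>. of_real (\<omega> (R a) * \<omega> (R b) - \<omega> (I a) * \<omega> (I b)) +
       \<i> * of_real (\<omega> (R a) * \<omega> (I b) + \<omega> (I a) * \<omega> (R b)))"
    by (intro Bochner_Integration.integral_cong refl) (simp add: complex_eq_iff)
  also have "\<dots> = of_real (S (R a) (R b) - S (I a) (I b)) + \<i> * of_real (S (R a) (I b) + S (I a) (R b))"
    using covariance RI by (simp add: S_def integral_complex_of_real del: of_real_add of_real_diff of_real_mult)
  also have "\<dots> = (CLINT x:cbox 0 1|lborel. fourier_mode (a + b) x)"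
  proof -
    have "(CLINT x:cbox 0 1|lborel. fourier_mode (a + b) x) =
      (CLINT x:cbox 0 1|lborel. of_real (R a x * R b x - I a x * I b x) + \<i> * of_real (R a x * I b x + I a x * R b x))"
      by (intro set_lebesgue_integral_cong) (auto simp: fourier_mode_add complex_eq_iff R_def I_def)
    also have "\<dots> = of_real (S (R a) (R b) - S (I a) (I b)) + \<i> * of_real (S (R a) (I b) + S (I a) (R b))"
    proof -
      let ?i = "\<lambda>x. indicator (cbox 0 1) x :: real"
      have "?i x *\<^sub>R (complex_of_real (R a x * R b x - I a x * I b x) + \<i> * of_real (R a x * I b x + I a x * R b x)) =
          of_real (?i x *\<^sub>R (R a x * R b x) - ?i x *\<^sub>R (I a x * I b x)) +
          \<i> * of_real (?i x *\<^sub>R (R a x * I b x) + ?i x *\<^sub>R (I a x * R b x))" for x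
        by (simp add: complex_eq_iff algebra_simps)
      then show ?thesis
        using int unfolding S_def set_lebesgue_integral_def set_integrable_def
        by (simp add: integral_complex_of_real del: of_real_add of_real_diff of_real_mult)
    qed
    finally show ?thesis ..
  qed
  also have "\<dots> = (if a + b = 0 then 1 else 0)" by (rule integral_fourier_mode)
  finally show ?thesis .
qed

lemma mode_norm_sq:
  shows "integrable \<mu> (\<lambda>\<omega>. (cmod (mode k \<omega>))\<^sup>2)" and "(LINT \<omega>|\<mu>. (cmod (mode k \<omega>))\<^sup>2) = 1"
proof -
  have eq: "complex_of_real ((cmod (mode k \<omega>))\<^sup>2) = mode k \<omega> * mode (- k) \<omega>" if "\<omega> \<in> space \<mu>" for \<omega>
    using that unfolding complex_norm_square by (simp add: space_eq cpair_mode_cnj Hminus_distributions)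
  have "integrable \<mu> (\<lambda>\<omega>. complex_of_real ((cmod (mode k \<omega>))\<^sup>2))"
    using mode_mult_integrable[of k "- k"] eq by (simp cong: Bochner_Integration.integrable_cong)
  then show "integrable \<mu> (\<lambda>\<omega>. (cmod (mode k \<omega>))\<^sup>2)"
    by (simp only: complex_of_real_integrable_eq)
  have "(CLINT \<omega>|\<mu>. complex_of_real ((cmod (mode k \<omega>))\<^sup>2)) = cov (mode k) (mode (- k))"
    unfolding cov_def using eq by (intro Bochner_Integration.integral_cong) auto
  then have "complex_of_real (LINT \<omega>|\<mu>. (cmod (mode k \<omega>))\<^sup>2) = 1"
    unfolding cov_mode by (simp only: integral_complex_of_real) simp
  then show "(LINT \<omega>|\<mu>. (cmod (mode k \<omega>))\<^sup>2) = 1" by (simp only: of_real_eq_1_iff)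
qed

text \<open>The product of two modes minus its mean.\<close>

definition wick_prod :: "int^2 \<Rightarrow> int^2 \<Rightarrow> functional \<Rightarrow> complex" where
  "wick_prod a b \<omega> = mode a \<omega> * mode b \<omega> - (if a + b = 0 then 1 else 0)"

lemma wick_prod_cov:
  shows "integrable \<mu> (\<lambda>\<omega>. wick_prod a b \<omega> * wick_prod c d \<omega>)"
    and "(CLINT \<omega>|\<mu>. wick_prod a b \<omega> * wick_prod c d \<omega>) =
      (if a + c = 0 \<and> b + d = 0 then 1 else 0) + (if a + d = 0 \<and> b + c = 0 then 1 else 0)"
proof -
  let ?p = "if a + b = 0 then 1 else 0 :: complex" and ?q = "if c + d = 0 then 1 else 0 :: complex"
  have eq: "wick_prod a b \<omega> * wick_prod c d \<omega> = mode a \<omega> * mode b \<omega> * mode c \<omega> * mode d \<omega>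
     - ?q * (mode a \<omega> * mode b \<omega>) - ?p * (mode c \<omega> * mode d \<omega>) + ?p * ?q" for \<omega>
    unfolding wick_prod_def by (simp add: algebra_simps)
  note int = mode_mult_integrable mode_mult4_integrable
  show "integrable \<mu> (\<lambda>\<omega>. wick_prod a b \<omega> * wick_prod c d \<omega>)"
    unfolding eq using int by (intro Bochner_Integration.integrable_add Bochner_Integration.integrable_diff integrable_mult_right) auto
  have "(CLINT \<omega>|\<mu>. wick_prod a b \<omega> * wick_prod c d \<omega>) =
     (CLINT \<omega>|\<mu>. mode a \<omega> * mode b \<omega> * mode c \<omega> * mode d \<omega>) - ?q * cov (mode a) (mode b) - ?p * cov (mode c) (mode d) + ?p * ?q"
    unfolding eq cov_def using int by (simp add: prob_space)
  also have "\<dots> = cov (mode a) (mode c) * cov (mode b) (mode d) + cov (mode a) (mode d) * cov (mode b) (mode c)"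
    using isserlis_mode[of a b c d] unfolding isserlis_def by (simp add: cov_mode)
  finally show "(CLINT \<omega>|\<mu>. wick_prod a b \<omega> * wick_prod c d \<omega>) =
      (if a + c = 0 \<and> b + d = 0 then 1 else 0) + (if a + d = 0 \<and> b + c = 0 then 1 else 0)"
    by (simp add: cov_mode)
qed

lemma wick_prod_cnj: "\<omega> \<in> space \<mu> \<Longrightarrow> cnj (wick_prod a b \<omega>) = wick_prod (- a) (- b) \<omega>"
  by (simp add: wick_prod_def space_eq Hminus_distributions cpair_mode_cnj neg_eq_iff_add_eq_0
      add_eq_0_iff)

text \<open>Products of two modes with fixed total frequency \<open>l + m\<close> are orthogonal unless they
  agree up to the order of the factors. Each \<open>k\<close> is therefore paired with itself
  and with \<open>m - l - k\<close> only, which gives the factor \<open>2\<close>.\<close>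

lemma wick_sum_norm_sq:
  fixes \<beta> :: "int^2 \<Rightarrow> real" and l m :: "int^2"
  assumes K: "finite K"
  defines "Q \<equiv> \<lambda>\<omega>. \<Sum>k\<in>K. of_real (\<beta> k) * wick_prod (l + k) (m - k) \<omega>"
  shows "integrable \<mu> (\<lambda>\<omega>. (cmod (Q \<omega>))\<^sup>2)"
    and "(LINT \<omega>|\<mu>. (cmod (Q \<omega>))\<^sup>2) \<le> 2 * (\<Sum>k\<in>K. (\<beta> k)\<^sup>2)"
proof -
  have eq: "complex_of_real ((cmod (Q \<omega>))\<^sup>2) =
     (\<Sum>k\<in>K. \<Sum>j\<in>K. of_real (\<beta> k * \<beta> j) * (wick_prod (l + k) (m - k) \<omega> * wick_prod (- (l + j)) (- (m - j)) \<omega>))"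
    if "\<omega> \<in> space \<mu>" for \<omega>
    unfolding complex_norm_square Q_def cnj_sum complex_cnj_mult wick_prod_cnj[OF that] sum_product
    by (intro sum.cong) auto
  let ?E = "\<lambda>k j. (if k = j then 1 else 0) + (if j = m - l - k then 1 else 0) :: real"
  have E: "(CLINT \<omega>|\<mu>. wick_prod (l + k) (m - k) \<omega> * wick_prod (- (l + j)) (- (m - j)) \<omega>) = of_real (?E k j)" for k j
  proof -
    have "(l + k + - (l + j) = 0 \<and> m - k + - (m - j) = 0) \<longleftrightarrow> k = j"
      "(l + k + - (m - j) = 0 \<and> m - k + - (l + j) = 0) \<longleftrightarrow> j = m - l - k"
      by (auto simp: algebra_simps)
    then show ?thesis unfolding wick_prod_cov(2) by simp
  qed
  have int: "integrable \<mu> (\<lambda>\<omega>. complex_of_real ((cmod (Q \<omega>))\<^sup>2))"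
    by (subst Bochner_Integration.integrable_cong[OF refl eq])
      (auto intro!: Bochner_Integration.integrable_sum integrable_mult_right wick_prod_cov(1))
  then show "integrable \<mu> (\<lambda>\<omega>. (cmod (Q \<omega>))\<^sup>2)"
    by (simp only: complex_of_real_integrable_eq)
  have "complex_of_real (LINT \<omega>|\<mu>. (cmod (Q \<omega>))\<^sup>2) = (CLINT \<omega>|\<mu>. complex_of_real ((cmod (Q \<omega>))\<^sup>2))"
    by (simp only: integral_complex_of_real)
  also have "\<dots> = (\<Sum>k\<in>K. \<Sum>j\<in>K. of_real (\<beta> k * \<beta> j) * of_real (?E k j))"
    unfolding E[symmetric]
    by (subst Bochner_Integration.integral_cong[OF refl eq])
      (auto simp: wick_prod_cov(1) Bochner_Integration.integral_sum)
  finally have "(LINT \<omega>|\<mu>. (cmod (Q \<omega>))\<^sup>2) = (\<Sum>k\<in>K. \<Sum>j\<in>K. \<beta> k * \<beta> j * ?E k j)"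
    by (simp only: flip: of_real_mult of_real_sum) (simp only: of_real_eq_iff)
  also have "\<dots> = (\<Sum>k\<in>K. (\<beta> k)\<^sup>2) + (\<Sum>k\<in>K. if m - l - k \<in> K then \<beta> k * \<beta> (m - l - k) else 0)"
    unfolding distrib_left sum.distrib using K
    by (simp add: if_distrib sum.delta power2_eq_square cong: if_cong)
  also have "(\<Sum>k\<in>K. if m - l - k \<in> K then \<beta> k * \<beta> (m - l - k) else 0) \<le>
      (\<Sum>k\<in>K. (\<beta> k)\<^sup>2 / 2 + (if m - l - k \<in> K then (\<beta> (m - l - k))\<^sup>2 / 2 else 0))"
  proof (intro sum_mono)
    fix k
    show "(if m - l - k \<in> K then \<beta> k * \<beta> (m - l - k) else 0) \<le>
      (\<beta> k)\<^sup>2 / 2 + (if m - l - k \<in> K then (\<beta> (m - l - k))\<^sup>2 / 2 else 0)"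
      using sum_squares_bound[of "\<beta> k" "\<beta> (m - l - k)"] by auto
  qed
  also have "\<dots> = (\<Sum>k\<in>K. (\<beta> k)\<^sup>2) / 2 + (\<Sum>k\<in>K. if m - l - k \<in> K then (\<beta> (m - l - k))\<^sup>2 else 0) / 2"
    unfolding sum.distrib sum_divide_distrib by (intro arg_cong2[of _ _ _ _ "(+)"] sum.cong) auto
  also have "(\<Sum>k\<in>K. if m - l - k \<in> K then (\<beta> (m - l - k))\<^sup>2 else 0) = (\<Sum>k\<in>{k\<in>K. m - l - k \<in> K}. (\<beta> (m - l - k))\<^sup>2)"
    using K by (simp add: sum.inter_filter)
  also have "\<dots> = (\<Sum>k\<in>{k\<in>K. m - l - k \<in> K}. (\<beta> k)\<^sup>2)"
    by (rule sum.reindex_bij_witness[of _ "\<lambda>k. m - l - k" "\<lambda>k. m - l - k"]) auto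
  also have "\<dots> \<le> (\<Sum>k\<in>K. (\<beta> k)\<^sup>2)" using K by (intro sum_mono2) auto
  finally show "(LINT \<omega>|\<mu>. (cmod (Q \<omega>))\<^sup>2) \<le> 2 * (\<Sum>k\<in>K. (\<beta> k)\<^sup>2)" by simp
qed

end

section \<open>Testing the derivative against modulated exponentials\<close>

text \<open>A family of functions of two variables that contains \<open>u cos v\<close>, \<open>u sin
  v\<close>, \<open>cos v\<close> and \<open>sin v\<close> and is closed under both partial
  derivatives. These are the real and imaginary parts of the test functionals \<open>u exp (i
  v)\<close> and \<open>exp (i v)\<close>.\<close>

definition trig_affine :: "real \<Rightarrow> real \<Rightarrow> real \<Rightarrow> real \<Rightarrow> real \<Rightarrow> real \<Rightarrow> real" where
  "trig_affine a b p q u v = (a * u + b) * cos v + (p * u + q) * sin v"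

abbreviation trig_affine_coord :: "real \<Rightarrow> real \<Rightarrow> real \<Rightarrow> real \<Rightarrow> (nat \<Rightarrow> real) \<Rightarrow> real" where
  "trig_affine_coord a b p q \<equiv> \<lambda>x. trig_affine a b p q (x 0) (x 1)"

lemma trig_affine_partial0:
  shows "((\<lambda>h. trig_affine_coord a b p q (x(0 := x 0 + h))) has_real_derivative trig_affine_coord 0 a 0 p x) (at 0)"
    and "partial_coord 0 (trig_affine_coord a b p q) = trig_affine_coord 0 a 0 p"
proof -
  show *: "((\<lambda>h. trig_affine_coord a b p q (x(0 := x 0 + h))) has_real_derivative trig_affine_coord 0 a 0 p x) (at 0)" for x
    unfolding trig_affine_def by (auto intro!: derivative_eq_intros)
  show "partial_coord 0 (trig_affine_coord a b p q) = trig_affine_coord 0 a 0 p"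
    unfolding partial_coord_def by (intro ext DERIV_imp_deriv *)
qed

lemma trig_affine_partial1:
  shows "((\<lambda>h. trig_affine_coord a b p q (x(1 := x 1 + h))) has_real_derivative trig_affine_coord p q (- a) (- b) x) (at 0)"
    and "partial_coord 1 (trig_affine_coord a b p q) = trig_affine_coord p q (- a) (- b)"
proof -
  show *: "((\<lambda>h. trig_affine_coord a b p q (x(1 := x 1 + h))) has_real_derivative trig_affine_coord p q (- a) (- b) x) (at 0)" for x
    unfolding trig_affine_def by (auto intro!: derivative_eq_intros simp: algebra_simps)
  show "partial_coord 1 (trig_affine_coord a b p q) = trig_affine_coord p q (- a) (- b)"
    unfolding partial_coord_def by (intro ext DERIV_imp_deriv *)
qed

lemma abs_trig_affine_le: "\<bar>trig_affine a b p q u v\<bar> \<le> (\<bar>a\<bar> + \<bar>b\<bar> + \<bar>p\<bar> + \<bar>q\<bar>) * (1 + \<bar>u\<bar>)"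
proof -
  have *: "\<bar>(a * u + b) * s\<bar> \<le> (\<bar>a\<bar> + \<bar>b\<bar>) * (1 + \<bar>u\<bar>)" if "\<bar>s\<bar> \<le> 1" for a b s :: real
  proof -
    have "\<bar>(a * u + b) * s\<bar> \<le> \<bar>a * u + b\<bar> * 1" unfolding abs_mult using that by (intro mult_left_mono) auto
    also have "\<dots> \<le> \<bar>a\<bar> * \<bar>u\<bar> + \<bar>b\<bar>" by (simp add: abs_triangle_ineq[THEN order_trans] abs_mult)
    also have "\<dots> \<le> (\<bar>a\<bar> + \<bar>b\<bar>) * (1 + \<bar>u\<bar>)" by (simp add: algebra_simps)
    finally show ?thesis .
  qed
  show ?thesis
    using *[of "cos v" a b] *[of "sin v" p q] abs_triangle_ineq[of "(a * u + b) * cos v" "(p * u + q) * sin v"]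
    unfolding trig_affine_def by (simp add: algebra_simps)
qed

lemma trig_affine_smooth_poly_growth: "trig_affine_coord a b p q \<in> smooth_poly_growth 2"
proof -
  have fold: "set \<alpha> \<subseteq> {..<2} \<Longrightarrow> \<exists>a' b' p' q'. foldr partial_coord \<alpha> (trig_affine_coord a b p q) = trig_affine_coord a' b' p' q'" for \<alpha>
  proof (induction \<alpha>)
    case (Cons j \<alpha>)
    then obtain a' b' p' q' where "foldr partial_coord \<alpha> (trig_affine_coord a b p q) = trig_affine_coord a' b' p' q'"
      by auto
    moreover have "j = 0 \<or> j = 1" using Cons.prems by auto
    ultimately show ?case
      using trig_affine_partial0(2)[of a' b' p' q'] trig_affine_partial1(2)[of a' b' p' q'] by fastforce
  qed auto
  have 1: "continuous_on UNIV (trig_affine_coord a b p q)" for a b p q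
    unfolding trig_affine_def by (intro continuous_intros continuous_on_product_coordinates)
  have 2: "(\<lambda>h. trig_affine_coord a b p q (x(j := x j + h))) differentiable at 0" if "j < 2" for a b p q j x
  proof -
    have "j = 0 \<or> j = 1" using that by auto
    then show ?thesis
      using trig_affine_partial0(1)[of a b p q x] trig_affine_partial1(1)[of a b p q x]
      unfolding real_differentiable_def by blast
  qed
  have 3: "\<exists>C m. \<forall>x. \<bar>trig_affine_coord a b p q x\<bar> \<le> C * (1 + (\<Sum>j<2. \<bar>x j\<bar>)) ^ m" for a b p q
  proof (intro exI allI)
    fix x :: "nat \<Rightarrow> real"
    have "\<bar>trig_affine_coord a b p q x\<bar> \<le> (\<bar>a\<bar> + \<bar>b\<bar> + \<bar>p\<bar> + \<bar>q\<bar>) * (1 + \<bar>x 0\<bar>)" by (rule abs_trig_affine_le)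
    also have "\<dots> \<le> (\<bar>a\<bar> + \<bar>b\<bar> + \<bar>p\<bar> + \<bar>q\<bar>) * (1 + (\<Sum>j<2. \<bar>x j\<bar>)) ^ 1"
      by (intro mult_left_mono) (auto simp: numeral_eq_Suc)
    finally show "\<bar>trig_affine_coord a b p q x\<bar> \<le> (\<bar>a\<bar> + \<bar>b\<bar> + \<bar>p\<bar> + \<bar>q\<bar>) * (1 + (\<Sum>j<2. \<bar>x j\<bar>)) ^ 1" .
  qed
  show ?thesis
    unfolding smooth_poly_growth_def
  proof (intro CollectI conjI allI impI)
    fix \<alpha> :: "nat list" assume "set \<alpha> \<subseteq> {..<2}"
    from fold[OF this] obtain a' b' p' q'
      where eq: "foldr partial_coord \<alpha> (trig_affine_coord a b p q) = trig_affine_coord a' b' p' q'" by blast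
    show "continuous_on UNIV (foldr partial_coord \<alpha> (trig_affine_coord a b p q))"
      unfolding eq by (rule 1)
    show "(\<lambda>h. foldr partial_coord \<alpha> (trig_affine_coord a b p q) (x(j := x j + h))) differentiable at 0"
      if "j < 2" for j x
      unfolding eq by (rule 2[OF that])
    show "\<exists>C m. \<forall>x. \<bar>foldr partial_coord \<alpha> (trig_affine_coord a b p q) x\<bar> \<le> C * (1 + (\<Sum>j<2. \<bar>x j\<bar>)) ^ m"
      unfolding eq by (rule 3)
  qed auto
qed

lemma transport_derivative_trig_affine:
  assumes G: "is_transport_derivative T \<mu> k \<rho> G" and c: "c \<in> C1_interval T"
    and \<psi>: "\<psi> \<in> real_trig" and \<phi>: "\<phi> \<in> real_trig" and \<mu>: "space \<mu> = Hminus"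
  shows "(CLINT z|time_space T \<mu>. G z * of_real (c (fst z) * trig_affine a b p q (snd z \<psi>) (snd z \<phi>))) =
     - (CLINT z|time_space T \<mu>. of_real (\<rho> (fst z) (snd z) * c (fst z)) *
       (of_real (trig_affine 0 a 0 p (snd z \<psi>) (snd z \<phi>)) * transport_pair k (snd z) \<psi> +
        of_real (trig_affine p q (- a) (- b) (snd z \<psi>) (snd z \<phi>)) * transport_pair k (snd z) \<phi>))"
proof -
  define \<Phi> where "\<Phi> j = (if j = 0 then \<psi> else \<phi>)" for j :: nat
  let ?g = "trig_affine_coord a b p q"
  let ?f = "(cylinder 2 ?g \<Phi>, cylinder_gradient 2 ?g \<Phi>)"
  have "?f \<in> FC_P"
    using trig_affine_smooth_poly_growth \<psi> \<phi> real_trig_smooth unfolding FC_P_def \<Phi>_def by fastforce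
  then have "(\<lambda>t \<omega>. \<Sum>i<(1::nat). c t * fst ?f \<omega>, \<lambda>t \<omega> x. \<Sum>i<(1::nat). c t * snd ?f \<omega> x) \<in> FC_PT T"
    unfolding FC_PT_def using c
    by (intro CollectI exI[of _ 1] exI[of _ "\<lambda>_. c"] exI[of _ "\<lambda>_. ?f"]) auto
  then have FC: "(\<lambda>t \<omega>. c t * cylinder 2 ?g \<Phi> \<omega>, \<lambda>t \<omega> x. c t * cylinder_gradient 2 ?g \<Phi> \<omega> x) \<in> FC_PT T"
    by simp
  have F: "cylinder 2 ?g \<Phi> \<omega> = trig_affine a b p q (\<omega> \<psi>) (\<omega> \<phi>)" for \<omega>
    by (simp add: cylinder_def \<Phi>_def)
  have DF: "cylinder_gradient 2 ?g \<Phi> \<omega> x =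
    trig_affine 0 a 0 p (\<omega> \<psi>) (\<omega> \<phi>) * \<psi> x + trig_affine p q (- a) (- b) (\<omega> \<psi>) (\<omega> \<phi>) * \<phi> x" for \<omega> x
    using trig_affine_partial0(2)[of a b p q] trig_affine_partial1(2)[of a b p q]
    by (simp add: cylinder_gradient_def \<Phi>_def numeral_2_eq_2)
  have X: "transport_pair k \<omega> (\<lambda>x. c t * cylinder_gradient 2 ?g \<Phi> \<omega> x) =
     of_real (c t) * (of_real (trig_affine 0 a 0 p (\<omega> \<psi>) (\<omega> \<phi>)) * transport_pair k \<omega> \<psi> +
        of_real (trig_affine p q (- a) (- b) (\<omega> \<psi>) (\<omega> \<phi>)) * transport_pair k \<omega> \<phi>)" if "\<omega> \<in> Hminus" for t \<omega>
    using transport_pair_lin[OF Hminus_distributions[OF that] \<psi> \<phi>, of k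
        "c t * trig_affine 0 a 0 p (\<omega> \<psi>) (\<omega> \<phi>)" "c t * trig_affine p q (- a) (- b) (\<omega> \<psi>) (\<omega> \<phi>)"]
    unfolding DF by (simp add: algebra_simps)
  have "(LINT (t, \<omega>)|time_space T \<mu>. G (t, \<omega>) * of_real (c t * cylinder 2 ?g \<Phi> \<omega>)) =
        - (LINT (t, \<omega>)|time_space T \<mu>. of_real (\<rho> t \<omega>) * transport_pair k \<omega> (\<lambda>x. c t * cylinder_gradient 2 ?g \<Phi> \<omega> x))"
    using G FC unfolding is_transport_derivative_def by fast
  also have "(LINT (t, \<omega>)|time_space T \<mu>. of_real (\<rho> t \<omega>) * transport_pair k \<omega> (\<lambda>x. c t * cylinder_gradient 2 ?g \<Phi> \<omega> x)) =
     (CLINT z|time_space T \<mu>. of_real (\<rho> (fst z) (snd z) * c (fst z)) *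
       (of_real (trig_affine 0 a 0 p (snd z \<psi>) (snd z \<phi>)) * transport_pair k (snd z) \<psi> +
        of_real (trig_affine p q (- a) (- b) (snd z \<psi>) (snd z \<phi>)) * transport_pair k (snd z) \<phi>))"
  proof (intro Bochner_Integration.integral_cong refl)
    fix z assume "z \<in> space (time_space T \<mu>)"
    then have "snd z \<in> Hminus" by (auto simp: time_space_def space_pair_measure \<mu>)
    from X[OF this, of "fst z"] show "(case z of (t, \<omega>) \<Rightarrow> of_real (\<rho> t \<omega>) * transport_pair k \<omega> (\<lambda>x. c t * cylinder_gradient 2 ?g \<Phi> \<omega> x)) =
      of_real (\<rho> (fst z) (snd z) * c (fst z)) *
       (of_real (trig_affine 0 a 0 p (snd z \<psi>) (snd z \<phi>)) * transport_pair k (snd z) \<psi> +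
        of_real (trig_affine p q (- a) (- b) (snd z \<psi>) (snd z \<phi>)) * transport_pair k (snd z) \<phi>)"
      by (simp only: case_prod_beta of_real_mult mult.assoc)
  qed
  finally show ?thesis by (simp only: F case_prod_beta prod.collapse)
qed

locale transport_setting = white_noise \<mu> for \<mu> :: "functional measure" +
  fixes T R :: real and \<rho> :: "real \<Rightarrow> functional \<Rightarrow> real"
  assumes T: "T > 0"
    and \<rho>_measurable: "(\<lambda>z. \<rho> (fst z) (snd z)) \<in> borel_measurable (time_space T \<mu>)"
    and \<rho>_bounded: "\<And>t \<omega>. t \<in> {0..T} \<Longrightarrow> \<omega> \<in> Hminus \<Longrightarrow> \<bar>\<rho> t \<omega>\<bar> \<le> R"
begin

abbreviation M :: "(real \<times> functional) measure" where
  "M \<equiv> time_space T \<mu>"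

abbreviation wave :: "(real \<Rightarrow> real) \<Rightarrow> (real^2 \<Rightarrow> real) \<Rightarrow> real \<times> functional \<Rightarrow> complex" where
  "wave c \<phi> z \<equiv> of_real (c (fst z)) * iexp (snd z \<phi>)"

abbreviation I :: "real measure" where
  "I \<equiv> restrict_space lborel {0..T}"

lemma space_M: "space M = {0..T} \<times> Hminus"
  by (simp add: time_space_def space_pair_measure space_restrict_space space_eq)

lemma snd_measurable_M [measurable]: "snd \<in> measurable M \<mu>"
  unfolding time_space_def by simp

lemma fst_measurable_I [measurable]: "fst \<in> measurable M I"
  unfolding time_space_def by simp

lemma fst_measurable_M [measurable]: "fst \<in> borel_measurable M"
proof -
  have "(\<lambda>t. t) \<in> borel_measurable I" by (intro measurable_restrict_space1) simp
  from measurable_compose[OF fst_measurable_I this] show ?thesis .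
qed

lemma R_nonneg: "0 \<le> R"
proof -
  obtain \<omega> where "\<omega> \<in> Hminus" using not_empty space_eq by auto
  then show ?thesis using \<rho>_bounded[of 0 \<omega>] T by auto
qed

lemma measure_I: "measure I (space I) = T"
  using T by (simp add: space_restrict_space measure_restrict_space)

lemma finite_I: "finite_measure I"
  using T by (intro finite_measureI) (simp add: space_restrict_space emeasure_restrict_space)

lemma pair_sf: "pair_sigma_finite I \<mu>"
  using finite_I finite_measure.axioms(1) sigma_finite_measure_axioms
  unfolding pair_sigma_finite_def by (auto simp: finite_measure_def)

lemma lift_integral:
  fixes f :: "functional \<Rightarrow> 'b::{banach, second_countable_topology}"
  assumes f: "integrable \<mu> f"
  shows "integrable M (\<lambda>z. f (snd z))" and "(LINT z|M. f (snd z)) = T *\<^sub>R (LINT \<omega>|\<mu>. f \<omega>)"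
proof -
  interpret pair_sigma_finite I \<mu> by (rule pair_sf)
  interpret I: finite_measure I by (rule finite_I)
  note [measurable] = borel_measurable_integrable[OF f]
  show int: "integrable M (\<lambda>z. f (snd z))"
    unfolding time_space_def using f by (intro Fubini_integrable) auto
  show "(LINT z|M. f (snd z)) = T *\<^sub>R (LINT \<omega>|\<mu>. f \<omega>)"
    using integral_fst'[OF int[unfolded time_space_def]] measure_I by (simp add: time_space_def)
qed

lemma finite_M: "finite_measure M"
proof (rule finite_measureI)
  have "{0..T} \<in> sets I" using sets.top[of I] by (simp add: space_restrict_space)
  moreover have "Hminus \<in> sets \<mu>" using sets.top[of \<mu>] by (simp only: space_eq)
  ultimately have "emeasure (I \<Otimes>\<^sub>M \<mu>) ({0..T} \<times> Hminus) = emeasure I {0..T} * emeasure \<mu> Hminus"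
    by (rule sigma_finite_measure.emeasure_pair_measure_Times[OF prob_space_imp_sigma_finite[OF prob_space_axioms]])
  then have "emeasure M (space M) = emeasure I {0..T} * emeasure \<mu> Hminus"
    unfolding space_M unfolding time_space_def .
  also have "\<dots> = ennreal T" using T
    by (simp add: emeasure_restrict_space emeasure_space_1 flip: space_eq)
  finally show "emeasure M (space M) \<noteq> \<infinity>" by simp
qed

lemma C1_measurable: 
  assumes "c \<in> C1_interval T"
  shows "(\<lambda>z. c (fst z)) \<in> borel_measurable M"
    and "\<exists>C\<ge>0. \<forall>t\<in>{0..T}. \<bar>c t\<bar> \<le> C"
proof -
  have cont: "continuous_on {0..T} c"
    using assms unfolding C1_interval_def
    by (auto simp: continuous_on_eq_continuous_within intro: DERIV_continuous)
  have "c \<in> borel_measurable I"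
    using borel_measurable_continuous_on_restrict[OF cont]
    by (simp cong: measurable_cong_sets add: sets_restrict_space)
  from measurable_compose[OF fst_measurable_I this] show "(\<lambda>z. c (fst z)) \<in> borel_measurable M" .
  have "bounded (c ` {0..T})" using cont compact_continuous_image compact_imp_bounded by blast
  then obtain C where "\<forall>t\<in>{0..T}. \<bar>c t\<bar> \<le> C" unfolding bounded_iff by auto
  moreover have "0 \<le> C" using calculation T by force
  ultimately show "\<exists>C\<ge>0. \<forall>t\<in>{0..T}. \<bar>c t\<bar> \<le> C" by blast
qed

lemma weighted_integral:
  fixes f :: "functional \<Rightarrow> complex"
  assumes u[measurable]: "u \<in> borel_measurable M" and B: "\<And>z. z \<in> space M \<Longrightarrow> cmod (u z) \<le> B"
    and f: "integrable \<mu> f"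
  shows "integrable M (\<lambda>z. u z * f (snd z))"
    and "cmod (CLINT z|M. u z * f (snd z)) \<le> B * T * (LINT \<omega>|\<mu>. cmod (f \<omega>))"
proof -
  note [measurable] = borel_measurable_integrable[OF f]
  have n: "integrable M (\<lambda>z. B * cmod (f (snd z)))"
    using lift_integral(1)[OF integrable_norm[OF f]] by simp
  have le: "cmod (u z * f (snd z)) \<le> B * cmod (f (snd z))" if "z \<in> space M" for z
    using B[OF that] by (simp add: norm_mult mult_right_mono)
  show int: "integrable M (\<lambda>z. u z * f (snd z))"
    by (rule Bochner_Integration.integrable_bound[OF n]) (auto intro!: AE_I2 order_trans[OF le])
  have "cmod (CLINT z|M. u z * f (snd z)) \<le> (LINT z|M. B * cmod (f (snd z)))"
    by (rule order_trans[OF integral_norm_bound]) (intro integral_mono integrable_norm int n le)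
  also have "\<dots> = B * T * (LINT \<omega>|\<mu>. cmod (f \<omega>))"
    using lift_integral(2)[OF integrable_norm[OF f]] by simp
  finally show "cmod (CLINT z|M. u z * f (snd z)) \<le> B * T * (LINT \<omega>|\<mu>. cmod (f \<omega>))" .
qed

text \<open>Cauchy-Schwarz in the form \<open>2xy \<le> \<eta>x\<^sup>2 + y\<^sup>2/\<eta>\<close>. The free
  parameter \<open>\<eta>\<close> makes the bounds for different frequencies summable as they
  stand.\<close>

lemma L2_pairing:
  fixes f :: "functional \<Rightarrow> complex"
  assumes G: "G \<in> L2 M" and u[measurable]: "u \<in> borel_measurable M" and B: "\<And>z. z \<in> space M \<Longrightarrow> cmod (u z) \<le> B"
    and f[measurable]: "f \<in> borel_measurable \<mu>" and f2: "integrable \<mu> (\<lambda>\<omega>. (cmod (f \<omega>))\<^sup>2)"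
  shows "integrable M (\<lambda>z. G z * (u z * f (snd z)))"
    and "\<eta> > 0 \<Longrightarrow> cmod (CLINT z|M. G z * (u z * f (snd z))) \<le>
      B / 2 * (\<eta> * T * (LINT \<omega>|\<mu>. (cmod (f \<omega>))\<^sup>2) + (LINT z|M. (cmod (G z))\<^sup>2) / \<eta>)"
proof -
  have [measurable]: "G \<in> borel_measurable M" and G2: "integrable M (\<lambda>z. (cmod (G z))\<^sup>2)"
    using G by (auto simp: L2_def)
  obtain \<omega> where "\<omega> \<in> Hminus" using not_empty space_eq by auto
  then have "(0, \<omega>) \<in> space M" using T by (simp add: space_M)
  then have B0: "0 \<le> B" using B norm_ge_zero order_trans by blast
  define h where "h \<eta> z = B / 2 * (\<eta> * (cmod (f (snd z)))\<^sup>2 + (cmod (G z))\<^sup>2 / \<eta>)" for \<eta> :: real and z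
  have hint: "integrable M (h \<eta>)" for \<eta>
    unfolding h_def[abs_def] using lift_integral(1)[OF f2] G2 by auto
  have le: "cmod (G z * (u z * f (snd z))) \<le> h \<eta> z" if "z \<in> space M" "\<eta> > 0" for z \<eta>
  proof -
    let ?g = "cmod (G z)" and ?f = "cmod (f (snd z))"
    have "0 \<le> (\<eta> * ?f - ?g)\<^sup>2 / \<eta>" using that by simp
    also have "\<dots> = \<eta> * ?f\<^sup>2 - 2 * (?f * ?g) + ?g\<^sup>2 / \<eta>"
      using that by (simp add: field_simps power2_eq_square)
    finally have *: "?f * ?g \<le> (\<eta> * ?f\<^sup>2 + ?g\<^sup>2 / \<eta>) / 2" by simp
    have "cmod (G z * (u z * f (snd z))) = cmod (u z) * (?f * ?g)" by (simp add: norm_mult)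
    also have "\<dots> \<le> B * ((\<eta> * ?f\<^sup>2 + ?g\<^sup>2 / \<eta>) / 2)"
      using B[OF that(1)] * B0 by (intro mult_mono) auto
    finally show ?thesis by (simp add: h_def)
  qed
  show int: "integrable M (\<lambda>z. G z * (u z * f (snd z)))"
    by (rule Bochner_Integration.integrable_bound[OF hint[of 1]])
      (auto intro!: AE_I2 order_trans[OF le[of _ 1]])
  assume \<eta>: "\<eta> > 0"
  have "cmod (CLINT z|M. G z * (u z * f (snd z))) \<le> (LINT z|M. h \<eta> z)"
    by (rule order_trans[OF integral_norm_bound]) (intro integral_mono integrable_norm int hint le \<eta>)
  also have "\<dots> = B / 2 * (\<eta> * T * (LINT \<omega>|\<mu>. (cmod (f \<omega>))\<^sup>2) + (LINT z|M. (cmod (G z))\<^sup>2) / \<eta>)"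
    unfolding h_def using lift_integral[OF f2] G2 by simp
  finally show "cmod (CLINT z|M. G z * (u z * f (snd z))) \<le>
      B / 2 * (\<eta> * T * (LINT \<omega>|\<mu>. (cmod (f \<omega>))\<^sup>2) + (LINT z|M. (cmod (G z))\<^sup>2) / \<eta>)" .
qed

lemma C1_weight_bound:
  assumes "\<forall>t\<in>{0..T}. \<bar>c t\<bar> \<le> C" "z \<in> space M"
  shows "\<bar>\<rho> (fst z) (snd z) * c (fst z)\<bar> \<le> R * C" "\<bar>c (fst z)\<bar> \<le> C"
  using assms \<rho>_bounded[of "fst z" "snd z"] R_nonneg unfolding abs_mult
  by (auto simp: space_M intro!: mult_mono)

text \<open>The weak side of the integration by parts, against a modulated functional \<open>exp
  (i\<langle>\<omega>, \<phi>\<rangle>) f\<close>.\<close>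

definition tested :: "(real \<Rightarrow> real) \<Rightarrow> (real^2 \<Rightarrow> real) \<Rightarrow> (functional \<Rightarrow> complex) \<Rightarrow> complex" where
  "tested c \<phi> f = (CLINT z|M. of_real (\<rho> (fst z) (snd z) * c (fst z)) * (iexp (snd z \<phi>) * f (snd z)))"

context
  fixes c :: "real \<Rightarrow> real" and \<phi> :: "real^2 \<Rightarrow> real"
  assumes c: "c \<in> C1_interval T" and \<phi>: "\<phi> \<in> real_trig"
begin

lemma exp_pair_measurable [measurable]: "(\<lambda>\<omega>. iexp (\<omega> \<phi>)) \<in> borel_measurable \<mu>"
proof -
  note [measurable] = pair_measurable[OF \<phi>]
  show ?thesis by measurable
qed

lemma tested_integrable:
  assumes f: "integrable \<mu> f"
  shows "integrable M (\<lambda>z. of_real (\<rho> (fst z) (snd z) * c (fst z)) * (iexp (snd z \<phi>) * f (snd z)))"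
proof -
  note [measurable] = C1_measurable(1)[OF c] \<rho>_measurable borel_measurable_integrable[OF f]
  obtain C where C: "\<forall>t\<in>{0..T}. \<bar>c t\<bar> \<le> C" using C1_measurable(2)[OF c] by blast
  have i: "integrable \<mu> (\<lambda>\<omega>. iexp (\<omega> \<phi>) * f \<omega>)"
    by (rule Bochner_Integration.integrable_bound[OF f]) (auto simp: norm_mult)
  show ?thesis
    by (rule weighted_integral(1)[OF _ _ i, of _ "R * C"])
      (auto simp: norm_mult C1_weight_bound(1)[OF C, unfolded abs_mult])
qed

lemma tested_bound:
  assumes f: "integrable \<mu> f" and C: "\<forall>t\<in>{0..T}. \<bar>c t\<bar> \<le> C"
  shows "cmod (tested c \<phi> f) \<le> R * C * T * (LINT \<omega>|\<mu>. cmod (f \<omega>))"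
proof -
  note [measurable] = C1_measurable(1)[OF c] \<rho>_measurable borel_measurable_integrable[OF f]
  have i: "integrable \<mu> (\<lambda>\<omega>. iexp (\<omega> \<phi>) * f \<omega>)"
    by (rule Bochner_Integration.integrable_bound[OF f]) (auto simp: norm_mult)
  have "cmod (tested c \<phi> f) \<le> R * C * T * (LINT \<omega>|\<mu>. cmod (iexp (\<omega> \<phi>) * f \<omega>))"
    unfolding tested_def
    by (rule weighted_integral(2)[OF _ _ i])
      (auto simp: norm_mult C1_weight_bound(1)[OF C, unfolded abs_mult])
  then show ?thesis by (simp add: norm_mult)
qed

lemma tested_add:
  assumes "integrable \<mu> f" "integrable \<mu> g"
  shows "tested c \<phi> (\<lambda>\<omega>. f \<omega> + g \<omega>) = tested c \<phi> f + tested c \<phi> g"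
  unfolding tested_def distrib_left
  by (rule Bochner_Integration.integral_add[OF assms[THEN tested_integrable]])

lemma tested_scale: "tested c \<phi> (\<lambda>\<omega>. b * f \<omega>) = b * tested c \<phi> f"
proof -
  have "tested c \<phi> (\<lambda>\<omega>. b * f \<omega>) =
    (CLINT z|M. b * (of_real (\<rho> (fst z) (snd z) * c (fst z)) * (iexp (snd z \<phi>) * f (snd z))))"
    unfolding tested_def by (intro Bochner_Integration.integral_cong refl) (simp only: mult_ac)
  then show ?thesis unfolding tested_def by (simp only: integral_mult_right_zero)
qed

lemma tested_sum: "finite A \<Longrightarrow> (\<And>i. i \<in> A \<Longrightarrow> integrable \<mu> (f i)) \<Longrightarrow>
    tested c \<phi> (\<lambda>\<omega>. \<Sum>i\<in>A. f i \<omega>) = (\<Sum>i\<in>A. tested c \<phi> (f i))"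
proof (induction A rule: finite_induct)
  case empty
  show ?case by (simp add: tested_def)
next
  case (insert x F)
  then show ?case by (simp add: tested_add)
qed

lemma tested_cong: "(\<And>\<omega>. \<omega> \<in> Hminus \<Longrightarrow> f \<omega> = g \<omega>) \<Longrightarrow> tested c \<phi> f = tested c \<phi> g"
  unfolding tested_def by (intro Bochner_Integration.integral_cong) (auto simp: space_M)

end

lemma mode_integrable: "integrable \<mu> (mode k)"
proof (rule Bochner_Integration.integrable_bound[of _ "\<lambda>\<omega>. 1 + (cmod (mode k \<omega>))\<^sup>2"])
  show "integrable \<mu> (\<lambda>\<omega>. 1 + (cmod (mode k \<omega>))\<^sup>2)" using mode_norm_sq(1) by simp
  have "x \<le> 1 + x\<^sup>2" for x :: real using sum_squares_bound[of x 1] zero_le_power2[of x] 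
    by (smt (verit) mult_cancel_left1 power_one)
  then show "AE \<omega> in \<mu>. norm (mode k \<omega>) \<le> norm (1 + (cmod (mode k \<omega>))\<^sup>2)"
    by (auto intro!: AE_I2 order_trans[OF _ abs_ge_self])
qed simp

lemma pair_mult_transport_integrable:
  assumes \<psi>: "\<psi> \<in> real_trig" and \<theta>: "\<theta> \<in> real_trig"
  shows "integrable \<mu> (\<lambda>\<omega>. (of_real b + of_real a * of_real (\<omega> \<psi>)) * transport_pair k \<omega> \<theta>)"
proof -
  obtain p where p: "fin_supp p" "\<And>x. of_real (\<psi> x) = trig p x" using real_trigE[OF \<psi>] by blast
  obtain q where q: "fin_supp q" "\<And>x. of_real (\<theta> x) = trig q x" using real_trigE[OF \<theta>] by blast
  define r where "r m = - (2 * of_real pi * \<i>) * of_real (transport_coeff k m) * q m" for m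
  have X: "transport_pair k \<omega> \<theta> = (\<Sum>m | q m \<noteq> 0. r m * mode (m + k) \<omega>)" if "\<omega> \<in> space \<mu>" for \<omega>
    using transport_pair_trig[OF Hminus_distributions q, of \<omega> k] that
    by (simp add: space_eq r_def sum_distrib_left mult.assoc)
  have P: "of_real (\<omega> \<psi>) = (\<Sum>m | p m \<noteq> 0. p m * mode m \<omega>)" if "\<omega> \<in> space \<mu>" for \<omega>
    using that by (simp add: space_eq real_trig_pair[OF Hminus_distributions p])
  have "integrable \<mu> (\<lambda>\<omega>. (p i * mode i \<omega>) * (r j * mode (j + k) \<omega>))" for i j
  proof -
    have "(p i * mode i \<omega>) * (r j * mode (j + k) \<omega>) = (p i * r j) * (mode i \<omega> * mode (j + k) \<omega>)" for \<omega>
      by simp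
    then show ?thesis by (simp only:) (intro integrable_mult_right mode_mult_integrable)
  qed
  then have 1: "integrable \<mu> (\<lambda>\<omega>. (\<Sum>m | p m \<noteq> 0. p m * mode m \<omega>) * (\<Sum>m | q m \<noteq> 0. r m * mode (m + k) \<omega>))"
    unfolding sum_product by (intro Bochner_Integration.integrable_sum)
  have 2: "integrable \<mu> (\<lambda>\<omega>. \<Sum>m | q m \<noteq> 0. r m * mode (m + k) \<omega>)"
    by (intro Bochner_Integration.integrable_sum integrable_mult_right mode_integrable)
  have "integrable \<mu> (\<lambda>\<omega>. of_real b * (\<Sum>m | q m \<noteq> 0. r m * mode (m + k) \<omega>) +
     of_real a * ((\<Sum>m | p m \<noteq> 0. p m * mode m \<omega>) * (\<Sum>m | q m \<noteq> 0. r m * mode (m + k) \<omega>)))"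
    by (intro Bochner_Integration.integrable_add integrable_mult_right 1 2)
  then show ?thesis
    by (rule Bochner_Integration.integrable_cong[THEN iffD1, rotated -1]) (auto simp: X P algebra_simps)
qed

end

section \<open>Arithmetic of the transport multiplier\<close>

lemma perp_inner: "perp k \<bullet> real_freq m = real_of_int (k $ 2 * m $ 1 - k $ 1 * m $ 2)"
  by (simp add: perp_def real_freq_def inner_vec_def sum_2)

lemma norm_perp: "norm (perp k) = norm (real_freq k)"
  by (simp add: norm_eq_sqrt_inner perp_def real_freq_def inner_vec_def sum_2 add.commute)

lemma transport_coeff_uminus_left: "transport_coeff (- k) m = - transport_coeff k m"
proof -
  have "perp (- k) = - perp k" by (simp add: perp_def vec_eq_iff forall_2)
  then show ?thesis by (simp add: transport_coeff_def real_freq_uminus)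
qed

lemma transport_coeff_uminus_right: "transport_coeff k (- m) = - transport_coeff k m"
  by (simp add: transport_coeff_def real_freq_uminus)

lemma transport_coeff_add: "transport_coeff k (m + n) = transport_coeff k m + transport_coeff k n"
  by (simp add: transport_coeff_def real_freq_add inner_add_right add_divide_distrib)

lemma transport_coeff_self: "transport_coeff k k = 0"
  by (simp add: transport_coeff_def perp_inner)

lemma norm_real_freq_sq: "(norm (real_freq k))\<^sup>2 = real_of_int ((k $ 1)\<^sup>2 + (k $ 2)\<^sup>2)"
  by (simp add: norm_eq_sqrt_inner real_freq_def inner_vec_def sum_2 power2_eq_square)

lemma norm_real_freq_ge_1: assumes "k \<noteq> 0" shows "1 \<le> norm (real_freq k)"
proof -
  have "k $ 1 \<noteq> 0 \<or> k $ 2 \<noteq> 0" using assms by (auto simp: vec_eq_iff forall_2)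
  then have "0 < (k $ 1)\<^sup>2 + (k $ 2)\<^sup>2" by (simp add: sum_power2_gt_zero_iff)
  then have "1 \<le> (norm (real_freq k))\<^sup>2" unfolding norm_real_freq_sq by linarith
  then show ?thesis by (smt (verit) norm_ge_zero power2_le_imp_le one_power2)
qed

lemma transport_coeff_bound: assumes "k \<noteq> 0" shows "\<bar>transport_coeff k m\<bar> \<le> norm (real_freq m)"
proof -
  let ?k = "norm (real_freq k)" and ?m = "norm (real_freq m)"
  have k: "1 \<le> ?k" by (rule norm_real_freq_ge_1[OF assms])
  have "\<bar>perp k \<bullet> real_freq m\<bar> \<le> ?k * ?m" using Cauchy_Schwarz_ineq2[of "perp k" "real_freq m"] by (simp add: norm_perp)
  also have "\<dots> \<le> ?m * ?k\<^sup>2"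
    using mult_left_mono[OF self_le_power[OF k, of 2], of ?m] by (simp add: mult.commute)
  finally show ?thesis using k by (simp add: transport_coeff_def divide_le_eq)
qed

lemma harmonic_unbounded: "\<exists>n::nat. C \<le> (\<Sum>q=1..n. 1 / real q)"
proof -
  have "eventually (\<lambda>n. C \<le> harm n) sequentially"
    using harm_at_top unfolding filterlim_at_top by blast
  then obtain n where "C \<le> harm n" by (auto simp: eventually_sequentially)
  then show ?thesis by (auto simp: harm_def inverse_eq_divide intro!: exI[of _ n])
qed

text \<open>The sum behaves like \<open>\<Sum> 1 / |k|\<^sup>2\<close> over a cone of the planar lattice and
  diverges logarithmically. The cone is the set of \<open>(\<plusminus>p, q)\<close> with
  \<open>1 \<le> p \<le> q\<close>, with the sign or the order of the coordinates chosen so that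
  \<open>k\<^sup>\<bottom>\<close> stays away from the orthogonal complement of
  \<open>l\<close>; every \<open>q\<close> then contributes at least \<open>1 / (4q)\<close>.\<close>

lemma transport_coeff_sum_unbounded:
  assumes l: "l \<noteq> 0"
  shows "\<exists>K. finite K \<and> 0 \<notin> K \<and> C \<le> (\<Sum>k\<in>K. (transport_coeff k l)\<^sup>2)"
proof -
  obtain f :: "nat \<times> nat \<Rightarrow> int^2" where inj: "inj f"
    and num: "\<And>p q. (int q)\<^sup>2 \<le> (f (p, q) $ 2 * l $ 1 - f (p, q) $ 1 * l $ 2)\<^sup>2"
    and den: "\<And>p q. (f (p, q) $ 1)\<^sup>2 + (f (p, q) $ 2)\<^sup>2 = (int p)\<^sup>2 + (int q)\<^sup>2"
  proof (cases "l $ 1 = 0")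
    case True
    then have "l $ 2 \<noteq> 0" using l by (auto simp: vec_eq_iff forall_2)
    then have "1 \<le> (l $ 2)\<^sup>2" by (smt (verit) zero_less_power2)
    then have "(int q)\<^sup>2 * 1 \<le> (int q)\<^sup>2 * (l $ 2)\<^sup>2" for q by (intro mult_left_mono) auto
    then show thesis
      using True by (intro that[of "\<lambda>(p, q). vector [int q, int p]"])
        (auto simp: inj_def vec_eq_iff forall_2 power_mult_distrib)
  next
    case False
    define e :: int where "e = (if l $ 1 * l $ 2 > 0 then -1 else 1)"
    have e: "e * (l $ 1 * l $ 2) \<le> 0" "e\<^sup>2 = 1" "e \<noteq> 0" by (auto simp: e_def)
    have num: "(int q)\<^sup>2 \<le> (int q * l $ 1 - e * int p * l $ 2)\<^sup>2" for p q
    proof -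
      have "1 \<le> (l $ 1)\<^sup>2" using False by (smt (verit) zero_less_power2)
      then have "(int q)\<^sup>2 * 1 \<le> (int q)\<^sup>2 * (l $ 1)\<^sup>2" by (intro mult_left_mono) auto
      moreover have "0 \<le> (2 * int p * int q) * (- (e * (l $ 1 * l $ 2)))" using e(1) by (intro mult_nonneg_nonneg) auto
      moreover have "0 \<le> (e * int p * l $ 2)\<^sup>2" by simp
      moreover have "(int q * l $ 1 - e * int p * l $ 2)\<^sup>2 =
        (int q)\<^sup>2 * (l $ 1)\<^sup>2 + (2 * int p * int q) * (- (e * (l $ 1 * l $ 2))) + (e * int p * l $ 2)\<^sup>2"
        by (simp add: power2_eq_square algebra_simps)
      ultimately show ?thesis by linarith
    qed
    show thesis
      using e num by (intro that[of "\<lambda>(p, q). vector [e * int p, int q]"])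
        (auto simp: inj_def vec_eq_iff forall_2 power_mult_distrib)
  qed
  obtain n :: nat where n: "4 * C \<le> (\<Sum>q=1..n. 1 / real q)" using harmonic_unbounded by blast
  define S where "S = (SIGMA q:{1..n}. {1..q})"
  define K where "K = (\<lambda>(q, p). f (p, q)) ` S"
  have S: "finite S" by (simp add: S_def)
  have pos: "1 / (4 * (real q)\<^sup>2) \<le> (transport_coeff (f (p, q)) l)\<^sup>2" if "1 \<le> p" "p \<le> q" for p q
  proof -
    have q: "0 < real q" using that by simp
    have "(norm (real_freq (f (p, q))))\<^sup>2 = (real p)\<^sup>2 + (real q)\<^sup>2"
      unfolding norm_real_freq_sq den by simp
    also have "\<dots> \<le> 2 * (real q)\<^sup>2" using that power_mono[of "real p" "real q" 2] by simp
    finally have d: "(norm (real_freq (f (p, q))))\<^sup>2 \<le> 2 * (real q)\<^sup>2" .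
    have d0: "0 < (norm (real_freq (f (p, q))))\<^sup>2"
      unfolding norm_real_freq_sq den using that by (simp add: sum_power2_gt_zero_iff)
    have nn: "(real q)\<^sup>2 \<le> (perp (f (p, q)) \<bullet> real_freq l)\<^sup>2"
      using num[of q p] unfolding perp_inner by (metis of_int_le_iff of_int_of_nat_eq of_int_power)
    have "1 / (4 * (real q)\<^sup>2) = (real q)\<^sup>2 / (2 * (real q)\<^sup>2)\<^sup>2"
      using q by (simp add: field_simps power2_eq_square)
    also have "\<dots> \<le> (perp (f (p, q)) \<bullet> real_freq l)\<^sup>2 / ((norm (real_freq (f (p, q))))\<^sup>2)\<^sup>2"
    proof (rule frac_le)
      show "0 < ((norm (real_freq (f (p, q))))\<^sup>2)\<^sup>2" using d0 by (rule zero_less_power)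
      show "((norm (real_freq (f (p, q))))\<^sup>2)\<^sup>2 \<le> (2 * (real q)\<^sup>2)\<^sup>2" using d by (rule power_mono) simp
    qed (use nn in auto)
    finally show ?thesis by (simp add: transport_coeff_def power_divide)
  qed
  have "4 * C \<le> (\<Sum>q=1..n. 1 / real q)" by (rule n)
  also have "\<dots> = 4 * (\<Sum>q=1..n. \<Sum>p=1..q. 1 / (4 * (real q)\<^sup>2))"
    by (simp add: sum_distrib_left power2_eq_square field_simps)
  also have "(\<Sum>q=1..n. \<Sum>p=1..q. 1 / (4 * (real q)\<^sup>2)) \<le> (\<Sum>q=1..n. \<Sum>p=1..q. (transport_coeff (f (p, q)) l)\<^sup>2)"
    using pos by (intro sum_mono) auto
  also have "\<dots> = (\<Sum>(q, p)\<in>S. (transport_coeff (f (p, q)) l)\<^sup>2)"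
    unfolding S_def by (subst sum.Sigma) auto
  also have "\<dots> = (\<Sum>k\<in>K. (transport_coeff k l)\<^sup>2)"
    unfolding K_def using inj by (subst sum.reindex) (auto simp: inj_on_def inj_def case_prod_beta)
  finally have "C \<le> (\<Sum>k\<in>K. (transport_coeff k l)\<^sup>2)" by simp
  moreover have "0 \<notin> K"
  proof
    assume "0 \<in> K"
    then obtain p q where pq: "f (p, q) = 0" "1 \<le> p" by (auto simp: K_def S_def)
    then show False using den[of p q] by simp
  qed
  moreover have "finite K" using S by (simp add: K_def)
  ultimately show ?thesis by blast
qed

section \<open>Bounded densities with finite gradient energy\<close>

context transport_setting
begin

lemma pair_affine_L2:
  assumes "\<psi> \<in> real_trig"
  shows "integrable \<mu> (\<lambda>\<omega>. (cmod (of_real (a * \<omega> \<psi> + b)))\<^sup>2)"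
proof -
  have "centered_gaussian \<mu> (\<lambda>\<omega>. \<omega> \<psi>)" using gaussian4[OF assms assms assms assms, of 1 0 0 0] by simp
  from centered_gaussian_moments(1)[OF this, of 1] have "integrable \<mu> (\<lambda>\<omega>. \<omega> \<psi>)" by simp
  then have "integrable \<mu> (\<lambda>\<omega>. a\<^sup>2 * (\<omega> \<psi> * \<omega> \<psi>) + (2 * a * b) * \<omega> \<psi> + b\<^sup>2)"
    using covariance(1)[OF assms assms] by simp
  then show ?thesis by (simp only: norm_of_real power2_abs) (simp add: power2_eq_square algebra_simps)
qed

text \<open>The identity for the complex functional \<open>(a\<langle>\<omega>, \<psi>\<rangle> + b) exp
  (i\<langle>\<omega>, \<phi>\<rangle>)\<close> is the combination of those for the real
  functionals with a cosine and with a sine.\<close>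

lemma test_affine_exp:
  assumes G: "is_transport_derivative T \<mu> k \<rho> G" and c: "c \<in> C1_interval T"
    and \<phi>: "\<phi> \<in> real_trig" and \<psi>: "\<psi> \<in> real_trig"
  shows "(CLINT z|M. G z * (wave c \<phi> z * of_real (a * snd z \<psi> + b))) =
    - tested c \<phi> (\<lambda>\<omega>. of_real a * transport_pair k \<omega> \<psi> + \<i> * ((of_real b + of_real a * of_real (\<omega> \<psi>)) * transport_pair k \<omega> \<phi>))"
proof -
  have GL2: "G \<in> L2 M" using G by (simp add: is_transport_derivative_def)
  obtain C where C: "\<forall>t\<in>{0..T}. \<bar>c t\<bar> \<le> C" using C1_measurable(2)[OF c] by blast
  note [measurable] = C1_measurable(1)[OF c] \<rho>_measurable pair_measurable[OF \<phi>] pair_measurable[OF \<psi>]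
  have pm: "(\<lambda>z. snd z \<phi>) \<in> borel_measurable M"
    by (rule measurable_compose[OF snd_measurable_M pair_measurable[OF \<phi>]])
  note [measurable] = pm
  define h where "h p q v = p * cos v + q * sin v" for p q v :: real
  have h: "\<bar>h p q v\<bar> \<le> \<bar>p\<bar> + \<bar>q\<bar>" for p q v
    using abs_trig_affine_le[of 0 p 0 q 0 v] by (simp add: h_def trig_affine_def)
  have [measurable]: "h p q \<in> borel_measurable borel" for p q
    unfolding h_def[abs_def] by measurable
  have intG: "integrable M (\<lambda>z. G z * (of_real (c (fst z) * h p q (snd z \<phi>)) * of_real (a * snd z \<psi> + b)))" for p q
  proof (rule L2_pairing(1)[OF GL2 _ _ _ pair_affine_L2[OF \<psi>], of _ "C * (\<bar>p\<bar> + \<bar>q\<bar>)"])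
    fix z assume z: "z \<in> space M"
    have "\<bar>c (fst z)\<bar> * \<bar>h p q (snd z \<phi>)\<bar> \<le> C * (\<bar>p\<bar> + \<bar>q\<bar>)"
      using C1_weight_bound(2)[OF C z] h by (intro mult_mono) auto
    then show "cmod (of_real (c (fst z) * h p q (snd z \<phi>))) \<le> C * (\<bar>p\<bar> + \<bar>q\<bar>)" by (simp add: norm_mult)
  qed measurable
  define w where "w p q z = complex_of_real (\<rho> (fst z) (snd z) * c (fst z) * h p q (snd z \<phi>))" for p q z
  have int\<rho>: "integrable M (\<lambda>z. w p q z * f (snd z))"
    if f: "integrable \<mu> f" for p q and f :: "functional \<Rightarrow> complex"
    unfolding w_def
  proof (rule weighted_integral(1)[OF _ _ f, of _ "(R * C) * (\<bar>p\<bar> + \<bar>q\<bar>)"])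
    fix z assume z: "z \<in> space M"
    have "\<bar>\<rho> (fst z) (snd z) * c (fst z)\<bar> * \<bar>h p q (snd z \<phi>)\<bar> \<le> (R * C) * (\<bar>p\<bar> + \<bar>q\<bar>)"
      using C1_weight_bound(1)[OF C z] h by (intro mult_mono) auto
    then show "cmod (of_real (\<rho> (fst z) (snd z) * c (fst z) * h p q (snd z \<phi>))) \<le> (R * C) * (\<bar>p\<bar> + \<bar>q\<bar>)"
      by (simp add: norm_mult abs_mult)
  qed measurable
  define X where "X \<omega> = transport_pair k \<omega> \<psi>" for \<omega>
  define Y where "Y \<omega> = (of_real b + of_real a * of_real (\<omega> \<psi>)) * transport_pair k \<omega> \<phi>" for \<omega>
  have X: "integrable \<mu> X" using pair_mult_transport_integrable[OF \<psi> \<psi>, of 1 0] by (simp add: X_def[abs_def])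
  have Y: "integrable \<mu> Y" using pair_mult_transport_integrable[OF \<psi> \<phi>] by (simp add: Y_def[abs_def])
  \<comment> \<open>The derivative of \<open>h p q\<close> is \<open>h q (- p)\<close>.\<close>
  have real_case: "(CLINT z|M. G z * (of_real (c (fst z) * h p q (snd z \<phi>)) * of_real (a * snd z \<psi> + b))) =
     - ((CLINT z|M. w q (- p) z * Y (snd z)) + of_real a * (CLINT z|M. w p q z * X (snd z)))" for p q
  proof -
    have "(CLINT z|M. G z * (of_real (c (fst z) * h p q (snd z \<phi>)) * of_real (a * snd z \<psi> + b))) =
      (CLINT z|M. G z * of_real (c (fst z) * trig_affine (a * p) (b * p) (a * q) (b * q) (snd z \<psi>) (snd z \<phi>)))"
      by (intro Bochner_Integration.integral_cong) (auto simp: trig_affine_def h_def algebra_simps)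
    also have "\<dots> = - (CLINT z|M. w q (- p) z * Y (snd z) + of_real a * (w p q z * X (snd z)))"
      unfolding transport_derivative_trig_affine[OF G c \<psi> \<phi> space_eq] X_def Y_def w_def
      by (intro arg_cong[where f=uminus] Bochner_Integration.integral_cong refl)
        (simp add: trig_affine_def h_def algebra_simps)
    finally show ?thesis unfolding integral_add_scaled[OF int\<rho>[OF Y] int\<rho>[OF X]] .
  qed
  have e: "iexp v = of_real (h 1 0 v) + \<i> * of_real (h 0 1 v)" for v
    by (simp add: exp_Euler cos_of_real sin_of_real h_def)
  have "(CLINT z|M. G z * (wave c \<phi> z * of_real (a * snd z \<psi> + b))) =
    (CLINT z|M. G z * (of_real (c (fst z) * h 1 0 (snd z \<phi>)) * of_real (a * snd z \<psi> + b)) +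
       \<i> * (G z * (of_real (c (fst z) * h 0 1 (snd z \<phi>)) * of_real (a * snd z \<psi> + b))))"
    unfolding e by (intro Bochner_Integration.integral_cong) (auto simp: algebra_simps)
  also have "\<dots> = - ((CLINT z|M. w 0 (- 1) z * Y (snd z)) + of_real a * (CLINT z|M. w 1 0 z * X (snd z)))
      + \<i> * - ((CLINT z|M. w 1 (- 0) z * Y (snd z)) + of_real a * (CLINT z|M. w 0 1 z * X (snd z)))"
    unfolding integral_add_scaled[OF intG intG] real_case ..
  also have "(\<lambda>z. w 0 (- 1) z * Y (snd z)) = (\<lambda>z. - (w 0 1 z * Y (snd z)))"
    by (simp add: w_def h_def)
  finally have L: "(CLINT z|M. G z * (wave c \<phi> z * of_real (a * snd z \<psi> + b))) =
    - (of_real a * ((CLINT z|M. w 1 0 z * X (snd z)) + \<i> * (CLINT z|M. w 0 1 z * X (snd z))) +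
      \<i> * ((CLINT z|M. w 1 0 z * Y (snd z)) + \<i> * (CLINT z|M. w 0 1 z * Y (snd z))))"
    by (simp add: algebra_simps)
  have J: "tested c \<phi> f = (CLINT z|M. w 1 0 z * f (snd z)) + \<i> * (CLINT z|M. w 0 1 z * f (snd z))" if f: "integrable \<mu> f" for f
    unfolding tested_def e integral_add_scaled[OF int\<rho>[OF f] int\<rho>[OF f], symmetric]
    by (intro Bochner_Integration.integral_cong) (auto simp: w_def algebra_simps)
  have "tested c \<phi> (\<lambda>\<omega>. of_real a * X \<omega> + \<i> * Y \<omega>) = of_real a * tested c \<phi> X + \<i> * tested c \<phi> Y"
    using X Y by (simp add: tested_add[OF c \<phi>] tested_scale[OF c \<phi>])
  then show ?thesis unfolding L J[OF X] J[OF Y] by (simp only: X_def Y_def)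
qed

lemma test_exp:
  assumes G: "is_transport_derivative T \<mu> k \<rho> G" and c: "c \<in> C1_interval T" and \<phi>: "\<phi> \<in> real_trig"
  shows "(CLINT z|M. G z * wave c \<phi> z) = - (\<i> * tested c \<phi> (\<lambda>\<omega>. transport_pair k \<omega> \<phi>))"
  using test_affine_exp[OF G c \<phi> \<phi>, of 0 1] by (simp add: tested_scale[OF c \<phi>])

lemma weighted_mode_integrable:
  assumes G: "G \<in> L2 M" and c: "c \<in> C1_interval T" and \<phi>: "\<phi> \<in> real_trig"
    and [measurable]: "f \<in> borel_measurable \<mu>" and f2: "integrable \<mu> (\<lambda>\<omega>. (cmod (f \<omega>))\<^sup>2)"
    and C: "\<forall>t\<in>{0..T}. \<bar>c t\<bar> \<le> C"
  shows "integrable M (\<lambda>z. G z * (wave c \<phi> z * f (snd z)))"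
    and "\<eta> > 0 \<Longrightarrow> cmod (CLINT z|M. G z * (wave c \<phi> z * f (snd z))) \<le>
      C / 2 * (\<eta> * T * (LINT \<omega>|\<mu>. (cmod (f \<omega>))\<^sup>2) + (LINT z|M. (cmod (G z))\<^sup>2) / \<eta>)"
proof -
  note [measurable] = C1_measurable(1)[OF c] 
  have pm[measurable]: "(\<lambda>z. snd z \<phi>) \<in> borel_measurable M"
    by (rule measurable_compose[OF snd_measurable_M pair_measurable[OF \<phi>]])
  have u: "(wave c \<phi>) \<in> borel_measurable M" by measurable
  have B: "cmod (wave c \<phi> z) \<le> C" if "z \<in> space M" for z
    using C1_weight_bound(2)[OF C that] by (simp add: norm_mult)
  show "integrable M (\<lambda>z. G z * (wave c \<phi> z * f (snd z)))"
    by (rule L2_pairing(1)[OF G u B _ f2]) auto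
  show "cmod (CLINT z|M. G z * (wave c \<phi> z * f (snd z))) \<le>
      C / 2 * (\<eta> * T * (LINT \<omega>|\<mu>. (cmod (f \<omega>))\<^sup>2) + (LINT z|M. (cmod (G z))\<^sup>2) / \<eta>)" if "\<eta> > 0"
    by (rule L2_pairing(2)[OF G u B _ f2 that]) auto
qed

lemma test_mode_exp:
  assumes G: "is_transport_derivative T \<mu> k \<rho> G" and c: "c \<in> C1_interval T" and \<phi>: "\<phi> \<in> real_trig"
  shows "(CLINT z|M. G z * (wave c \<phi> z * mode n (snd z))) =
    - tested c \<phi> (\<lambda>\<omega>. - (2 * of_real pi * \<i>) * of_real (transport_coeff k n) * mode (n + k) \<omega>
        + \<i> * (mode n \<omega> * transport_pair k \<omega> \<phi>))"
proof -
  have GL2: "G \<in> L2 M" using G by (simp add: is_transport_derivative_def)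
  obtain C where C: "\<forall>t\<in>{0..T}. \<bar>c t\<bar> \<le> C" using C1_measurable(2)[OF c] by blast
  define r where "r x = Re (fourier_mode n x)" for x
  define s where "s x = Im (fourier_mode n x)" for x
  have rs: "r \<in> real_trig" "s \<in> real_trig" unfolding r_def[abs_def] s_def[abs_def] by (rule Re_mode Im_mode)+
  let ?u = "wave c \<phi>"
  have w: "mode n \<omega> = of_real (\<omega> r) + \<i> * of_real (\<omega> s)" for \<omega>
    by (simp add: cpair_def r_def[abs_def] s_def[abs_def] complex_eq_iff)
  have int: "integrable M (\<lambda>z. G z * (?u z * of_real (snd z \<psi>)))" if \<psi>: "\<psi> \<in> real_trig" for \<psi>
  proof (rule weighted_mode_integrable(1)[OF GL2 c \<phi> _ _ C])
    show "integrable \<mu> (\<lambda>\<omega>. (cmod (of_real (\<omega> \<psi>)))\<^sup>2)" using pair_affine_L2[OF \<psi>, of 1 0] by simp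
    show "(\<lambda>\<omega>. complex_of_real (\<omega> \<psi>)) \<in> borel_measurable \<mu>" using pair_measurable[OF \<psi>] by simp
  qed
  define Z where "Z \<psi> \<omega> = transport_pair k \<omega> \<psi> + \<i> * (of_real (\<omega> \<psi>) * transport_pair k \<omega> \<phi>)" for \<psi> \<omega>
  have Zint: "integrable \<mu> (Z \<psi>)" if \<psi>: "\<psi> \<in> real_trig" for \<psi>
    unfolding Z_def using pair_mult_transport_integrable[OF \<psi> \<phi>, of 0 1 k] pair_mult_transport_integrable[OF \<psi> \<psi>, of 1 0 k]
    by (intro Bochner_Integration.integrable_add integrable_mult_right) simp_all
  have Z: "(CLINT z|M. G z * (?u z * of_real (snd z \<psi>))) = - tested c \<phi> (Z \<psi>)" if \<psi>: "\<psi> \<in> real_trig" for \<psi>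
    using test_affine_exp[OF G c \<phi> \<psi>, of 1 0] by (simp add: Z_def[abs_def])
  have "(CLINT z|M. G z * (?u z * mode n (snd z))) =
     (CLINT z|M. G z * (?u z * of_real (snd z r)) + \<i> * (G z * (?u z * of_real (snd z s))))"
    unfolding w by (intro Bochner_Integration.integral_cong) (auto simp: algebra_simps)
  also have "\<dots> = (CLINT z|M. G z * (?u z * of_real (snd z r))) + \<i> * (CLINT z|M. G z * (?u z * of_real (snd z s)))"
    by (rule integral_add_scaled[OF int[OF rs(1)] int[OF rs(2)]])
  also have "\<dots> = - tested c \<phi> (\<lambda>\<omega>. Z r \<omega> + \<i> * Z s \<omega>)"
    unfolding Z[OF rs(1)] Z[OF rs(2)] using Zint[OF rs(1)] Zint[OF rs(2)]
    by (simp add: tested_add[OF c \<phi>] tested_scale[OF c \<phi>])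
  also have "tested c \<phi> (\<lambda>\<omega>. Z r \<omega> + \<i> * Z s \<omega>) = tested c \<phi> (\<lambda>\<omega>. - (2 * of_real pi * \<i>) * of_real (transport_coeff k n) * mode (n + k) \<omega>
        + \<i> * (mode n \<omega> * transport_pair k \<omega> \<phi>))"
  proof (rule tested_cong[OF c \<phi>])
    fix \<omega> assume "\<omega> \<in> Hminus"
    from transport_pair_mode[OF Hminus_distributions[OF this], of k n, folded r_def s_def]
    have "transport_pair k \<omega> r + \<i> * transport_pair k \<omega> s = - (2 * of_real pi * \<i>) * of_real (transport_coeff k n) * mode (n + k) \<omega>"
      by (simp add: r_def[abs_def] s_def[abs_def])
    then show "Z r \<omega> + \<i> * Z s \<omega> = - (2 * of_real pi * \<i>) * of_real (transport_coeff k n) * mode (n + k) \<omega>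
        + \<i> * (mode n \<omega> * transport_pair k \<omega> \<phi>)"
      unfolding Z_def w by (simp only: flip: \<open>transport_pair k \<omega> r + \<i> * transport_pair k \<omega> s = _\<close>) (simp add: algebra_simps)
  qed
  finally show ?thesis .
qed

lemma wick_prod_integrable: "integrable \<mu> (wick_prod a b)"
  unfolding wick_prod_def[abs_def] using mode_mult_integrable by (intro Bochner_Integration.integrable_diff) auto

text \<open>The choice of the shift: \<open>\<sigma>\<^sub>-\<^sub>k \<cdot> \<nabla>\<close> takes the
  frequency \<open>l + k\<close> back to \<open>l\<close>, with the multiplier of
  \<open>l\<close> because \<open>k\<^sup>\<bottom> \<cdot> k = 0\<close>. The product of modes
  with \<open>m = - l\<close> has mean one for every \<open>k\<close>; this mean is what
  completes \<open>w\<^sub>l\<close> to the divergence \<open>w\<^sub>l - i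
  a\<^sub>-\<^sub>l\<close>.\<close>

lemma test_shifted_mode:
  assumes G: "is_transport_derivative T \<mu> (- k) \<rho> G" and c: "c \<in> C1_interval T"
    and a: "fin_supp a" and \<phi>: "\<And>x. of_real (\<phi> x) = trig a x"
  shows "(CLINT z|M. G z * (wave c \<phi> z * mode (l + k) (snd z))) =
    - (2 * of_real pi * \<i>) * (of_real (transport_coeff k l) * tested c \<phi> (\<lambda>\<omega>. mode l \<omega> - \<i> * a (- l)) +
      \<i> * (\<Sum>m | a m \<noteq> 0. a m * of_real (transport_coeff k m) * tested c \<phi> (wick_prod (l + k) (m - k))))"
proof -
  have \<phi>t: "\<phi> \<in> real_trig" by (rule real_trigI[OF a \<phi>])
  note lin = tested_add[OF c \<phi>t] tested_scale[OF c \<phi>t] tested_sum[OF c \<phi>t]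
  let ?c = "2 * of_real pi * \<i> :: complex" and ?A = "{m. a m \<noteq> 0}"
  have coeff: "transport_coeff (- k) (l + k) = - transport_coeff k l"
    by (simp add: transport_coeff_uminus_left transport_coeff_add transport_coeff_self)
  \<comment> \<open>The means of the products of modes.\<close>
  have contraction: "(\<Sum>m\<in>?A. a m * of_real (transport_coeff k m) * (if l + m = 0 then 1 else 0)) =
      - (of_real (transport_coeff k l) * a (- l))"
  proof -
    have "(\<Sum>m\<in>?A. a m * of_real (transport_coeff k m) * (if l + m = 0 then 1 else 0)) =
       (\<Sum>m\<in>?A. if m = - l then a m * of_real (transport_coeff k m) else 0)"
      by (intro sum.cong) (auto simp: add_eq_0_iff)
    also have "\<dots> = - (of_real (transport_coeff k l) * a (- l))"
      using a by (simp add: sum.delta transport_coeff_uminus_right)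
    finally show ?thesis .
  qed
  have "- (?c) * of_real (transport_coeff (- k) (l + k)) * mode (l + k + - k) \<omega> +
      \<i> * (mode (l + k) \<omega> * transport_pair (- k) \<omega> \<phi>) =
    ?c * (of_real (transport_coeff k l) * (mode l \<omega> - \<i> * a (- l)) +
      \<i> * (\<Sum>m\<in>?A. (a m * of_real (transport_coeff k m)) * wick_prod (l + k) (m - k) \<omega>))"
    if \<omega>: "\<omega> \<in> Hminus" for \<omega>
  proof -
    have "transport_pair (- k) \<omega> \<phi> = ?c * (\<Sum>m\<in>?A. (a m * of_real (transport_coeff k m)) * mode (m - k) \<omega>)"
      unfolding transport_pair_trig[OF Hminus_distributions[OF \<omega>] a \<phi>]
      by (simp add: transport_coeff_uminus_left sum_negf mult_ac)
    then have "mode (l + k) \<omega> * transport_pair (- k) \<omega> \<phi> =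
      ?c * (\<Sum>m\<in>?A. (a m * of_real (transport_coeff k m)) * (mode (l + k) \<omega> * mode (m - k) \<omega>))"
      by (simp add: sum_distrib_left mult_ac)
    also have "(\<Sum>m\<in>?A. (a m * of_real (transport_coeff k m)) * (mode (l + k) \<omega> * mode (m - k) \<omega>)) =
      (\<Sum>m\<in>?A. (a m * of_real (transport_coeff k m)) * wick_prod (l + k) (m - k) \<omega>) +
      (\<Sum>m\<in>?A. a m * of_real (transport_coeff k m) * (if l + m = 0 then 1 else 0))"
      unfolding sum.distrib[symmetric] wick_prod_def by (intro sum.cong) (auto simp: algebra_simps)
    finally have e: "mode (l + k) \<omega> * transport_pair (- k) \<omega> \<phi> =
      ?c * ((\<Sum>m\<in>?A. (a m * of_real (transport_coeff k m)) * wick_prod (l + k) (m - k) \<omega>) +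
        - (of_real (transport_coeff k l) * a (- l)))"
      unfolding contraction .
    show ?thesis unfolding coeff e by (simp add: algebra_simps)
  qed
  then have "tested c \<phi> (\<lambda>\<omega>. - (?c) * of_real (transport_coeff (- k) (l + k)) * mode (l + k + - k) \<omega> +
      \<i> * (mode (l + k) \<omega> * transport_pair (- k) \<omega> \<phi>)) =
    tested c \<phi> (\<lambda>\<omega>. ?c * (of_real (transport_coeff k l) * (mode l \<omega> - \<i> * a (- l)) +
      \<i> * (\<Sum>m\<in>?A. (a m * of_real (transport_coeff k m)) * wick_prod (l + k) (m - k) \<omega>)))"
    by (rule tested_cong[OF c \<phi>t])
  also have "\<dots> = ?c * (of_real (transport_coeff k l) * tested c \<phi> (\<lambda>\<omega>. mode l \<omega> - \<i> * a (- l)) +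
      \<i> * (\<Sum>m\<in>?A. a m * of_real (transport_coeff k m) * tested c \<phi> (wick_prod (l + k) (m - k))))"
  proof -
    have 1: "integrable \<mu> (\<lambda>\<omega>. mode l \<omega> - \<i> * a (- l))" using mode_integrable by simp
    have 2: "integrable \<mu> (\<lambda>\<omega>. (a m * of_real (transport_coeff k m)) * wick_prod (l + k) (m - k) \<omega>)" for m
      by (intro integrable_mult_right wick_prod_integrable)
    have 3: "integrable \<mu> (\<lambda>\<omega>. \<Sum>m\<in>?A. (a m * of_real (transport_coeff k m)) * wick_prod (l + k) (m - k) \<omega>)"
      by (intro Bochner_Integration.integrable_sum 2)
    show ?thesis
      using a by (subst lin(2), subst lin(1)) (simp_all only: integrable_mult_right 1 2 3 lin)
  qed
  finally show ?thesis
    using test_mode_exp[OF G c \<phi>t, of "l + k"] by (simp only: minus_mult_left)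
qed

text \<open>The weak derivative of the density in the direction of a non-constant mode is zero: the right-hand
  side is the density tested against the derivative of \<open>exp (i\<langle>\<omega>, \<phi>\<rangle>)\<close> in that direction. The difference \<open>J\<close> of the two sides is
  amplified by \<open>s = \<Sum>\<^sub>k \<tau>(k, l)\<^sup>2\<close> when the identities of \<open>test_shifted_mode\<close> are multiplied by
  \<open>\<tau>(k, l)\<close> and added, while the error terms are bounded by \<open>\<eta>sP + Q/\<eta>\<close> with constants that do
  not depend on the finite set of frequencies.\<close>

lemma tested_mode:
  assumes D: "\<And>k. k \<noteq> 0 \<Longrightarrow> is_transport_derivative T \<mu> k \<rho> (G k)"
    and \<Gamma>: "\<And>K. finite K \<Longrightarrow> 0 \<notin> K \<Longrightarrow> (\<Sum>k\<in>K. LINT z|M. (cmod (G k z))\<^sup>2) \<le> \<Gamma>"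
    and c: "c \<in> C1_interval T" and a: "fin_supp a" and \<phi>: "\<And>x. of_real (\<phi> x) = trig a x"
    and l: "l \<noteq> 0"
  shows "tested c \<phi> (mode l) = \<i> * a (- l) * tested c \<phi> (\<lambda>_. 1)"
proof -
  have \<phi>t: "\<phi> \<in> real_trig" by (rule real_trigI[OF a \<phi>])
  note lin = tested_add[OF c \<phi>t] tested_scale[OF c \<phi>t] tested_sum[OF c \<phi>t]
  obtain C where C0: "C \<ge> 0" and C: "\<forall>t\<in>{0..T}. \<bar>c t\<bar> \<le> C" using C1_measurable(2)[OF c] by blast
  let ?A = "{m. a m \<noteq> 0}" and ?\<tau> = "\<lambda>k. transport_coeff k l" and ?N = "\<lambda>m. norm (real_freq m)"
  define J where "J = tested c \<phi> (\<lambda>\<omega>. mode l \<omega> - \<i> * a (- l))"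
  define P where "P = C * T / 2 + 2 * pi * (\<Sum>m\<in>?A. cmod (a m) * (R * C * T / 2))"
  define Q where "Q = C * \<Gamma> / 2 + 2 * pi * (\<Sum>m\<in>?A. cmod (a m) * (R * C * T * (?N m)\<^sup>2))"
  have \<Gamma>0: "0 \<le> \<Gamma>" using \<Gamma>[of "{}"] by simp
  have RCT: "0 \<le> R * C * T" using R_nonneg C0 T by simp
  have PQ: "0 \<le> P" "0 \<le> Q" unfolding P_def Q_def using C0 T \<Gamma>0 RCT
    by (auto intro!: add_nonneg_nonneg mult_nonneg_nonneg sum_nonneg divide_nonneg_nonneg)
  have main: "2 * pi * s * cmod J \<le> \<eta> * s * P + Q / \<eta>"
    if K: "finite K" "0 \<notin> K" and s: "s = (\<Sum>k\<in>K. (?\<tau> k)\<^sup>2)" "s > 0" and \<eta>: "\<eta> > 0" for K s \<eta>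
  proof -
    define L where "L k = (CLINT z|M. G (- k) z * (wave c \<phi> z * mode (l + k) (snd z)))" for k
    define W where "W m \<omega> = (\<Sum>k\<in>K. of_real (?\<tau> k * transport_coeff k m) * wick_prod (l + k) (m - k) \<omega>)" for m \<omega>
    have W_int: "integrable \<mu> (W m)" for m
      unfolding W_def by (intro Bochner_Integration.integrable_sum integrable_mult_right wick_prod_integrable)
    have W: "tested c \<phi> (W m) = (\<Sum>k\<in>K. of_real (?\<tau> k * transport_coeff k m) * tested c \<phi> (wick_prod (l + k) (m - k)))" for m
      unfolding W_def using K(1) by (subst lin(3)) (auto simp: lin(2) wick_prod_integrable intro!: integrable_mult_right)
    have Lk: "L k = - (2 * of_real pi * \<i>) * (of_real (?\<tau> k) * J +
      \<i> * (\<Sum>m\<in>?A. a m * of_real (transport_coeff k m) * tested c \<phi> (wick_prod (l + k) (m - k))))" if "k \<in> K" for k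
    proof -
      have "- k \<noteq> 0" using that K(2) by auto
      from test_shifted_mode[OF D[OF this] c a \<phi>] show ?thesis by (simp only: L_def J_def)
    qed
    have "(\<Sum>k\<in>K. of_real (?\<tau> k) * L k) = - (2 * of_real pi * \<i>) *
      (\<Sum>k\<in>K. of_real ((?\<tau> k)\<^sup>2) * J + \<i> * (\<Sum>m\<in>?A. a m * (of_real (?\<tau> k * transport_coeff k m) * tested c \<phi> (wick_prod (l + k) (m - k)))))"
      unfolding sum_distrib_left[of "- (2 * of_real pi * \<i>)"]
      by (intro sum.cong refl) (simp add: Lk sum_distrib_left power2_eq_square algebra_simps)
    also have "\<dots> = - (2 * of_real pi * \<i>) * (of_real s * J + \<i> * (\<Sum>m\<in>?A. a m * tested c \<phi> (W m)))"
    proof -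
      have "(\<Sum>k\<in>K. \<Sum>m\<in>?A. a m * (of_real (?\<tau> k * transport_coeff k m) * tested c \<phi> (wick_prod (l + k) (m - k)))) =
        (\<Sum>m\<in>?A. a m * tested c \<phi> (W m))"
        unfolding W sum_distrib_left by (rule sum.swap)
      then show ?thesis
        unfolding s(1) by (simp add: sum.distrib flip: sum_distrib_left sum_distrib_right)
    qed
    finally have id: "(2 * of_real pi * \<i>) * (of_real s * J) =
       - (\<Sum>k\<in>K. of_real (?\<tau> k) * L k) - (2 * of_real pi * \<i>) * (\<i> * (\<Sum>m\<in>?A. a m * tested c \<phi> (W m)))"
      by (simp add: algebra_simps)
    have "2 * pi * s * cmod J = cmod ((2 * of_real pi * \<i>) * (of_real s * J))"
      using s(2) by (simp add: norm_mult)
    also have "\<dots> \<le> cmod (\<Sum>k\<in>K. of_real (?\<tau> k) * L k) + 2 * pi * cmod (\<Sum>m\<in>?A. a m * tested c \<phi> (W m))"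
      unfolding id by (rule order_trans[OF norm_triangle_ineq4]) (simp add: norm_mult)
    also have "cmod (\<Sum>k\<in>K. of_real (?\<tau> k) * L k) \<le> (\<Sum>k\<in>K. C / 2 * (\<eta> * T * (?\<tau> k)\<^sup>2 + (LINT z|M. (cmod (G (- k) z))\<^sup>2) / \<eta>))"
    proof (rule sum_norm_le)
      fix k assume k: "k \<in> K"
      then have "- k \<noteq> 0" using K(2) by auto
      then have GL2: "G (- k) \<in> L2 M" using D unfolding is_transport_derivative_def by blast
      let ?f = "\<lambda>\<omega>. of_real (?\<tau> k) * mode (l + k) \<omega>"
      have f2: "(cmod (?f \<omega>))\<^sup>2 = (?\<tau> k)\<^sup>2 * (cmod (mode (l + k) \<omega>))\<^sup>2" for \<omega>
        by (simp add: norm_mult power_mult_distrib)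
      have "of_real (?\<tau> k) * L k = (CLINT z|M. of_real (?\<tau> k) * (G (- k) z * (wave c \<phi> z * mode (l + k) (snd z))))"
        unfolding L_def by (simp only: integral_mult_right_zero)
      also have "\<dots> = (CLINT z|M. G (- k) z * (wave c \<phi> z * ?f (snd z)))"
        by (intro Bochner_Integration.integral_cong refl) (simp only: mult_ac)
      also have "cmod \<dots> \<le> C / 2 * (\<eta> * T * (LINT \<omega>|\<mu>. (cmod (?f \<omega>))\<^sup>2) + (LINT z|M. (cmod (G (- k) z))\<^sup>2) / \<eta>)"
        by (rule weighted_mode_integrable(2)[OF GL2 c \<phi>t _ _ C \<eta>]) (auto simp only: f2 intro!: mode_norm_sq integrable_mult_right borel_measurable_times borel_measurable_const mode_measurable)
      also have "(LINT \<omega>|\<mu>. (cmod (?f \<omega>))\<^sup>2) = (?\<tau> k)\<^sup>2"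
        unfolding f2 using mode_norm_sq by simp
      finally show "cmod (of_real (?\<tau> k) * L k) \<le> C / 2 * (\<eta> * T * (?\<tau> k)\<^sup>2 + (LINT z|M. (cmod (G (- k) z))\<^sup>2) / \<eta>)" .
    qed
    also have "(\<Sum>k\<in>K. C / 2 * (\<eta> * T * (?\<tau> k)\<^sup>2 + (LINT z|M. (cmod (G (- k) z))\<^sup>2) / \<eta>)) =
      C / 2 * (\<eta> * T * s + (\<Sum>k\<in>K. LINT z|M. (cmod (G (- k) z))\<^sup>2) / \<eta>)"
      unfolding s(1) by (simp add: sum.distrib flip: sum_distrib_left sum_divide_distrib)
    also have "(\<Sum>k\<in>K. LINT z|M. (cmod (G (- k) z))\<^sup>2) = (\<Sum>k\<in>uminus ` K. LINT z|M. (cmod (G k z))\<^sup>2)"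
      by (subst sum.reindex) auto
    also have "C / 2 * (\<eta> * T * s + (\<Sum>k\<in>uminus ` K. LINT z|M. (cmod (G k z))\<^sup>2) / \<eta>) \<le> C / 2 * (\<eta> * T * s + \<Gamma> / \<eta>)"
      using K \<eta> C0 by (intro mult_left_mono add_left_mono divide_right_mono \<Gamma>) auto
    also have "cmod (\<Sum>m\<in>?A. a m * tested c \<phi> (W m)) \<le> (\<Sum>m\<in>?A. cmod (a m) * (R * C * T * (\<eta> * s / 2 + (?N m)\<^sup>2 / \<eta>)))"
    proof (rule sum_norm_le)
      fix m
      have W2: "integrable \<mu> (\<lambda>\<omega>. (cmod (W m \<omega>))\<^sup>2)" "(LINT \<omega>|\<mu>. (cmod (W m \<omega>))\<^sup>2) \<le> 2 * (\<Sum>k\<in>K. (?\<tau> k * transport_coeff k m)\<^sup>2)"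
        unfolding W_def by (rule wick_sum_norm_sq[OF K(1)])+
      have "(\<Sum>k\<in>K. (?\<tau> k * transport_coeff k m)\<^sup>2) \<le> (\<Sum>k\<in>K. (?\<tau> k)\<^sup>2 * (?N m)\<^sup>2)"
      proof (rule sum_mono)
        fix k assume "k \<in> K"
        then have "k \<noteq> 0" using K(2) by auto
        from power_mono[OF transport_coeff_bound[OF this, of m], of 2]
        show "(?\<tau> k * transport_coeff k m)\<^sup>2 \<le> (?\<tau> k)\<^sup>2 * (?N m)\<^sup>2"
          by (simp add: power_mult_distrib mult_left_mono)
      qed
      also have "\<dots> = s * (?N m)\<^sup>2" unfolding s(1) by (simp add: sum_distrib_right)
      finally have W2': "(LINT \<omega>|\<mu>. (cmod (W m \<omega>))\<^sup>2) \<le> 2 * (s * (?N m)\<^sup>2)" using W2(2) by linarith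
      have "(LINT \<omega>|\<mu>. cmod (W m \<omega>)) \<le> (LINT \<omega>|\<mu>. \<eta> * s / 2 + (cmod (W m \<omega>))\<^sup>2 / (2 * \<eta> * s))"
      proof (rule integral_mono)
        show "integrable \<mu> (\<lambda>\<omega>. cmod (W m \<omega>))" using W_int by (rule integrable_norm)
        show "integrable \<mu> (\<lambda>\<omega>. \<eta> * s / 2 + (cmod (W m \<omega>))\<^sup>2 / (2 * \<eta> * s))" using W2(1) by simp
        fix \<omega>
        have "0 \<le> (\<eta> * s - cmod (W m \<omega>))\<^sup>2 / (2 * \<eta> * s)" using \<eta> s(2) by simp
        also have "\<dots> = \<eta> * s / 2 + (cmod (W m \<omega>))\<^sup>2 / (2 * \<eta> * s) - cmod (W m \<omega>)"
          using \<eta> s(2) by (simp add: field_simps power2_eq_square)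
        finally show "cmod (W m \<omega>) \<le> \<eta> * s / 2 + (cmod (W m \<omega>))\<^sup>2 / (2 * \<eta> * s)" by simp
      qed
      also have "\<dots> = \<eta> * s / 2 + (LINT \<omega>|\<mu>. (cmod (W m \<omega>))\<^sup>2) / (2 * \<eta> * s)"
        using W2(1) by (simp add: prob_space)
      also have "\<dots> \<le> \<eta> * s / 2 + 2 * (s * (?N m)\<^sup>2) / (2 * \<eta> * s)"
        using W2' \<eta> s(2) by (intro add_left_mono divide_right_mono) auto
      also have "\<dots> = \<eta> * s / 2 + (?N m)\<^sup>2 / \<eta>" using \<eta> s(2) by simp
      finally have "R * C * T * (LINT \<omega>|\<mu>. cmod (W m \<omega>)) \<le> R * C * T * (\<eta> * s / 2 + (?N m)\<^sup>2 / \<eta>)"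
        using RCT by (rule mult_left_mono)
      with tested_bound[OF c \<phi>t W_int C] have "cmod (tested c \<phi> (W m)) \<le> R * C * T * (\<eta> * s / 2 + (?N m)\<^sup>2 / \<eta>)"
        by (rule order_trans)
      then show "cmod (a m * tested c \<phi> (W m)) \<le> cmod (a m) * (R * C * T * (\<eta> * s / 2 + (?N m)\<^sup>2 / \<eta>))"
        unfolding norm_mult by (intro mult_left_mono) auto
    qed
    finally have "2 * pi * s * cmod J \<le> C / 2 * (\<eta> * T * s + \<Gamma> / \<eta>) +
       2 * pi * (\<Sum>m\<in>?A. cmod (a m) * (R * C * T * (\<eta> * s / 2 + (?N m)\<^sup>2 / \<eta>)))" by simp
    also have "\<dots> = \<eta> * s * P + Q / \<eta>"
    proof -
      have "(\<Sum>m\<in>?A. cmod (a m) * (R * C * T * (\<eta> * s / 2 + (?N m)\<^sup>2 / \<eta>))) =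
        \<eta> * s * (\<Sum>m\<in>?A. cmod (a m) * (R * C * T / 2)) + (\<Sum>m\<in>?A. cmod (a m) * (R * C * T * (?N m)\<^sup>2)) / \<eta>"
        unfolding sum_distrib_left sum_divide_distrib sum.distrib[symmetric]
        by (intro sum.cong refl) (simp add: algebra_simps)
      then show ?thesis unfolding P_def Q_def by (simp add: algebra_simps add_divide_distrib)
    qed
    finally show ?thesis .
  qed
  have "J = 0"
  proof (rule ccontr)
    assume "J \<noteq> 0"
    then have J: "cmod J > 0" by simp
    \<comment> \<open>For \<open>s \<ge> 1/\<eta>\<^sup>2\<close> both error terms are at most \<open>\<eta>s\<close> times a constant; this \<open>\<eta>\<close> keeps them
      below half of the main term.\<close>
    define \<eta> where "\<eta> = pi * cmod J / (P + Q + 1)"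
    have \<eta>: "\<eta> > 0" using J PQ by (simp add: \<eta>_def)
    obtain K where K: "finite K" "0 \<notin> K" "1 + 1 / \<eta>\<^sup>2 \<le> (\<Sum>k\<in>K. (?\<tau> k)\<^sup>2)"
      using transport_coeff_sum_unbounded[OF l] by blast
    define s where "s = (\<Sum>k\<in>K. (?\<tau> k)\<^sup>2)"
    have s: "1 / \<eta>\<^sup>2 \<le> s" "s > 0" using K(3) \<eta> unfolding s_def by (smt (verit) divide_nonneg_nonneg zero_le_power2)+
    have "2 * pi * s * cmod J \<le> \<eta> * s * P + Q / \<eta>" by (rule main[OF K(1,2) s_def s(2) \<eta>])
    also have "Q / \<eta> \<le> \<eta> * s * Q"
    proof -
      have "1 \<le> \<eta>\<^sup>2 * s" using s(1) \<eta> by (simp add: divide_le_eq mult.commute)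
      then have "1 / \<eta> \<le> \<eta> * s" using \<eta> by (simp add: divide_le_eq power2_eq_square mult_ac)
      from mult_right_mono[OF this PQ(2)] show ?thesis by simp
    qed
    also have "\<eta> * s * P + \<eta> * s * Q \<le> s * (\<eta> * (P + Q + 1))" using \<eta> s(2) by (simp add: algebra_simps)
    also have "\<dots> = s * (pi * cmod J)" using PQ by (simp add: \<eta>_def)
    finally show False using s(2) J by simp
  qed
  moreover have "J = tested c \<phi> (mode l) + (- (\<i> * a (- l))) * tested c \<phi> (\<lambda>_. 1)"
  proof -
    have "J = tested c \<phi> (\<lambda>\<omega>. mode l \<omega> + (- (\<i> * a (- l))) * 1)" by (simp add: J_def)
    also have "\<dots> = tested c \<phi> (mode l) + tested c \<phi> (\<lambda>\<omega>. (- (\<i> * a (- l))) * 1)"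
      by (rule lin(1)) (auto intro: mode_integrable)
    also have "tested c \<phi> (\<lambda>\<omega>. (- (\<i> * a (- l))) * 1) = (- (\<i> * a (- l))) * tested c \<phi> (\<lambda>_. 1)"
      by (rule lin(2))
    finally show ?thesis .
  qed
  ultimately show ?thesis by simp
qed

text \<open>The involution \<open>m \<mapsto> - (m + k)\<close> exchanges the two coefficients and reverses
  the sign of the multiplier.\<close>

lemma antisymmetric_sum_zero:
  assumes a: "fin_supp a"
  shows "(\<Sum>m | a m \<noteq> 0. of_real (transport_coeff k m) * a m * a (- (m + k))) = 0"
proof -
  let ?f = "\<lambda>m. of_real (transport_coeff k m) * a m * a (- (m + k))"
  have t: "transport_coeff k (- m - k) = - transport_coeff k m" for m
    using transport_coeff_uminus_right[of k "m + k"] by (simp add: transport_coeff_add transport_coeff_self)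
  let ?B = "{m. a m \<noteq> 0 \<and> a (- (m + k)) \<noteq> 0}"
  have "(\<Sum>m | a m \<noteq> 0. ?f m) = (\<Sum>m\<in>?B. ?f m)"
    using a by (intro sum.mono_neutral_right) auto
  moreover have "(\<Sum>m\<in>?B. ?f m) = (\<Sum>m\<in>?B. - ?f m)"
    by (rule sum.reindex_bij_witness[of _ "\<lambda>m. - (m + k)" "\<lambda>m. - (m + k)"])
      (auto simp: t)
  ultimately show ?thesis by (simp add: sum_negf)
qed

text \<open>By the vanishing weak derivatives, each \<open>w\<^sub>m\<^sub>+\<^sub>k\<close> in the
  transported exponential may be replaced by the constant \<open>i
  a\<^sub>-\<^sub>(\<^sub>m\<^sub>+\<^sub>k\<^sub>)\<close>; what remains is an antisymmetric
  sum.\<close>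

lemma derivative_test_exp_zero:
  assumes D: "\<And>k. k \<noteq> 0 \<Longrightarrow> is_transport_derivative T \<mu> k \<rho> (G k)"
    and \<Gamma>: "\<And>K. finite K \<Longrightarrow> 0 \<notin> K \<Longrightarrow> (\<Sum>k\<in>K. LINT z|M. (cmod (G k z))\<^sup>2) \<le> \<Gamma>"
    and c: "c \<in> C1_interval T" and \<phi>t: "\<phi> \<in> real_trig" and k: "k \<noteq> 0"
  shows "(CLINT z|M. G k z * wave c \<phi> z) = 0"
proof -
  obtain a where a: "fin_supp a" and \<phi>: "\<And>x. of_real (\<phi> x) = trig a x" using real_trigE[OF \<phi>t] by metis
  note lin = tested_add[OF c \<phi>t] tested_scale[OF c \<phi>t] tested_sum[OF c \<phi>t]
  let ?c = "- (2 * of_real pi * \<i>) :: complex" and ?A = "{m. a m \<noteq> 0}"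
  have "tested c \<phi> (\<lambda>\<omega>. transport_pair k \<omega> \<phi>) =
     tested c \<phi> (\<lambda>\<omega>. ?c * (\<Sum>m\<in>?A. (of_real (transport_coeff k m) * a m) * mode (m + k) \<omega>))"
    by (rule tested_cong[OF c \<phi>t]) (simp only: transport_pair_trig[OF Hminus_distributions a \<phi>])
  also have "\<dots> = ?c * (\<Sum>m\<in>?A. (of_real (transport_coeff k m) * a m) * tested c \<phi> (mode (m + k)))"
    using a by (subst lin(2), subst lin(3)) (simp_all only: integrable_mult_right mode_integrable lin(2))
  also have "(\<Sum>m\<in>?A. (of_real (transport_coeff k m) * a m) * tested c \<phi> (mode (m + k))) =
    (\<Sum>m\<in>?A. (of_real (transport_coeff k m) * a m * a (- (m + k))) * (\<i> * tested c \<phi> (\<lambda>_. 1)))"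
  proof (rule sum.cong[OF refl])
    fix m
    show "(of_real (transport_coeff k m) * a m) * tested c \<phi> (mode (m + k)) =
      (of_real (transport_coeff k m) * a m * a (- (m + k))) * (\<i> * tested c \<phi> (\<lambda>_. 1))"
    proof (cases "m + k = 0")
      case True
      then have "m = - k" by (simp add: add_eq_0_iff2)
      then show ?thesis by (simp add: transport_coeff_uminus_right transport_coeff_self)
    next
      case False
      have "tested c \<phi> (mode (m + k)) = \<i> * a (- (m + k)) * tested c \<phi> (\<lambda>_. 1)"
        by (rule tested_mode[of G \<Gamma> c a \<phi>]) (fact D \<Gamma> c a \<phi> False)+
      then show ?thesis by (simp only: mult_ac)
    qed
  qed
  also have "\<dots> = 0"
    unfolding sum_distrib_right[symmetric] antisymmetric_sum_zero[OF a] by simp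
  finally have "tested c \<phi> (\<lambda>\<omega>. transport_pair k \<omega> \<phi>) = 0" by simp
  then show ?thesis using test_exp[OF D[OF k] c \<phi>t] by simp
qed

end

section \<open>Convergence of the series\<close>

context transport_setting
begin

lemma C1_cos_sin: "(\<lambda>t. cos (\<tau> * t)) \<in> C1_interval T" "(\<lambda>t. sin (\<tau> * t)) \<in> C1_interval T"
proof -
  have "((\<lambda>t. cos (\<tau> * t)) has_real_derivative - \<tau> * sin (\<tau> * t)) (at t within {0..T})"
    "((\<lambda>t. sin (\<tau> * t)) has_real_derivative \<tau> * cos (\<tau> * t)) (at t within {0..T})" for t
    by (auto intro!: derivative_eq_intros)
  moreover have "continuous_on {0..T} (\<lambda>t. - \<tau> * sin (\<tau> * t))" "continuous_on {0..T} (\<lambda>t. \<tau> * cos (\<tau> * t))"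
    by (intro continuous_intros)+
  ultimately show "(\<lambda>t. cos (\<tau> * t)) \<in> C1_interval T" "(\<lambda>t. sin (\<tau> * t)) \<in> C1_interval T"
    unfolding C1_interval_def by blast+
qed

text \<open>Functions of the form \<open>\<tau>t + \<langle>\<omega>, \<phi>\<rangle>\<close> are closed
  under adding multiples of time and of the modes, as the uniqueness theorem requires. The
  equality with such a function is demanded on the space only, because functionals outside it
  need not be linear.\<close>

lemma derivative_AE_zero:
  assumes D: "\<And>k. k \<noteq> 0 \<Longrightarrow> is_transport_derivative T \<mu> k \<rho> (G k)"
    and \<Gamma>: "\<And>K. finite K \<Longrightarrow> 0 \<notin> K \<Longrightarrow> (\<Sum>k\<in>K. LINT z|M. (cmod (G k z))\<^sup>2) \<le> \<Gamma>"
    and k: "k \<noteq> 0"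
  shows "AE z in M. G k z = 0"
proof -
  have GL2: "G k \<in> L2 M" using D[OF k] by (simp add: is_transport_derivative_def)
  define V :: "(real \<times> functional \<Rightarrow> real) set" where "V = insert fst ((\<lambda>\<phi> z. snd z \<phi>) ` mode_parts)"
  define W where "W = {X \<in> borel_measurable M. \<exists>\<tau> \<phi>. \<phi> \<in> real_trig \<and> (\<forall>z\<in>space M. X z = \<tau> * fst z + snd z \<phi>)}"
  have WI: "X \<in> W" if "X \<in> borel_measurable M" "\<phi> \<in> real_trig" "\<And>z. z \<in> space M \<Longrightarrow> X z = \<tau> * fst z + snd z \<phi>" for X \<tau> \<phi>
    using that unfolding W_def by blast
  have dist: "snd z \<in> distributions" if "z \<in> space M" for z
    using that Hminus_distributions by (auto simp: space_M)
  have pm: "(\<lambda>z. snd z \<phi>) \<in> borel_measurable M" if "\<phi> \<in> real_trig" for \<phi>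
    by (rule measurable_compose[OF snd_measurable_M pair_measurable[OF that]])
  have iG: "integrable M (\<lambda>z. G k z * (u z * 1))" if [measurable]: "u \<in> borel_measurable M" and "\<And>z. z \<in> space M \<Longrightarrow> cmod (u z) \<le> 1" for u
    by (rule L2_pairing(1)[OF GL2, of u 1 "\<lambda>_. 1"]) (use that in auto)
  have zero: "(\<lambda>_. 0) \<in> W"
    by (rule WI[OF _ real_trig_zero, of _ 0]) (auto simp: distribution_zero[OF dist])
  have VW: "V \<subseteq> W"
  proof
    fix X assume "X \<in> V"
    then consider "X = fst" | \<phi> where "\<phi> \<in> mode_parts" "X = (\<lambda>z. snd z \<phi>)" unfolding V_def by blast
    then show "X \<in> W"
    proof cases
      case 1
      then show ?thesis by (intro WI[OF _ real_trig_zero, of _ 1]) (auto simp: distribution_zero[OF dist])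
    next
      case 2
      then have "\<phi> \<in> real_trig" using mode_parts_real_trig by blast
      then show ?thesis using 2 pm by (intro WI[of _ \<phi> 0]) auto
    qed
  qed
  show ?thesis
  proof (rule complex_density_zero_of_joint_char[where W = W and V = V])
    show "sigma_finite_measure M" using finite_M by (simp add: finite_measure_def)
    show "integrable M (G k)" using iG[of "\<lambda>_. 1"] by simp
    show "W \<subseteq> borel_measurable M" by (auto simp: W_def)
    show "V \<subseteq> W" "(\<lambda>_. 0) \<in> W" by (fact VW zero)+
    show "(\<lambda>x. X x + s * Y x) \<in> W" if X: "X \<in> W" and Y: "Y \<in> V" for X Y s
    proof -
      obtain \<tau> \<phi> where 1: "X \<in> borel_measurable M" "\<phi> \<in> real_trig" "\<And>z. z \<in> space M \<Longrightarrow> X z = \<tau> * fst z + snd z \<phi>"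
        using X unfolding W_def by blast
      obtain \<tau>' \<psi> where 2: "Y \<in> borel_measurable M" "\<psi> \<in> real_trig" "\<And>z. z \<in> space M \<Longrightarrow> Y z = \<tau>' * fst z + snd z \<psi>"
        using Y VW unfolding W_def by blast
      show ?thesis
      proof (rule WI[of _ "\<lambda>x. 1 * \<phi> x + s * \<psi> x" "\<tau> + s * \<tau>'"])
        show "(\<lambda>x. X x + s * Y x) \<in> borel_measurable M" using 1(1) 2(1) by measurable
        show "(\<lambda>x. 1 * \<phi> x + s * \<psi> x) \<in> real_trig" by (rule real_trig_lin[OF 1(2) 2(2)])
        fix z assume z: "z \<in> space M"
        show "X z + s * Y z = (\<tau> + s * \<tau>') * fst z + snd z (\<lambda>x. 1 * \<phi> x + s * \<psi> x)"
          unfolding distribution_lin[OF dist[OF z] 1(2) 2(2)] 1(3)[OF z] 2(3)[OF z] by (simp add: algebra_simps)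
      qed
    qed
    show "sets M \<subseteq> sigma_sets (space M) {X -` B \<inter> space M |X B. X \<in> V \<and> B \<in> sets borel}"
      unfolding V_def by (rule sets_time_space_subset[OF space_eq sets_eq])
    show "(CLINT z|M. G k z * iexp (X z)) = 0" if X: "X \<in> W" for X
    proof -
      obtain \<tau> \<phi> where 1: "\<phi> \<in> real_trig" "\<And>z. z \<in> space M \<Longrightarrow> X z = \<tau> * fst z + snd z \<phi>"
        using X unfolding W_def by blast
      have [measurable]: "(\<lambda>z. snd z \<phi>) \<in> borel_measurable M" by (rule pm[OF 1(1)])
      have zero: "(CLINT z|M. G k z * wave c \<phi> z) = 0" if c: "c \<in> C1_interval T" for c
        by (rule derivative_test_exp_zero[where G = G and \<Gamma> = \<Gamma>]) (fact D \<Gamma> c 1(1) k)+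
      have int: "integrable M (\<lambda>z. G k z * (of_real (h (\<tau> * fst z)) * iexp (snd z \<phi>)))"
        if [measurable]: "h \<in> borel_measurable borel" and h: "\<And>x. \<bar>h x\<bar> \<le> 1" for h :: "real \<Rightarrow> real"
      proof -
        have "integrable M (\<lambda>z. G k z * ((of_real (h (\<tau> * fst z)) * iexp (snd z \<phi>)) * 1))"
          by (rule iG) (auto simp: norm_mult h)
        then show ?thesis by simp
      qed
      have int_cos: "integrable M (\<lambda>z. G k z * (of_real (cos (\<tau> * fst z)) * iexp (snd z \<phi>)))"
        and int_sin: "integrable M (\<lambda>z. G k z * (of_real (sin (\<tau> * fst z)) * iexp (snd z \<phi>)))"
        by (rule int; simp)+
      have e: "iexp x = of_real (cos x) + \<i> * of_real (sin x)" for x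
        by (simp add: exp_Euler cos_of_real sin_of_real)
      have "(CLINT z|M. G k z * iexp (X z)) =
        (CLINT z|M. G k z * (of_real (cos (\<tau> * fst z)) * iexp (snd z \<phi>)) + \<i> * (G k z * (of_real (sin (\<tau> * fst z)) * iexp (snd z \<phi>))))"
      proof (intro Bochner_Integration.integral_cong refl)
        fix z assume z: "z \<in> space M"
        have "iexp (X z) = iexp (\<tau> * fst z) * iexp (snd z \<phi>)"
          unfolding 1(2)[OF z] by (simp add: exp_add distrib_left)
        then show "G k z * iexp (X z) = G k z * (of_real (cos (\<tau> * fst z)) * iexp (snd z \<phi>)) + \<i> * (G k z * (of_real (sin (\<tau> * fst z)) * iexp (snd z \<phi>)))"
          unfolding e[of "\<tau> * fst z"] by (simp only:) (simp add: algebra_simps)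
      qed
      also have "\<dots> = (CLINT z|M. G k z * (of_real (cos (\<tau> * fst z)) * iexp (snd z \<phi>))) +
          \<i> * (CLINT z|M. G k z * (of_real (sin (\<tau> * fst z)) * iexp (snd z \<phi>)))"
        by (rule integral_add_scaled[OF int_cos int_sin])
      also have "\<dots> = 0" using zero[OF C1_cos_sin(1)] zero[OF C1_cos_sin(2)] by simp
      finally show ?thesis .
    qed
  qed
qed

end

theorem theorem1p6:
  fixes T :: real
    and \<mu> :: "functional measure"
    and \<rho>0 :: "functional \<Rightarrow> real"
    and \<rho> :: "real \<Rightarrow> functional \<Rightarrow> real"
    and G :: "int^2 \<Rightarrow> real \<times> functional \<Rightarrow> complex"
  assumes "T > 0"
    and "white_noise_law \<mu>"
    and "continuous_map Hminus_topology euclideanreal \<rho>0"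
    and "bounded (\<rho>0 ` Hminus)"
    and "\<forall>\<omega>\<in>Hminus. \<rho>0 \<omega> \<ge> 0"
    and "(LINT \<omega>|\<mu>. \<rho>0 \<omega>) = 1"
    and "(\<lambda>(t, \<omega>). \<rho> t \<omega>) \<in> borel_measurable (time_space T \<mu>)"
    and "\<forall>t\<in>{0..T}. \<forall>\<omega>\<in>Hminus. \<rho> t \<omega> \<in> {0..Hminus_sup_norm \<rho>0}"
    and "\<forall>t\<in>{0..T}. (LINT \<omega>|\<mu>. \<rho> t \<omega>) = 1"
    and "\<forall>k. k \<noteq> 0 \<longrightarrow> is_transport_derivative T \<mu> k \<rho> (G k)"
    and "(\<Sum>\<^sub>\<infinity>k\<in>UNIV - {0}. \<integral>\<^sup>+z. ennreal ((cmod (G k z))\<^sup>2) \<partial>time_space T \<mu>)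
           \<le> ennreal ((Hminus_sup_norm \<rho>0)\<^sup>2)"
  shows "L2_convergent (time_space T \<mu>)
           (\<lambda>N (t, \<omega>). 2 * of_real pi * \<i> *
              (\<Sum>k | 0 < norm (real_freq k) \<and> norm (real_freq k) \<le> real N.
                 cpair \<omega> (fourier_mode k) * G k (t, \<omega>)))"
proof -
  interpret transport_setting \<mu> T "Hminus_sup_norm \<rho>0" \<rho>
  proof
    show "(\<lambda>z. \<rho> (fst z) (snd z)) \<in> borel_measurable (time_space T \<mu>)"
      using assms(7) by (simp only: case_prod_beta')
    show "\<bar>\<rho> t \<omega>\<bar> \<le> Hminus_sup_norm \<rho>0" if "t \<in> {0..T}" "\<omega> \<in> Hminus" for t \<omega>
      using assms(8) that by force
  qed (use assms in auto)
  let ?\<Gamma> = "(Hminus_sup_norm \<rho>0)\<^sup>2"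
  have D: "is_transport_derivative T \<mu> k \<rho> (G k)" if "k \<noteq> 0" for k using assms(10) that by blast
  have L2: "G k \<in> L2 M" if "k \<noteq> 0" for k using D[OF that] by (simp add: is_transport_derivative_def)
  have energy: "(\<Sum>k\<in>K. LINT z|M. (cmod (G k z))\<^sup>2) \<le> ?\<Gamma>" if K: "finite K" "0 \<notin> K" for K
  proof -
    have "ennreal (\<Sum>k\<in>K. LINT z|M. (cmod (G k z))\<^sup>2) = (\<Sum>k\<in>K. ennreal (LINT z|M. (cmod (G k z))\<^sup>2))"
      by (rule sum_ennreal[symmetric]) simp
    also have "\<dots> = (\<Sum>k\<in>K. \<integral>\<^sup>+z. ennreal ((cmod (G k z))\<^sup>2) \<partial>M)"
    proof (rule sum.cong[OF refl])
      fix k assume "k \<in> K"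
      then have "k \<noteq> 0" using K(2) by auto
      from L2[OF this] have "integrable M (\<lambda>z. (cmod (G k z))\<^sup>2)" by (simp add: L2_def)
      then show "ennreal (LINT z|M. (cmod (G k z))\<^sup>2) = (\<integral>\<^sup>+z. ennreal ((cmod (G k z))\<^sup>2) \<partial>M)"
        by (intro nn_integral_eq_integral[symmetric]) auto
    qed
    also have "\<dots> = (\<Sum>\<^sub>\<infinity>k\<in>K. \<integral>\<^sup>+z. ennreal ((cmod (G k z))\<^sup>2) \<partial>M)" using K(1) by simp
    also have "\<dots> \<le> (\<Sum>\<^sub>\<infinity>k\<in>UNIV - {0}. \<integral>\<^sup>+z. ennreal ((cmod (G k z))\<^sup>2) \<partial>M)"
      using K by (intro infsum_mono_neutral nonneg_summable_on_complete) auto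
    also have "\<dots> \<le> ennreal ?\<Gamma>" by (rule assms(11))
    finally show ?thesis by (simp add: ennreal_le_iff)
  qed
  have ae: "AE z in M. G k z = 0" if k: "k \<noteq> 0" for k
    by (rule derivative_AE_zero[where G = G and \<Gamma> = ?\<Gamma>]) (fact D energy k)+
  have ae_all: "AE z in M. \<forall>k. k \<noteq> 0 \<longrightarrow> G k z = 0"
    unfolding AE_all_countable using ae by (auto simp: AE_all_countable)
  let ?S = "\<lambda>N (t, \<omega>). 2 * of_real pi * \<i> *
    (\<Sum>k | 0 < norm (real_freq k) \<and> norm (real_freq k) \<le> real N. cpair \<omega> (fourier_mode k) * G k (t, \<omega>))"
  have nz: "k \<noteq> 0" if "0 < norm (real_freq k)" for k
    using that by (auto simp: real_freq_def vec_eq_iff)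
  have S_meas: "?S N \<in> borel_measurable M" for N
  proof -
    have "(\<lambda>z. mode k (snd z)) \<in> borel_measurable M" for k
      by (rule measurable_compose[OF snd_measurable_M mode_measurable])
    moreover have "G k \<in> borel_measurable M" if "0 < norm (real_freq k)" for k
      using L2[OF nz[OF that]] by (simp add: L2_def)
    ultimately have "(\<lambda>z. 2 * of_real pi * \<i> *
      (\<Sum>k | 0 < norm (real_freq k) \<and> norm (real_freq k) \<le> real N. mode k (snd z) * G k z)) \<in> borel_measurable M"
      by (intro borel_measurable_times borel_measurable_const borel_measurable_sum) auto
    then show ?thesis by (simp only: case_prod_beta' prod.collapse)
  qed
  have S0: "AE z in M. ?S N z = 0" for N
    using ae_all by eventually_elim (auto simp: case_prod_beta nz intro!: sum.neutral)
  have norm0: "AE z in M. (cmod (?S N z))\<^sup>2 = 0" for N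
    using S0[of N] by eventually_elim simp
  have sq_meas: "(\<lambda>z. (cmod (?S N z))\<^sup>2) \<in> borel_measurable M" for N
    using S_meas[of N] by measurable
  have int: "integrable M (\<lambda>z. (cmod (?S N z))\<^sup>2)" for N
    using integrable_cong_AE[OF sq_meas borel_measurable_const norm0, of N] by simp
  have "(LINT z|M. (cmod (?S N z - 0))\<^sup>2) = 0" for N
    using integral_eq_zero_AE[OF norm0[of N]] by simp
  then have lim: "(\<lambda>N. LINT z|M. (cmod (?S N z - 0))\<^sup>2) \<longlonglongrightarrow> 0"
    by (simp only: tendsto_const)
  have L2_S: "?S N \<in> L2 M" for N
    unfolding L2_def using S_meas[of N] int[of N] by (intro CollectI conjI)
  have L2_zero: "(\<lambda>_. 0) \<in> L2 M" by (simp add: L2_def)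
  from lim L2_zero have "\<exists>f\<in>L2 M. (\<lambda>N. LINT z|M. (cmod (?S N z - f z))\<^sup>2) \<longlonglongrightarrow> 0"
    by (rule bexI[where x = "\<lambda>_. 0"])
  then show ?thesis
    unfolding L2_convergent_def using L2_S by (intro conjI allI)
qed

end
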